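(* (i) Let $R$ be of type $B_n,C_n,F_4$ or $G_2$. The product $$\Pi_{\hat R}=\prod_{\alpha\in R_+}\Bigl((1-q^{k_\alpha+(\alpha^\vee,\rho+\rho_k)})\prod_{j=1}^{(\alpha^\vee,\rho)}\frac{1-q^{j-1+k_\alpha+(\alpha^\vee,\rho_k)}}{1-q^{j-1+(\alpha^\vee,\rho_k)}}\Bigr)$$ is a regular function, and its rational exponents are proportional to those of $\Pi_{\tilde R}$. The affine duality holds: $$\Pi_{\hat R}(q,k_{\rm lng},k_{\rm sht})=\Pi_{\widehat{R^\vee}}(q,k_{\rm sht},k_{\rm lng}).$$ (ii) For $R=B_n$, $$\Pi_{\hat R}=\frac{\prod_{m=2}^n\prod_{j=0}^{m-1}(1-q^{mk_{\rm lng}+j})\ \prod_{m=0}^{n-1}\prod_{j=0}^{2m+1}(1-q^{2k_{\rm sht}+2mk_{\rm lng}+j})}{(1-q^{k_{\rm lng}})^{n-1}\ \prod_{m=0}^{n-1}\prod_{j=0}^{m}(1-q^{k_{\rm sht}+mk_{\rm lng}+j})},$$ with $\frac{n^2+3n-2}2$ negative affine exponents. The proportional pairs of rational exponents here are $\{mk_{\rm lng}+j,\ lmk_{\rm lng}+lj\}$ with $j/m\notin\mathbb Z$, $lm\le n$, $m>1$. (iii) For $R=G_2$ the positive affine exponents are $2k_{\rm lng}$, $2k_{\rm sht}$, $1+2k_{\rm lng}$, $1+2k_{\rm sht}$ and $j+3k_{\rm lng}+3k_{\rm sht}$ for $j=0,1,2,3,4,5$; the negative ones are $k_{\rm lng}$,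 $k_{\rm sht}$, $k_{\rm lng}+k_{\rm sht}$, $1+k_{\rm lng}+k_{\rm sht}$ (so there are $10/4$ positive/negative exponents). All rational exponents are pairwise not proportional. (iv) For $R=F_4$ the affine exponents are $lk_{\rm lng}+sk_{\rm sht}+j$, $j=0,1,\ldots,l+s-1$, where for the positive ones $[ls]\in\{[20],[02],[30],[03],[24],[42],[44],[66]\}$ and for the negative ones $[ls]\in\{[10],[01],[10],[01],[12],[21],[11],[33]\}$ (with multiplicities; so there are $42/18$ positive/negative exponents). The proportional pairs of rational exponents are $\{[44]+2,[66]+3\}$ and $\{[44]+6,[66]+9\}$, where $[ls]+j$ stands for $lk_{\rm lng}+sk_{\rm sht}+j$.
   Context: $R$ is an irreducible reduced root system with positive roots $R_+$, $\alpha^\vee=2\alpha/(\alpha,\alpha)$, $R^\vee=\{\alpha^\vee\}$ the dual system, $\rho=\frac12\sum_{\alpha\in R_+}\alpha$, $\rho_k=\frac12\sum_{\alpha\in R_+}k_\alpha\alpha$, where $k_\alpha=k_{\rm sht}$ for short and $k_\alpha=k_{\rm lng}$ for long roots. $\Pi_{\hat R}$ is associated with the affine extension $\hat R=\{[\alpha,j]:\alpha\in R,j\in\mathbb Z\}$; $\Pi_{\widehat{R^\vee}}$ is defined by the same formula for $R^\vee$, and its arguments are the values of $k_{\rm lng}$ and $k_{\rm sht}$ for $R^\vee$, in this order. Regular means that all denominators cancel, i.e. $\Pi_{\hat R}$ is a polynomial in $q$, $q^{k_{\rm lng}}$, $q^{k_{\rm sht}}$. Removing coinciding binomials from the numerator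 and denominator (without performing divisions), the exponents $e$ of the remaining binomials $1-q^e$ in the numerator (denominator) are called positive (negative) affine exponents. Rational exponents are the positive affine exponents whose binomials are not divisible by any binomial of the reduced denominator. $\Pi_{\tilde R}$ is the analogous product for $\tilde R=\{[\alpha,\nu_\alpha j]\}$, where $(\alpha,\alpha)=2$ for short roots, $\nu_\alpha=(\alpha,\alpha)/2$, $q_\alpha=q^{\nu_\alpha}$: $\Pi_{\tilde R}=\prod_{\alpha\in R_+}\bigl((1-q_\alpha^{k_\alpha+(\alpha^\vee,\rho+\rho_k)})\prod_{j=1}^{(\alpha^\vee,\rho)}\frac{1-q_\alpha^{j-1+k_\alpha+(\alpha^\vee,\rho_k)}}{1-q_\alpha^{j-1+(\alpha^\vee,\rho_k)}}\bigr)$, with rational exponents defined in the same way. Up to proportionality these are: $\tilde B_n$: $2k_{\rm sht}+1$; $2mk_{\rm lng}+2j$ ($2\le m\le n$, $0<j<m$); $2k_{\rm sht}+2mk_{\rm lng}+2j+1$ ($1\le m<n$, $0\le j\le m$); $\tilde C_n$: the same with $k_{\rm sht}\leftrightarrow k_{\rm lng}$; $\tilde G_2$: $1+2k_{\rm lng}$, $1+2k_{\rm sht}$, $j+3k_{\rm lng}+3k_{\rm sht}$ ($j=1,2,4,5$); $\tilde F_4$: $2+4k_{\rm lng}$, $2+6k_{\rm lng}$, $4+6k_{\rm lng}$, $1+2k_{\rm sht}$, $1+3k_{\rm sht}$, $2+3k_{\rm sht}$, $j+2k_{\rm lng}+2k_{\rm sht}$ ($j=1,3$), $j+8k_{\rm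 lng}+4k_{\rm sht}$ ($j=2,6,10$), $j+2k_{\rm lng}+4k_{\rm sht}$ ($j=1,3,5$), $j+4k_{\rm lng}+4k_{\rm sht}$ ($j=1,3,5,7$), $j+6k_{\rm lng}+6k_{\rm sht}$ ($j=1,3,5,7,9,11$). *)

theory Defs
  imports
    "HOL-Analysis.Analysis"
    "HOL-Library.Multiset"
    "HOL-Computational_Algebra.Computational_Algebra"
begin

section \<open>Root systems\<close>

definition coroot :: "'a::euclidean_space \<Rightarrow> 'a" where
  "coroot \<alpha> = (2 / (\<alpha> \<bullet> \<alpha>)) *\<^sub>R \<alpha>"

definition root_system :: "'a::euclidean_space set \<Rightarrow> bool" where
  "root_system R \<longleftrightarrow>
     finite R \<and> 0 \<notin> R \<and> span R = UNIV \<and>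
     (\<forall>\<alpha>\<in>R. \<forall>\<beta>\<in>R. \<beta> - (coroot \<alpha> \<bullet> \<beta>) *\<^sub>R \<alpha> \<in> R) \<and>
     (\<forall>\<alpha>\<in>R. \<forall>\<beta>\<in>R. coroot \<alpha> \<bullet> \<beta> \<in> \<int>)"

definition reduced_roots :: "'a::euclidean_space set \<Rightarrow> bool" where
  "reduced_roots R \<longleftrightarrow> (\<forall>\<alpha>\<in>R. \<forall>c::real. c *\<^sub>R \<alpha> \<in> R \<longrightarrow> c = 1 \<or> c = -1)"

definition irreducible_roots :: "'a::euclidean_space set \<Rightarrow> bool" where
  "irreducible_roots R \<longleftrightarrow>
     R \<noteq> {} \<and>
     \<not> (\<exists>A B. A \<noteq> {} \<and> B \<noteq> {} \<and> A \<union> B = R \<and> A \<inter> B = {} \<and>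
           (\<forall>\<alpha>\<in>A. \<forall>\<beta>\<in>B. \<alpha> \<bullet> \<beta> = 0))"

definition positive_roots :: "'a::euclidean_space set \<Rightarrow> 'a set \<Rightarrow> bool" where
  "positive_roots R Rp \<longleftrightarrow>
     (\<exists>v. (\<forall>\<alpha>\<in>R. v \<bullet> \<alpha> \<noteq> 0) \<and> Rp = {\<alpha> \<in> R. v \<bullet> \<alpha> > 0})"

text \<open>
  A root system has a given type if it is isomorphic to the standard model of that type.  An
  isomorphism of irreducible root systems is a linear map that preserves the inner product up
  to a positive factor, so the models are written in terms of an arbitrary orthogonal family of
  vectors of equal length (for \<open>G\<^sub>2\<close>: a pair of simple roots).
\<close>

definition orthogonal_frame :: "nat \<Rightarrow> (nat \<Rightarrow> 'a::euclidean_space) \<Rightarrow> bool" where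
  "orthogonal_frame n e \<longleftrightarrow>
     (\<exists>c>0. \<forall>i<n. \<forall>j<n. e i \<bullet> e j = (if i = j then c else 0))"

definition type_B :: "nat \<Rightarrow> 'a::euclidean_space set \<Rightarrow> bool" where
  "type_B n R \<longleftrightarrow> (\<exists>e. orthogonal_frame n e \<and>
     R = {s *\<^sub>R e i | s i. s \<in> {1, -1} \<and> i < n}
       \<union> {s *\<^sub>R e i + t *\<^sub>R e j | s t i j. s \<in> {1, -1} \<and> t \<in> {1, -1} \<and> i < j \<and> j < n})"

definition type_C :: "nat \<Rightarrow> 'a::euclidean_space set \<Rightarrow> bool" where
  "type_C n R \<longleftrightarrow> (\<exists>e. orthogonal_frame n e \<and>
     R = {(2 * s) *\<^sub>R e i | s i. s \<in> {1, -1} \<and> i < n}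
       \<union> {s *\<^sub>R e i + t *\<^sub>R e j | s t i j. s \<in> {1, -1} \<and> t \<in> {1, -1} \<and> i < j \<and> j < n})"

definition type_F4 :: "'a::euclidean_space set \<Rightarrow> bool" where
  "type_F4 R \<longleftrightarrow> (\<exists>e. orthogonal_frame 4 e \<and>
     R = {s *\<^sub>R e i | s i. s \<in> {1, -1} \<and> i < 4}
       \<union> {s *\<^sub>R e i + t *\<^sub>R e j | s t i j. s \<in> {1, -1} \<and> t \<in> {1, -1} \<and> i < j \<and> j < 4}
       \<union> {(1/2) *\<^sub>R (\<Sum>i<4. s i *\<^sub>R e i) | s. \<forall>i<4. s i \<in> {1, -1}})"

definition type_G2 :: "'a::euclidean_space set \<Rightarrow> bool" where
  "type_G2 R \<longleftrightarrow> (\<exists>a b. a \<bullet> a > 0 \<and> b \<bullet> b = 3 * (a \<bullet> a) \<and> a \<bullet> b = - (3/2) * (a \<bullet> a) \<and>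
     (let P = {a, b, a + b, 2 *\<^sub>R a + b, 3 *\<^sub>R a + b, 3 *\<^sub>R a + 2 *\<^sub>R b} in R = P \<union> uminus ` P))"

section \<open>Exponents\<close>

text \<open>
  The exponent \<open>l k\<^sub>l\<^sub>n\<^sub>g + s k\<^sub>s\<^sub>h\<^sub>t + j\<close>, a linear form in the formal parameters, is the
  triple \<open>(l, s, j)\<close>.
\<close>

type_synonym expo = "real \<times> real \<times> real"

definition is_short :: "'a::euclidean_space set \<Rightarrow> 'a \<Rightarrow> bool" where
  "is_short R \<alpha> \<longleftrightarrow> (\<forall>\<beta>\<in>R. norm \<alpha> \<le> norm \<beta>)"

definition k_root :: "'a::euclidean_space set \<Rightarrow> 'a \<Rightarrow> expo" where
  "k_root R \<alpha> = (if is_short R \<alpha> then (0, 1, 0) else (1, 0, 0))"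

definition rho :: "'a::euclidean_space set \<Rightarrow> 'a" where
  "rho Rp = (1/2) *\<^sub>R (\<Sum>\<alpha>\<in>Rp. \<alpha>)"

text \<open>\<open>(\<alpha>\<^sup>\<or>, \<rho>)\<close> and \<open>(\<alpha>\<^sup>\<or>, \<rho>\<^sub>k)\<close>; the latter is a linear form in \<open>k\<close>.\<close>

definition ht :: "'a::euclidean_space set \<Rightarrow> 'a \<Rightarrow> real" where
  "ht Rp \<alpha> = coroot \<alpha> \<bullet> rho Rp"

definition ht_k :: "'a::euclidean_space set \<Rightarrow> 'a set \<Rightarrow> 'a \<Rightarrow> expo" where
  "ht_k R Rp \<alpha> = (1/2) *\<^sub>R (\<Sum>\<beta>\<in>Rp. (coroot \<alpha> \<bullet> \<beta>) *\<^sub>R k_root R \<beta>)"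

definition const_expo :: "real \<Rightarrow> expo" where
  "const_expo c = (0, 0, c)"

definition steps :: "'a::euclidean_space set \<Rightarrow> 'a \<Rightarrow> nat set" where
  "steps Rp \<alpha> = {j. 1 \<le> j \<and> real j \<le> ht Rp \<alpha>}"

text \<open>
  The arguments of \<open>binom\<close> stand for \<open>q\<close>, \<open>q\<^sup>k\<close> for \<open>k = k\<^sub>l\<^sub>n\<^sub>g\<close>, and \<open>q\<^sup>k\<close> for \<open>k = k\<^sub>s\<^sub>h\<^sub>t\<close>.
  The rounding is vacuous on triples of natural numbers, the only ones that occur.
\<close>

fun binom :: "'r::comm_ring_1 \<Rightarrow> 'r \<Rightarrow> 'r \<Rightarrow> expo \<Rightarrow> 'r" where
  "binom q ql qs (l, s, j) = 1 - ql ^ nat \<lfloor>l\<rfloor> * qs ^ nat \<lfloor>s\<rfloor> * q ^ nat \<lfloor>j\<rfloor>"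

definition Pi_hat :: "'a::euclidean_space set \<Rightarrow> 'a set \<Rightarrow> 'k::field \<Rightarrow> 'k \<Rightarrow> 'k \<Rightarrow> 'k" where
  "Pi_hat R Rp q ql qs =
     (\<Prod>\<alpha>\<in>Rp.
        binom q ql qs (k_root R \<alpha> + (const_expo (ht Rp \<alpha>) + ht_k R Rp \<alpha>)) *
        (\<Prod>j\<in>steps Rp \<alpha>.
           binom q ql qs (const_expo (real j - 1) + k_root R \<alpha> + ht_k R Rp \<alpha>) /
           binom q ql qs (const_expo (real j - 1) + ht_k R Rp \<alpha>)))"

text \<open>
  The exponents of the binomials in the product before any cancellation.  Passing from \<open>q\<close> to
  \<open>q\<^sub>\<alpha>\<close> multiplies them by \<open>\<nu>\<^sub>\<alpha>\<close>; the constant \<open>\<nu> = 1\<close> gives the product for the affine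
  extension \<open>[\<alpha>, j]\<close>, and \<open>\<nu> = nu_root R\<close> the one for \<open>[\<alpha>, \<nu>\<^sub>\<alpha> j]\<close>.
\<close>

definition num_expos ::
  "('a::euclidean_space \<Rightarrow> real) \<Rightarrow> 'a set \<Rightarrow> 'a set \<Rightarrow> expo multiset" where
  "num_expos \<nu> R Rp =
     (\<Sum>\<alpha>\<in>Rp.
        {# \<nu> \<alpha> *\<^sub>R (k_root R \<alpha> + (const_expo (ht Rp \<alpha>) + ht_k R Rp \<alpha>)) #} +
        {# \<nu> \<alpha> *\<^sub>R (const_expo (real j - 1) + k_root R \<alpha> + ht_k R Rp \<alpha>).
             j \<in># mset_set (steps Rp \<alpha>) #})"

definition den_expos ::
  "('a::euclidean_space \<Rightarrow> real) \<Rightarrow> 'a set \<Rightarrow> 'a set \<Rightarrow> expo multiset" where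
  "den_expos \<nu> R Rp =
     (\<Sum>\<alpha>\<in>Rp.
        {# \<nu> \<alpha> *\<^sub>R (const_expo (real j - 1) + ht_k R Rp \<alpha>). j \<in># mset_set (steps Rp \<alpha>) #})"

abbreviation nu_one :: "'a::euclidean_space \<Rightarrow> real" where
  "nu_one \<equiv> (\<lambda>_. 1)"

text \<open>
  With the normalization \<open>(\<alpha>, \<alpha>) = 2\<close> for short roots this is \<open>\<nu>\<^sub>\<alpha> = (\<alpha>, \<alpha>) / 2\<close>; the quotient
  makes it independent of the scaling of the inner product.
\<close>

definition nu_root :: "'a::euclidean_space set \<Rightarrow> 'a \<Rightarrow> real" where
  "nu_root R \<alpha> = (\<alpha> \<bullet> \<alpha>) / Min ((\<lambda>\<beta>. \<beta> \<bullet> \<beta>) ` R)"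

definition positive_expos ::
  "('a::euclidean_space \<Rightarrow> real) \<Rightarrow> 'a set \<Rightarrow> 'a set \<Rightarrow> expo multiset" where
  "positive_expos \<nu> R Rp = num_expos \<nu> R Rp - den_expos \<nu> R Rp"

definition negative_expos ::
  "('a::euclidean_space \<Rightarrow> real) \<Rightarrow> 'a set \<Rightarrow> 'a set \<Rightarrow> expo multiset" where
  "negative_expos \<nu> R Rp = den_expos \<nu> R Rp - num_expos \<nu> R Rp"

section \<open>Polynomials and rational functions in \<open>q\<close> and its powers\<close>

text \<open>The parameters are generic: \<open>q\<close> and its two powers are independent variables.\<close>

type_synonym qpoly = "rat poly poly poly"

definition var_q :: qpoly where "var_q = [:[:[:0, 1:]:]:]"
definition var_lng :: qpoly where "var_lng = [:[:0, 1:]:]"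
definition var_sht :: qpoly where "var_sht = [:0, 1:]"

abbreviation q_ind :: "qpoly fract" where "q_ind \<equiv> to_fract var_q"
abbreviation q_lng :: "qpoly fract" where "q_lng \<equiv> to_fract var_lng"
abbreviation q_sht :: "qpoly fract" where "q_sht \<equiv> to_fract var_sht"

definition regular :: "qpoly fract \<Rightarrow> bool" where
  "regular f \<longleftrightarrow> f \<in> range to_fract"

definition rational_expos ::
  "('a::euclidean_space \<Rightarrow> real) \<Rightarrow> 'a set \<Rightarrow> 'a set \<Rightarrow> expo multiset" where
  "rational_expos \<nu> R Rp =
     {# e \<in># positive_expos \<nu> R Rp.
        \<forall>d \<in># negative_expos \<nu> R Rp.
          \<not> binom var_q var_lng var_sht d dvd binom var_q var_lng var_sht e #}"

definition proportional :: "expo \<Rightarrow> expo \<Rightarrow> bool" where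
  "proportional e f \<longleftrightarrow> (\<exists>c. c \<noteq> 0 \<and> f = c *\<^sub>R e)"

text \<open>
  Pairs are two-element submultisets, so that an exponent of multiplicity at least two would
  count as a proportional pair with itself.
\<close>

definition proportional_pairs :: "expo multiset \<Rightarrow> expo multiset set" where
  "proportional_pairs M = {{#e, f#} | e f. {#e, f#} \<subseteq># M \<and> proportional e f}"

text \<open>The exponents \<open>l k\<^sub>l\<^sub>n\<^sub>g + s k\<^sub>s\<^sub>h\<^sub>t + j\<close> with \<open>0 \<le> j < l + s\<close>.\<close>

definition expo_string :: "nat \<times> nat \<Rightarrow> expo multiset" where
  "expo_string = (\<lambda>(l, s). {# (real l, real s, real j). j \<in># mset_set {..<l + s} #})"

end

theory Submission
  imports Defs
begin

text \<open>
  Since \<open>(\<alpha>\<^sup>\<or>, \<rho>)\<close> is the value of \<open>(\<alpha>\<^sup>\<or>, \<rho>\<^sub>k) = l k\<^sub>l\<^sub>n\<^sub>g + s k\<^sub>s\<^sub>h\<^sub>t\<close> at \<open>k = 1\<close>, a positive root contributes to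
  the denominator exactly the string of exponents \<open>l k\<^sub>l\<^sub>n\<^sub>g + s k\<^sub>s\<^sub>h\<^sub>t + j\<close>, \<open>0 \<le> j < l + s\<close>, and to the numerator
  the string over \<open>(\<alpha>\<^sup>\<or>, \<rho>\<^sub>k) + k\<^sub>\<alpha>\<close>.  Different strings are disjoint, so cancellation takes place
  between the pairs \<open>(l, s)\<close>: it telescopes for \<open>B\<^sub>n\<close> and \<open>C\<^sub>n\<close>, and is a finite computation for \<open>F\<^sub>4\<close> and
  \<open>G\<^sub>2\<close>.  The dual system leaves the same pairs with \<open>l\<close> and \<open>s\<close> interchanged, whence the duality.
  A binomial \<open>1 - q\<^sup>d\<close> divides \<open>1 - q\<^sup>e\<close> only if \<open>e\<close> is a multiple of \<open>d\<close>, which decides regularity and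
  the rational exponents.  An arbitrary choice of positive roots is moved to the standard one by
  a product of reflections.
\<close>

section \<open>Divisibility of binomials\<close>

text \<open>Multiset subtraction is truncated, so no cancellation is carried out by subtracting.
  Each one is an identity \<open>num + B = den + A\<close> with \<open>A\<close> and
  \<open>B\<close> disjoint: this determines the positive exponents \<open>A\<close> and the
  negative exponents \<open>B\<close>, and it passes directly to products of binomials.

  The obstacle is the extension \<open>[\<alpha>, \<nu>\<^sub>\<alpha> j]\<close>: strings scaled by
  different factors overlap without being equal, so strings must be split (by parity for B and C)
  before the rest cancels.

  Regularity is obtained without factoring binomials into cyclotomic polynomials: every negative
  exponent is assigned a positive exponent of its own that is a multiple of it.

  The converse, that divisibility forces a multiple, is tested at complex points with exponential
  coordinates, where the vanishing of a binomial is a linear condition modulo 2 pi i.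

  The uncancelled products of \<open>R\<close> and its dual are different, and different roots
  cancel in them; only the results agree. Hence each type has two cancellations to verify with the
  same remainder.\<close>

definition unital_hom :: "('a::comm_ring_1 \<Rightarrow> 'b::comm_ring_1) \<Rightarrow> bool" where
  "unital_hom h \<longleftrightarrow> h 1 = 1 \<and> (\<forall>x y. h (x + y) = h x + h y) \<and> (\<forall>x y. h (x * y) = h x * h y)"

lemma unital_hom_0: "unital_hom h \<Longrightarrow> h 0 = 0"
  unfolding unital_hom_def by (metis add_cancel_right_right)

lemma unital_hom_diff: "unital_hom h \<Longrightarrow> h (x - y) = h x - h y"
  unfolding unital_hom_def by (metis add_diff_cancel_right' diff_add_cancel)

lemma unital_hom_power: "unital_hom h \<Longrightarrow> h (x ^ n) = h x ^ n"
  by (induction n) (auto simp: unital_hom_def)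

text \<open>Evaluates one layer of a nested polynomial ring. The conclusion has the form of the
  premise, so the step can be iterated through all layers.\<close>

lemma unital_hom_poly_map_poly:
  assumes "unital_hom h"
  shows "unital_hom (\<lambda>p. poly (map_poly h p) x)"
proof -
  note h0 = unital_hom_0[OF assms]
  have h1: "h 1 = 1" and ha: "h (a + b) = h a + h b" and hm: "h (a * b) = h a * h b" for a b
    using assms by (auto simp: unital_hom_def)
  have add: "map_poly h (p + r) = map_poly h p + map_poly h r" for p r
    by (intro poly_eqI) (simp add: coeff_map_poly h0 ha)
  have mult: "map_poly h (p * r) = map_poly h p * map_poly h r" for p r
    by (induction p) (simp_all add: add h0 hm map_poly_pCons map_poly_smult)
  show ?thesis
    by (simp add: unital_hom_def add mult h1)
qed

text \<open>\<open>qpoly\<close> is evaluated from the inside out: \<open>q\<close> lives in the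
  innermost layer, then come the variables for long and for short roots. The values can be
  prescribed freely because the variables are independent.\<close>

lemma ex_evaluation:
  "\<exists>h :: qpoly \<Rightarrow> complex. unital_hom h \<and> h var_q = x \<and> h var_lng = y \<and> h var_sht = z"
proof -
  define h0 :: "rat \<Rightarrow> complex" where "h0 = of_rat"
  define h1 where "h1 = (\<lambda>p. poly (map_poly h0 p) x)"
  define h2 where "h2 = (\<lambda>p. poly (map_poly h1 p) y)"
  define h3 where "h3 = (\<lambda>p. poly (map_poly h2 p) z)"
  have 0: "unital_hom h0" by (simp add: unital_hom_def h0_def of_rat_add of_rat_mult)
  have 1: "unital_hom h1" unfolding h1_def by (rule unital_hom_poly_map_poly[OF 0])
  have 2: "unital_hom h2" unfolding h2_def by (rule unital_hom_poly_map_poly[OF 1])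
  have 3: "unital_hom h3" unfolding h3_def by (rule unital_hom_poly_map_poly[OF 2])
  note zero = unital_hom_0[OF 0] unital_hom_0[OF 1] unital_hom_0[OF 2]
  have one: "h0 1 = 1" "h1 1 = 1" "h2 1 = 1" using 0 1 2 by (auto simp: unital_hom_def)
  have c1: "h1 [:c:] = h0 c" "h1 [:0, 1:] = x" for c
    by (simp_all add: h1_def map_poly_pCons zero one)
  have c2: "h2 [:c:] = h1 c" "h2 [:0, 1:] = y" for c
    by (simp_all add: h2_def map_poly_pCons zero one)
  have c3: "h3 [:c:] = h2 c" "h3 [:0, 1:] = z" for c
    by (simp_all add: h3_def map_poly_pCons zero one)
  show ?thesis
    using 3 by (intro exI[of _ h3]) (simp add: var_q_def var_lng_def var_sht_def c1 c2 c3)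
qed

definition nat_expo :: "nat \<times> nat \<times> nat \<Rightarrow> expo" where
  "nat_expo = (\<lambda>(l, s, j). (real l, real s, real j))"

lemma Nats_cube_iff: "e \<in> \<nat> \<times> \<nat> \<times> \<nat> \<longleftrightarrow> e \<in> range nat_expo"
  by (auto simp: nat_expo_def Nats_def image_iff)

lemma binom_nat_expo [simp]:
  "binom q ql qs (nat_expo (l, s, j)) = 1 - ql ^ l * qs ^ s * q ^ j"
  by (simp add: nat_expo_def)

text \<open>With \<open>x\<close> the monomial of \<open>d\<close> this is the geometric sum
  \<open>1 - x ^ c = (1 - x) * (1 + ... + x ^ (c - 1))\<close>; for \<open>c = 0\<close> the
  multiple is the zero binomial.\<close>

lemma binom_dvd_scaleR:
  assumes "d \<in> \<nat> \<times> \<nat> \<times> \<nat>"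
  shows "binom q ql qs d dvd binom q ql qs (real c *\<^sub>R d)"
proof -
  obtain l s j where d: "d = nat_expo (l, s, j)"
    using assms unfolding Nats_cube_iff by auto
  have "real c *\<^sub>R d = nat_expo (c * l, c * s, c * j)"
    by (simp add: d nat_expo_def)
  moreover have "ql ^ (c * l) * qs ^ (c * s) * q ^ (c * j) = (ql ^ l * qs ^ s * q ^ j) ^ c"
    by (simp add: power_mult_distrib power_mult[symmetric] mult.commute)
  ultimately show ?thesis
    using dvd_power_le[of 1] by (simp add: d one_diff_power_eq)
qed

text \<open>A zero of a divisor is a zero of every multiple. At a point with exponential coordinates
  a monomial is the exponential of a linear form, which turns divisibility into linear
  algebra.\<close>

lemma binom_dvd_evaluation:
  fixes a b c :: complex
  assumes "binom var_q var_lng var_sht (nat_expo (l, s, j)) dvd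
           binom var_q var_lng var_sht (nat_expo (l', s', j'))"
    and "exp (of_nat l * a + of_nat s * b + of_nat j * c) = 1"
  shows "exp (of_nat l' * a + of_nat s' * b + of_nat j' * c) = 1"
proof -
  obtain h :: "qpoly \<Rightarrow> complex"
    where h: "unital_hom h" "h var_q = exp c" "h var_lng = exp a" "h var_sht = exp b"
    using ex_evaluation by blast
  have m: "h (x * y) = h x * h y" "h 1 = 1" for x y using h(1) by (auto simp: unital_hom_def)
  have *: "h (binom var_q var_lng var_sht (nat_expo (l, s, j)))
      = 1 - exp (of_nat l * a + of_nat s * b + of_nat j * c)" for l s j
    by (simp add: unital_hom_diff[OF h(1)] m unital_hom_power[OF h(1)] h exp_add exp_of_nat_mult)
  from assms(1) obtain k where "binom var_q var_lng var_sht (nat_expo (l', s', j')) =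
      binom var_q var_lng var_sht (nat_expo (l, s, j)) * k" by (rule dvdE)
  then have "h (binom var_q var_lng var_sht (nat_expo (l', s', j'))) = 0"
    by (simp only: m * assms(2)) simp
  then show ?thesis unfolding * by simp
qed

text \<open>
  If \<open>1 - x\<^sup>d\<close> divides \<open>1 - x\<^sup>e\<close>, then every \<open>w\<close> with \<open>exp (w \<bullet> d) = 1\<close> has \<open>exp (w \<bullet> e) = 1\<close>.
  The choice \<open>w = 2 \<pi> \<i> d / (d \<bullet> d)\<close> shows that \<open>c = (d \<bullet> e) / (d \<bullet> d)\<close> is an integer, and then
  \<open>w = e - c d\<close>, which is orthogonal to \<open>d\<close>, must vanish.
\<close>

lemma binom_dvd_iff:
  assumes "d \<in> \<nat> \<times> \<nat> \<times> \<nat>" "e \<in> \<nat> \<times> \<nat> \<times> \<nat>" "d \<noteq> 0"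
  shows "binom var_q var_lng var_sht d dvd binom var_q var_lng var_sht e \<longleftrightarrow>
    (\<exists>c::nat. e = real c *\<^sub>R d)"
proof
  assume dvd: "binom var_q var_lng var_sht d dvd binom var_q var_lng var_sht e"
  obtain l s j where d: "d = nat_expo (l, s, j)"
    using assms(1) unfolding Nats_cube_iff by auto
  obtain l' s' j' where e: "e = nat_expo (l', s', j')"
    using assms(2) unfolding Nats_cube_iff by auto
  note ev = binom_dvd_evaluation[OF dvd[unfolded d e]]
  define N where "N = real l * real l + real s * real s + real j * real j"
  define c where "c = (real l * real l' + real s * real s' + real j * real j') / N"
  have N: "N > 0"
  proof -
    have "l > 0 \<or> s > 0 \<or> j > 0" using assms(3) by (auto simp: d nat_expo_def zero_prod_def)
    then have "real l * real l > 0 \<or> real s * real s > 0 \<or> real j * real j > 0" by auto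
    then show ?thesis unfolding N_def
      using zero_le_square[of "real l"] zero_le_square[of "real s"] zero_le_square[of "real j"]
      by linarith
  qed
  define w where "w x = 2 * of_real pi * \<i> * of_real (x / N)" for x :: real
  have lin: "of_nat a * w x + of_nat b * w y + of_nat c * w z
      = 2 * of_real pi * \<i> * of_real ((real a * x + real b * y + real c * z) / N)" for a b c x y z
    by (simp add: w_def add_divide_distrib algebra_simps)
  have "exp (of_nat l' * w (real l) + of_nat s' * w (real s) + of_nat j' * w (real j)) = 1"
    using N by (intro ev) (simp add: lin N_def[symmetric])
  then have "exp (2 * of_real pi * \<i> * of_real c) = (1 :: complex)"
    unfolding lin c_def by (simp add: mult.commute add.commute)
  then obtain k :: int where k: "c = of_int k"
    by (auto simp: exp_eq_1)
  have "c \<ge> 0" using N by (simp add: c_def)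
  then obtain m :: nat where m: "c = real m"
    using k by (metis of_int_0_le_iff of_int_of_nat_eq zero_le_imp_eq_int)
  define x y z where "x = real l' - c * l" and "y = real s' - c * s" and "z = real j' - c * j"
  have cN: "c * N = real l * real l' + real s * real s' + real j * real j'"
    using N by (simp add: c_def)
  have perp: "real l * x + real s * y + real j * z = 0"
    using cN unfolding x_def y_def z_def N_def by (simp add: algebra_simps)
  have "exp (of_nat l * of_real x + of_nat s * of_real y + of_nat j * of_real z) = (1 :: complex)"
    using arg_cong[OF perp, of complex_of_real] by simp
  then have "exp (of_nat l' * of_real x + of_nat s' * of_real y + of_nat j' * of_real z) = (1 :: complex)"
    by (rule ev)
  \<comment> \<open>At this second point the exponent is real, where \<open>exp\<close> takes the
    value 1 only at 0; no multiple of 2 pi i remains.\<close>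
  then have "exp (complex_of_real (real l' * x + real s' * y + real j' * z)) = 1"
    by simp
  then have "real l' * x + real s' * y + real j' * z = 0"
    by (metis exp_of_real of_real_eq_1_iff exp_eq_one_iff)
  \<comment> \<open>\<open>(l', s', j')\<close> is \<open>(x, y, z)\<close> plus a multiple of
    \<open>(l, s, j)\<close>, which is orthogonal to \<open>(x, y, z)\<close>; its inner product
    with \<open>(x, y, z)\<close> is therefore the squared length.\<close>
  then have "x * x + y * y + z * z = 0"
    using perp unfolding x_def y_def z_def by algebra
  then have "x = 0" "y = 0" "z = 0"
    by (smt (verit) zero_le_square mult_eq_0_iff)+
  then have "e = real m *\<^sub>R d"
    unfolding d e m[symmetric] by (simp add: x_def y_def z_def nat_expo_def)
  then show "\<exists>c::nat. e = real c *\<^sub>R d" ..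
next
  assume "\<exists>c::nat. e = real c *\<^sub>R d"
  then show "binom var_q var_lng var_sht d dvd binom var_q var_lng var_sht e"
    using binom_dvd_scaleR[OF assms(1)] by blast
qed

text \<open>Setting all three variables to 2 gives \<open>1 - 2 ^ (l + s + j)\<close>, which
  vanishes only for the zero exponent.\<close>

lemma binom_var_neq_0:
  assumes "e \<in> \<nat> \<times> \<nat> \<times> \<nat>" "e \<noteq> 0"
  shows "binom var_q var_lng var_sht e \<noteq> 0"
proof
  assume 0: "binom var_q var_lng var_sht e = 0"
  obtain l s j where e: "e = nat_expo (l, s, j)"
    using assms(1) unfolding Nats_cube_iff by auto
  obtain h :: "qpoly \<Rightarrow> complex" where h: "unital_hom h" "h var_q = 2" "h var_lng = 2" "h var_sht = 2"
    using ex_evaluation by blast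
  have m: "h (x * y) = h x * h y" "h 1 = 1" for x y using h(1) by (auto simp: unital_hom_def)
  have "h (binom var_q var_lng var_sht e) = 1 - 2 ^ (l + s + j)"
    by (simp add: e unital_hom_diff[OF h(1)] m unital_hom_power[OF h(1)] h power_add)
  with 0 have "(2 :: complex) ^ (l + s + j) = 1"
    by (simp add: unital_hom_0[OF h(1)])
  then have "norm ((2 :: complex) ^ (l + s + j)) = 1" by simp
  then have "(2 :: real) ^ (l + s + j) = 1" by (simp add: norm_power)
  then have "l + s + j = 0" by (metis one_less_numeral_iff power_eq_1_iff power_inject_exp power_0 semiring_norm(76))
  then show False using assms(2) by (simp add: e nat_expo_def zero_prod_def)
qed

section \<open>Contributions of single roots\<close>

lemma coroot_coroot [simp]: "coroot (coroot \<alpha>) = \<alpha>"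
  by (cases "\<alpha> = 0") (simp_all add: coroot_def power2_eq_square field_simps)

lemma inj_coroot: "inj_on coroot A"
  by (metis coroot_coroot inj_on_inverseI)

lemma norm_coroot: "norm (coroot \<alpha>) = 2 / norm \<alpha>"
  by (cases "\<alpha> = 0")
    (simp_all add: coroot_def power2_norm_eq_inner[symmetric] power2_eq_square field_simps)

definition num_contrib :: "('a::euclidean_space \<Rightarrow> real) \<Rightarrow> 'a set \<Rightarrow> 'a set \<Rightarrow> 'a \<Rightarrow> expo multiset" where
  "num_contrib \<nu> R Rp \<alpha> =
     {# \<nu> \<alpha> *\<^sub>R (k_root R \<alpha> + (const_expo (ht Rp \<alpha>) + ht_k R Rp \<alpha>)) #} +
     {# \<nu> \<alpha> *\<^sub>R (const_expo (real j - 1) + k_root R \<alpha> + ht_k R Rp \<alpha>). j \<in># mset_set (steps Rp \<alpha>) #}"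

definition den_contrib :: "('a::euclidean_space \<Rightarrow> real) \<Rightarrow> 'a set \<Rightarrow> 'a set \<Rightarrow> 'a \<Rightarrow> expo multiset" where
  "den_contrib \<nu> R Rp \<alpha> =
     {# \<nu> \<alpha> *\<^sub>R (const_expo (real j - 1) + ht_k R Rp \<alpha>). j \<in># mset_set (steps Rp \<alpha>) #}"

lemma num_expos_sum: "num_expos \<nu> R Rp = (\<Sum>\<alpha>\<in>Rp. num_contrib \<nu> R Rp \<alpha>)"
  by (simp only: num_expos_def num_contrib_def)

lemma den_expos_sum: "den_expos \<nu> R Rp = (\<Sum>\<alpha>\<in>Rp. den_contrib \<nu> R Rp \<alpha>)"
  by (simp only: den_expos_def den_contrib_def)

text \<open>The Boolean marks a short root: the pair of
  \<open>(\<alpha>\<^sup>\<or>, \<rho>\<^sub>k)\<close> goes to that of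
  \<open>(\<alpha>\<^sup>\<or>, \<rho>\<^sub>k) + k\<^sub>\<alpha>\<close>.\<close>

definition add_k :: "bool \<Rightarrow> nat \<times> nat \<Rightarrow> nat \<times> nat" where
  "add_k sh = (\<lambda>(l, s). if sh then (l, s + 1) else (l + 1, s))"

text \<open>Each \<open>k_root\<close> is a unit vector in one of the first two coordinates, so
  adding these coordinates replaces every weight by 1.\<close>

lemma ht_eq: "ht Rp \<alpha> = fst (ht_k R Rp \<alpha>) + fst (snd (ht_k R Rp \<alpha>))"
proof -
  have "ht Rp \<alpha> = (1/2) * (\<Sum>\<beta>\<in>Rp. coroot \<alpha> \<bullet> \<beta>)"
    by (simp add: ht_def rho_def inner_sum_right)
  also have "\<dots> = (1/2) * (\<Sum>\<beta>\<in>Rp. fst ((coroot \<alpha> \<bullet> \<beta>) *\<^sub>R k_root R \<beta>)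
      + fst (snd ((coroot \<alpha> \<bullet> \<beta>) *\<^sub>R k_root R \<beta>)))"
    by (simp add: k_root_def if_distrib cong: if_cong)
  finally show ?thesis
    by (simp add: ht_k_def fst_sum snd_sum sum.distrib ring_distribs)
qed

text \<open>The constants \<open>j - 1\<close> with \<open>1 \<le> j \<le> l + s\<close> fill the
  string over \<open>(l, s)\<close>. In the numerator \<open>k\<^sub>\<alpha>\<close> makes the
  string one place longer, and the missing constant \<open>l + s\<close> is supplied by the factor
  outside the inner product.\<close>

lemma contrib_eq:
  assumes "ht_k R Rp \<alpha> = (real l, real s, 0)"
  shows "num_contrib \<nu> R Rp \<alpha> =
      image_mset ((*\<^sub>R) (\<nu> \<alpha>)) (expo_string (add_k (is_short R \<alpha>) (l, s)))" (is ?num)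
    and "den_contrib \<nu> R Rp \<alpha> = image_mset ((*\<^sub>R) (\<nu> \<alpha>)) (expo_string (l, s))" (is ?den)
    and "ht Rp \<alpha> \<in> \<nat>"
proof -
  have ht: "ht Rp \<alpha> = real (l + s)"
    by (simp add: ht_eq[of _ _ R] assms)
  then show "ht Rp \<alpha> \<in> \<nat>" by (simp only: of_nat_in_Nats)
  have steps: "mset_set (steps Rp \<alpha>) = image_mset Suc (mset_set {..<l + s})"
  proof -
    have "steps Rp \<alpha> = {1..l + s}"
      unfolding steps_def ht of_nat_le_iff by auto
    then show ?thesis
      by (simp add: image_mset_mset_set image_Suc_lessThan)
  qed
  have up: "mset_set {..<Suc n} = add_mset n (mset_set {..<n})" for n
    by (simp add: lessThan_Suc)
  show ?num
    unfolding num_contrib_def steps ht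
    by (auto simp: assms expo_string_def add_k_def k_root_def const_expo_def up
        image_mset.compositionality o_def algebra_simps)
  show ?den
    unfolding den_contrib_def steps
    by (simp add: assms expo_string_def const_expo_def image_mset.compositionality o_def)
qed

lemma image_mset_scaleR_1: "image_mset ((*\<^sub>R) 1) (M :: expo multiset) = M"
  by (induction M) simp_all

text \<open>The string over \<open>(0, 0)\<close> is empty, so every exponent that occurs has a
  positive coefficient.\<close>

lemma expo_string_cube:
  assumes "c > 0" "e \<in># image_mset ((*\<^sub>R) (real c)) (expo_string p)"
  shows "e \<in> \<nat> \<times> \<nat> \<times> \<nat> \<and> e \<noteq> 0"
  using assms by (cases p) (auto simp: expo_string_def zero_prod_def)

section \<open>The product and its cancellations\<close>

lemma prod_mset_image_sum:
  "prod_mset (image_mset f (\<Sum>x\<in>A. M x)) = (\<Prod>x\<in>A. prod_mset (image_mset f (M x)))"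
  by (induction A rule: infinite_finite_induct) auto

lemma Pi_hat_eq_prod_mset:
  "Pi_hat R Rp q ql qs =
    prod_mset (image_mset (binom q ql qs) (num_expos nu_one R Rp)) /
    prod_mset (image_mset (binom q ql qs) (den_expos nu_one R Rp))"
proof -
  have "Pi_hat R Rp q ql qs = (\<Prod>\<alpha>\<in>Rp.
      prod_mset (image_mset (binom q ql qs) (num_contrib nu_one R Rp \<alpha>)) /
      prod_mset (image_mset (binom q ql qs) (den_contrib nu_one R Rp \<alpha>)))"
    unfolding Pi_hat_def num_contrib_def den_contrib_def
    by (intro prod.cong refl)
      (simp only: image_mset_union prod_mset.union image_mset_add_mset image_mset_empty
        prod_mset.add_mset prod_mset.empty image_mset.compositionality o_def scaleR_one
        prod_unfold_prod_mset[symmetric] prod_dividef mult_1_right times_divide_eq_right)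
  then show ?thesis
    by (simp only: prod_dividef num_expos_sum den_expos_sum prod_mset_image_sum)
qed

text \<open>Equality of quotients in cross-multiplied form: sums of multisets become products of
  binomials, and the binomials of both denominators are nonzero.\<close>

lemma Pi_hat_balanced:
  assumes "num_expos nu_one R Rp + B = den_expos nu_one R Rp + A"
    and "\<And>e. e \<in># den_expos nu_one R Rp + B \<Longrightarrow> binom q ql qs e \<noteq> 0"
  shows "Pi_hat R Rp q ql qs =
    prod_mset (image_mset (binom q ql qs) A) / prod_mset (image_mset (binom q ql qs) B)"
proof -
  let ?P = "\<lambda>M. prod_mset (image_mset (binom q ql qs) M)"
  have "?P (num_expos nu_one R Rp) * ?P B = ?P (den_expos nu_one R Rp) * ?P A"
    using arg_cong[OF assms(1), of ?P] by simp
  moreover have "?P (den_expos nu_one R Rp) \<noteq> 0" "?P B \<noteq> 0"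
    using assms(2) by auto
  ultimately show ?thesis
    by (simp add: Pi_hat_eq_prod_mset field_simps)
qed

text \<open>At each point at most one of the disjoint \<open>A\<close> and \<open>B\<close> has a
  positive count, so they are the positive and negative parts of the difference of counts, which is
  what the truncated subtractions compute.\<close>

lemma balanced_cancel:
  assumes "num_expos \<nu> R Rp + B = den_expos \<nu> R Rp + A" and "A \<inter># B = {#}"
  shows "positive_expos \<nu> R Rp = A" and "negative_expos \<nu> R Rp = B"
proof -
  have *: "count (num_expos \<nu> R Rp) x + count B x = count (den_expos \<nu> R Rp) x + count A x" for x
    using arg_cong[OF assms(1), of "\<lambda>M. count M x"] by simp
  have "min (count A x) (count B x) = 0" for x
    using arg_cong[OF assms(2), of "\<lambda>M. count M x"] by simp
  then have **: "count A x = 0 \<or> count B x = 0" for x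
    by (metis min_def)
  show "positive_expos \<nu> R Rp = A"
    unfolding positive_expos_def
  proof (rule multiset_eqI)
    show "count (num_expos \<nu> R Rp - den_expos \<nu> R Rp) x = count A x" for x
      using *[of x] **[of x] by auto
  qed
  show "negative_expos \<nu> R Rp = B"
    unfolding negative_expos_def
  proof (rule multiset_eqI)
    show "count (den_expos \<nu> R Rp - num_expos \<nu> R Rp) x = count B x" for x
      using *[of x] **[of x] by auto
  qed
qed

definition nat_multiple :: "expo \<Rightarrow> expo \<Rightarrow> bool" where
  "nat_multiple d e \<longleftrightarrow> (\<exists>c::nat. e = real c *\<^sub>R d)"

text \<open>The survivors of a cancellation lie in the original multisets, hence are nonzero natural
  triples, and divisibility of their binomials becomes the arithmetic relation
  \<open>nat_multiple\<close>.\<close>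

lemma rational_expos_balanced:
  assumes bal: "num_expos \<nu> R Rp + B = den_expos \<nu> R Rp + A" and disj: "A \<inter># B = {#}"
    and cube: "\<And>e. e \<in># num_expos \<nu> R Rp + den_expos \<nu> R Rp \<Longrightarrow> e \<in> \<nat> \<times> \<nat> \<times> \<nat> \<and> e \<noteq> 0"
  shows "rational_expos \<nu> R Rp = {# e \<in># A. \<forall>d\<in>#B. \<not> nat_multiple d e #}"
proof -
  note pn = balanced_cancel[OF bal disj]
  have "A \<subseteq># num_expos \<nu> R Rp" "B \<subseteq># den_expos \<nu> R Rp"
    using pn unfolding positive_expos_def negative_expos_def by (metis diff_subset_eq_self)+
  then have "e \<in># A \<Longrightarrow> e \<in> \<nat> \<times> \<nat> \<times> \<nat>" "e \<in># B \<Longrightarrow> e \<in> \<nat> \<times> \<nat> \<times> \<nat> \<and> e \<noteq> 0" for e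
    using cube[of e] by (auto dest: mset_subset_eqD)
  then show ?thesis
    unfolding rational_expos_def pn nat_multiple_def
    by (intro filter_mset_cong refl ball_cong arg_cong[of _ _ Not]) (simp add: binom_dvd_iff)
qed

lemma rel_mset_add:
  assumes "rel_mset Q A B" "rel_mset Q C D"
  shows "rel_mset Q (A + C) (B + D)"
proof -
  obtain as bs cs ds where "mset as = A" "mset bs = B" "list_all2 Q as bs"
    "mset cs = C" "mset ds = D" "list_all2 Q cs ds"
    using assms unfolding rel_mset_def by blast
  then show ?thesis
    unfolding rel_mset_def
    by (intro exI[of _ "as @ cs"] exI[of _ "bs @ ds"]) (auto intro: list_all2_appendI)
qed

lemma rel_mset_image_image:
  "(\<And>x. x \<in># M \<Longrightarrow> Q (f x) (g x)) \<Longrightarrow> rel_mset Q (image_mset f M) (image_mset g M)"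
  by (simp add: multiset.rel_map multiset.rel_refl_strong)

text \<open>\<open>A'\<close> assigns to each factor of the denominator its own factor of the
  numerator, multiplicities included; the products then divide factor by factor.\<close>

lemma prod_binom_dvd:
  assumes "rel_mset nat_multiple B A'" "A' \<subseteq># A" "\<And>d. d \<in># B \<Longrightarrow> d \<in> \<nat> \<times> \<nat> \<times> \<nat>"
  shows "prod_mset (image_mset (binom q ql qs) B) dvd prod_mset (image_mset (binom q ql qs) A)"
proof -
  obtain xs ys where xy: "mset xs = B" "mset ys = A'" "list_all2 nat_multiple xs ys"
    using assms(1) unfolding rel_mset_def by blast
  have *: "list_all2 nat_multiple xs ys \<Longrightarrow> \<forall>d\<in>set xs. d \<in> \<nat> \<times> \<nat> \<times> \<nat> \<Longrightarrow>
      prod_mset (image_mset (binom q ql qs) (mset xs)) dvd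
      prod_mset (image_mset (binom q ql qs) (mset ys))"
  proof (induction rule: list_all2_induct)
    case (Cons d xs e ys)
    obtain c :: nat where "e = real c *\<^sub>R d"
      using Cons.hyps(1) unfolding nat_multiple_def by blast
    moreover have "d \<in> \<nat> \<times> \<nat> \<times> \<nat>" using Cons.prems by simp
    ultimately have "binom q ql qs d dvd binom q ql qs e"
      using binom_dvd_scaleR by blast
    moreover have "prod_mset (image_mset (binom q ql qs) (mset xs)) dvd
        prod_mset (image_mset (binom q ql qs) (mset ys))"
      using Cons.IH Cons.prems by simp
    ultimately show ?case
      by (simp only: mset.simps image_mset_add_mset prod_mset.add_mset mult_dvd_mono)
  qed simp
  have "\<forall>d\<in>set xs. d \<in> \<nat> \<times> \<nat> \<times> \<nat>"
    using assms(3) xy(1) by auto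
  from *[OF xy(3) this]
  have "prod_mset (image_mset (binom q ql qs) B) dvd prod_mset (image_mset (binom q ql qs) A')"
    by (simp only: xy)
  also have "\<dots> dvd prod_mset (image_mset (binom q ql qs) A)"
    by (intro prod_mset_subset_imp_dvd image_mset_subseteq_mono assms(2))
  finally show ?thesis .
qed

lemma to_fract_power [simp]: "to_fract (x ^ n) = to_fract x ^ n"
  by (induction n) simp_all

lemma to_fract_prod_mset: "to_fract (prod_mset M) = prod_mset (image_mset to_fract M)"
  by (induction M) simp_all

lemma to_fract_binom: "to_fract (binom q ql qs e) = binom (to_fract q) (to_fract ql) (to_fract qs) e"
  by (cases e) simp

definition swap_expo :: "expo \<Rightarrow> expo" where
  "swap_expo = (\<lambda>(l, s, j). (s, l, j))"

lemma binom_swap_expo: "binom q ql qs (swap_expo e) = binom q qs ql e"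
  by (cases e) (simp add: swap_expo_def mult.commute)

lemma swap_expo_cube: "swap_expo e \<in> \<nat> \<times> \<nat> \<times> \<nat> \<longleftrightarrow> e \<in> \<nat> \<times> \<nat> \<times> \<nat>"
  "swap_expo e = 0 \<longleftrightarrow> e = 0" "swap_expo (swap_expo e) = e"
  by (auto simp: swap_expo_def zero_prod_def split: prod.splits)

lemma image_swap_expo_string:
  "image_mset swap_expo (expo_string (l, s)) = expo_string (s, l)"
  by (simp add: expo_string_def swap_expo_def image_mset.compositionality o_def add.commute)

section \<open>Systems with two root lengths\<close>

text \<open>The squared lengths are \<open>m\<close> for short and \<open>r * m\<close> for long
  roots. The ratio \<open>r\<close> is a natural number because it reappears as the scale \<nu> of
  the long roots.\<close>

locale two_length_roots =
  fixes R Rp :: "'a::euclidean_space set" and m :: real and r :: nat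
  assumes finite: "finite Rp" and R_eq: "R = Rp \<union> uminus ` Rp"
    and m_pos: "0 < m" and r_gt: "1 < r"
    and lengths: "\<alpha> \<in> Rp \<Longrightarrow> \<alpha> \<bullet> \<alpha> = m \<or> \<alpha> \<bullet> \<alpha> = r * m"
    and ex_short: "\<exists>\<alpha>\<in>Rp. \<alpha> \<bullet> \<alpha> = m" and ex_long: "\<exists>\<alpha>\<in>Rp. \<alpha> \<bullet> \<alpha> = r * m"
begin

text \<open>Twice the long part of \<rho>: together, \<open>2 \<rho>\<^sub>k =
  k\<^sub>l\<^sub>n\<^sub>g long_sum + k\<^sub>s\<^sub>h\<^sub>t short_sum\<close>.\<close>

definition long_sum :: 'a where "long_sum = (\<Sum>\<beta>\<in>{\<beta>\<in>Rp. \<beta> \<bullet> \<beta> \<noteq> m}. \<beta>)"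
definition short_sum :: 'a where "short_sum = (\<Sum>\<beta>\<in>{\<beta>\<in>Rp. \<beta> \<bullet> \<beta> = m}. \<beta>)"

lemma m_less: "m < r * m"
  using m_pos r_gt by simp

lemma R_lengths: "\<alpha> \<in> R \<Longrightarrow> \<alpha> \<bullet> \<alpha> = m \<or> \<alpha> \<bullet> \<alpha> = r * m"
  by (auto simp: R_eq dest: lengths)

lemma m_le: "\<beta> \<in> R \<Longrightarrow> m \<le> \<beta> \<bullet> \<beta>" and le_rm: "\<beta> \<in> R \<Longrightarrow> \<beta> \<bullet> \<beta> \<le> r * m"
  using R_lengths[of \<beta>] m_less by auto

lemma is_short_iff:
  assumes "\<alpha> \<in> Rp"
  shows "is_short R \<alpha> \<longleftrightarrow> \<alpha> \<bullet> \<alpha> = m"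
proof -
  obtain \<beta> where \<beta>: "\<beta> \<in> R" "\<beta> \<bullet> \<beta> = m"
    using ex_short by (auto simp: R_eq)
  have "is_short R \<alpha> \<longleftrightarrow> \<alpha> \<bullet> \<alpha> \<le> m"
    unfolding is_short_def norm_le using \<beta> m_le order_trans by metis
  also have "\<dots> \<longleftrightarrow> \<alpha> \<bullet> \<alpha> = m"
    using m_le[of \<alpha>] assms by (auto simp: R_eq)
  finally show ?thesis .
qed

text \<open>A coroot has norm \<open>2 / norm \<alpha>\<close>, so passing to the dual reverses the
  order of lengths.\<close>

lemma is_short_coroot_iff:
  assumes "\<alpha> \<in> Rp"
  shows "is_short (coroot ` R) (coroot \<alpha>) \<longleftrightarrow> \<alpha> \<bullet> \<alpha> \<noteq> m"
proof -
  have pos: "\<beta> \<in> R \<Longrightarrow> norm \<beta> > 0" for \<beta>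
    using m_le[of \<beta>] m_pos by auto
  have "2 / norm \<alpha> \<le> 2 / norm \<beta> \<longleftrightarrow> norm \<beta> \<le> norm \<alpha>" if "\<beta> \<in> R" for \<beta>
    using pos[OF that] pos[of \<alpha>] assms by (simp add: R_eq field_simps)
  then have "is_short (coroot ` R) (coroot \<alpha>) \<longleftrightarrow> (\<forall>\<beta>\<in>R. norm \<beta> \<le> norm \<alpha>)"
    unfolding is_short_def by (simp add: norm_coroot)
  also have "\<dots> \<longleftrightarrow> r * m \<le> \<alpha> \<bullet> \<alpha>"
  proof -
    obtain \<beta> where "\<beta> \<in> R" "\<beta> \<bullet> \<beta> = r * m"
      using ex_long by (auto simp: R_eq)
    then show ?thesis unfolding norm_le using le_rm order_trans by metis
  qed
  also have "\<dots> \<longleftrightarrow> \<alpha> \<bullet> \<alpha> \<noteq> m"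
    using lengths[OF assms] m_less by auto
  finally show ?thesis .
qed

lemma nu_root_eq: "\<alpha> \<in> Rp \<Longrightarrow> nu_root R \<alpha> = (if \<alpha> \<bullet> \<alpha> = m then 1 else real r)"
proof -
  assume \<alpha>: "\<alpha> \<in> Rp"
  have "Min ((\<lambda>\<beta>. \<beta> \<bullet> \<beta>) ` R) = m"
    using finite ex_short m_le by (intro Min_eqI) (auto simp: R_eq)
  then show ?thesis
    using lengths[OF \<alpha>] m_pos by (auto simp: nu_root_def)
qed

text \<open>The 2 in the coroot cancels the 1/2 in \<rho>, which leaves the quotients of
  \<open>\<alpha> \<bullet> long_sum\<close> and \<open>\<alpha> \<bullet> short_sum\<close> by
  \<open>\<alpha> \<bullet> \<alpha>\<close>.\<close>

lemma ht_k_eq: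
  assumes "\<alpha> \<in> Rp" "\<alpha> \<bullet> long_sum = x * (\<alpha> \<bullet> \<alpha>)" "\<alpha> \<bullet> short_sum = y * (\<alpha> \<bullet> \<alpha>)"
  shows "ht_k R Rp \<alpha> = (x, y, 0)"
proof -
  have pos: "\<alpha> \<bullet> \<alpha> \<noteq> 0" using lengths[OF assms(1)] m_pos m_less by auto
  have "(\<Sum>\<beta>\<in>Rp. (coroot \<alpha> \<bullet> \<beta>) *\<^sub>R k_root R \<beta>) =
      (\<Sum>\<beta>\<in>Rp. (if \<beta> \<bullet> \<beta> \<noteq> m then coroot \<alpha> \<bullet> \<beta> else 0, if \<beta> \<bullet> \<beta> = m then coroot \<alpha> \<bullet> \<beta> else 0, 0))"
    by (intro sum.cong refl) (auto simp: k_root_def is_short_iff)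
  also have "\<dots> = (coroot \<alpha> \<bullet> long_sum, coroot \<alpha> \<bullet> short_sum, 0)"
    by (simp add: prod_eq_iff fst_sum snd_sum long_sum_def short_sum_def inner_sum_right
        flip: sum.inter_filter[OF finite])
  finally show ?thesis
    using assms(2,3) pos by (simp add: ht_k_def coroot_def)
qed

text \<open>The coroot of \<open>coroot \<alpha>\<close> is \<alpha>, and the sum runs over the
  coroots of all \<beta>. Hence the divisors are the squared lengths \<open>r * m\<close> and
  \<open>m\<close> of the \<beta>, not that of \<alpha>; \<open>y\<close> comes first because short
  \<beta> have long coroots.\<close>

lemma dual_ht_k_eq:
  assumes "\<alpha> \<in> Rp" "\<alpha> \<bullet> long_sum = x * (r * m)" "\<alpha> \<bullet> short_sum = y * m"
  shows "ht_k (coroot ` R) (coroot ` Rp) (coroot \<alpha>) = (y, x, 0)"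
proof -
  have "(\<Sum>\<beta>\<in>coroot ` Rp. (\<alpha> \<bullet> \<beta>) *\<^sub>R k_root (coroot ` R) \<beta>) =
      (\<Sum>\<beta>\<in>Rp. (\<alpha> \<bullet> coroot \<beta>) *\<^sub>R k_root (coroot ` R) (coroot \<beta>))"
    by (simp add: sum.reindex[OF inj_coroot])
  also have "\<dots> = (\<Sum>\<beta>\<in>Rp. (if \<beta> \<bullet> \<beta> = m then 2 / m * (\<alpha> \<bullet> \<beta>) else 0,
        if \<beta> \<bullet> \<beta> \<noteq> m then 2 / (r * m) * (\<alpha> \<bullet> \<beta>) else 0, 0))"
  proof (intro sum.cong refl)
    fix \<beta> assume \<beta>: "\<beta> \<in> Rp"
    have "\<alpha> \<bullet> coroot \<beta> = 2 / (\<beta> \<bullet> \<beta>) * (\<alpha> \<bullet> \<beta>)"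
      by (simp add: coroot_def)
    then show "(\<alpha> \<bullet> coroot \<beta>) *\<^sub>R k_root (coroot ` R) (coroot \<beta>) =
        (if \<beta> \<bullet> \<beta> = m then 2 / m * (\<alpha> \<bullet> \<beta>) else 0,
         if \<beta> \<bullet> \<beta> \<noteq> m then 2 / (r * m) * (\<alpha> \<bullet> \<beta>) else 0, 0)"
      using lengths[OF \<beta>] by (cases "\<beta> \<bullet> \<beta> = m") (simp_all add: k_root_def is_short_coroot_iff[OF \<beta>])
  qed
  also have "\<dots> = (2 / m * (\<alpha> \<bullet> short_sum), 2 / (r * m) * (\<alpha> \<bullet> long_sum), 0)"
    by (simp add: prod_eq_iff fst_sum snd_sum long_sum_def short_sum_def inner_sum_right
        sum_distrib_left flip: sum.inter_filter[OF finite])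
  finally show ?thesis
    using assms(2,3) m_pos m_less r_gt by (simp add: ht_k_def)
qed

lemma contrib:
  assumes "\<alpha> \<in> Rp" "\<alpha> \<bullet> long_sum = real l * (\<alpha> \<bullet> \<alpha>)" "\<alpha> \<bullet> short_sum = real s * (\<alpha> \<bullet> \<alpha>)"
  shows "num_contrib \<nu> R Rp \<alpha> =
      image_mset ((*\<^sub>R) (\<nu> \<alpha>)) (expo_string (add_k (\<alpha> \<bullet> \<alpha> = m) (l, s)))"
    and "den_contrib \<nu> R Rp \<alpha> = image_mset ((*\<^sub>R) (\<nu> \<alpha>)) (expo_string (l, s))"
    and "ht Rp \<alpha> \<in> \<nat>"
  using contrib_eq[OF ht_k_eq[OF assms]] by (simp_all add: is_short_iff[OF assms(1)])

text \<open>The dual pair is kept in the order of the original system and swapped as a whole. The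
  flag of \<open>add_k\<close> remains that of \<alpha>, since the swap also exchanges the slot that
  is raised.\<close>

lemma dual_contrib:
  assumes "\<alpha> \<in> Rp" "\<alpha> \<bullet> long_sum = real l * (r * m)" "\<alpha> \<bullet> short_sum = real s * m"
  shows "num_contrib nu_one (coroot ` R) (coroot ` Rp) (coroot \<alpha>) =
      image_mset swap_expo (expo_string (add_k (\<alpha> \<bullet> \<alpha> = m) (l, s)))"
    and "den_contrib nu_one (coroot ` R) (coroot ` Rp) (coroot \<alpha>) =
      image_mset swap_expo (expo_string (l, s))"
  using contrib_eq(1,2)[OF dual_ht_k_eq[OF assms], of nu_one]
  by (auto simp: is_short_coroot_iff[OF assms(1)] image_swap_expo_string add_k_def image_mset_scaleR_1)

end

section \<open>Moving a chamber to the dominant one\<close>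

lemma reflection_orthogonal:
  assumes "\<alpha> \<noteq> 0"
  shows "orthogonal_transformation (\<lambda>x. x - (coroot \<alpha> \<bullet> x) *\<^sub>R \<alpha>)"
proof -
  have "linear (\<lambda>x. x - (coroot \<alpha> \<bullet> x) *\<^sub>R \<alpha>)"
    by (rule linearI) (simp_all add: inner_add_right algebra_simps)
  moreover have "(x - (coroot \<alpha> \<bullet> x) *\<^sub>R \<alpha>) \<bullet> (y - (coroot \<alpha> \<bullet> y) *\<^sub>R \<alpha>) = x \<bullet> y" for x y
    using assms by (simp add: coroot_def inner_diff_left inner_diff_right inner_commute field_simps)
  ultimately show ?thesis
    unfolding orthogonal_transformation_def by blast
qed

text \<open>
  Among the isometries \<open>w\<close> preserving \<open>R\<close>, choose one that maximizes \<open>(v, w \<delta>)\<close> for a strictly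
  dominant \<open>\<delta>\<close>: if \<open>(v, w \<alpha>) < 0\<close> for a simple root \<open>\<alpha>\<close>, then \<open>w s\<^sub>\<alpha>\<close> would give a larger value.
\<close>

lemma ex_dominant_isometry:
  fixes R :: "'a::euclidean_space set"
  assumes R: "root_system R" and \<Delta>: "\<Delta> \<subseteq> R" and v: "\<And>\<alpha>. \<alpha> \<in> R \<Longrightarrow> v \<bullet> \<alpha> \<noteq> 0"
    and \<delta>: "\<And>\<alpha>. \<alpha> \<in> \<Delta> \<Longrightarrow> \<alpha> \<bullet> \<delta> > 0"
  obtains w where "orthogonal_transformation w" "w ` R = R" "\<And>\<alpha>. \<alpha> \<in> \<Delta> \<Longrightarrow> v \<bullet> w \<alpha> > 0"
proof -
  have fin: "finite R" and span: "span R = UNIV" and "0 \<notin> R"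
    and refl: "\<And>\<alpha> \<beta>. \<alpha> \<in> R \<Longrightarrow> \<beta> \<in> R \<Longrightarrow> \<beta> - (coroot \<alpha> \<bullet> \<beta>) *\<^sub>R \<alpha> \<in> R"
    using R by (auto simp: root_system_def)
  define W where "W = {w :: 'a \<Rightarrow> 'a. orthogonal_transformation w \<and> w ` R = R}"
  have "\<delta> \<in> span R" using span by simp
  then obtain c where c: "\<delta> = (\<Sum>\<beta>\<in>R. c \<beta> *\<^sub>R \<beta>)"
    unfolding span_finite[OF fin] by blast
  \<comment> \<open>For a maximum it suffices that the values are finitely many: as \<open>R\<close>
    spans, \<open>v \<bullet> w \<delta>\<close> depends only on the restriction of \<open>w\<close>
    to \<open>R\<close>, one of finitely many maps from \<open>R\<close> to
    \<open>R\<close>.\<close>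
  have "(\<lambda>w. v \<bullet> w \<delta>) ` W \<subseteq> (\<lambda>f. \<Sum>\<beta>\<in>R. c \<beta> * (v \<bullet> f \<beta>)) ` (R \<rightarrow>\<^sub>E R)"
  proof
    fix x assume "x \<in> (\<lambda>w. v \<bullet> w \<delta>) ` W"
    then obtain w where w: "w \<in> W" "x = v \<bullet> w \<delta>" by blast
    then have "linear w" by (simp add: W_def orthogonal_transformation_def)
    then have "x = (\<Sum>\<beta>\<in>R. c \<beta> * (v \<bullet> restrict w R \<beta>))"
      by (simp add: w c linear_sum linear_cmul inner_sum_right)
    moreover have "restrict w R \<in> R \<rightarrow>\<^sub>E R" using w by (auto simp: W_def)
    ultimately show "x \<in> (\<lambda>f. \<Sum>\<beta>\<in>R. c \<beta> * (v \<bullet> f \<beta>)) ` (R \<rightarrow>\<^sub>E R)" by blast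
  qed
  then have finW: "finite ((\<lambda>w. v \<bullet> w \<delta>) ` W)"
    by (rule finite_subset) (simp add: fin finite_PiE)
  have "id \<in> W" by (simp add: W_def orthogonal_transformation_id[unfolded id_def] id_def)
  then have ne: "(\<lambda>w. v \<bullet> w \<delta>) ` W \<noteq> {}" by blast
  obtain w where w: "w \<in> W" "Max ((\<lambda>w. v \<bullet> w \<delta>) ` W) = v \<bullet> w \<delta>"
    using Max_in[OF finW ne] by blast
  have max: "v \<bullet> u \<delta> \<le> v \<bullet> w \<delta>" if "u \<in> W" for u
    using Max_ge[OF finW, of "v \<bullet> u \<delta>"] that w(2) by auto
  have "v \<bullet> w \<alpha> > 0" if \<alpha>: "\<alpha> \<in> \<Delta>" for \<alpha>
  proof (rule ccontr)
    assume neg: "\<not> v \<bullet> w \<alpha> > 0"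
    have aR: "\<alpha> \<in> R" "\<alpha> \<noteq> 0" using \<alpha> \<Delta> \<open>0 \<notin> R\<close> by auto
    then have "w \<alpha> \<in> R" using w(1) by (auto simp: W_def)
    then have neg: "v \<bullet> w \<alpha> < 0" using neg v[of "w \<alpha>"] by linarith
    define s where "s x = x - (coroot \<alpha> \<bullet> x) *\<^sub>R \<alpha>" for x
    have s: "orthogonal_transformation s"
      unfolding s_def by (rule reflection_orthogonal[OF aR(2)])
    have "s ` R \<subseteq> R" using refl aR by (auto simp: s_def)
    then have "s ` R = R"
      using fin s by (intro endo_inj_surj) (auto intro: inj_on_subset dest: orthogonal_transformation_inj)
    then have "(w \<circ> s) ` R = R"
      using w(1) by (simp only: image_comp[symmetric]) (simp add: W_def)
    then have "w \<circ> s \<in> W"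
      using w(1) s by (simp add: W_def orthogonal_transformation_compose)
    then have "v \<bullet> w (s \<delta>) \<le> v \<bullet> w \<delta>" using max by fastforce
    moreover have "linear w" using w(1) by (simp add: W_def orthogonal_transformation_def)
    \<comment> \<open>Here \<open>w (s \<delta>) = w \<delta> - (coroot \<alpha> \<bullet> \<delta>)
      *\<^sub>R w \<alpha>\<close>, so maximality says that the subtracted term is nonnegative
      against \<open>v\<close>.\<close>
    ultimately have "(coroot \<alpha> \<bullet> \<delta>) * (v \<bullet> w \<alpha>) \<ge> 0"
      by (simp add: s_def linear_diff linear_cmul inner_diff_right)
    moreover have "coroot \<alpha> \<bullet> \<delta> > 0"
      using \<delta>[OF \<alpha>] aR by (simp add: coroot_def)
    ultimately show False using neg by (simp add: zero_le_mult_iff)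
  qed
  then show thesis using that[of w] w(1) by (simp add: W_def)
qed

lemma orthogonal_frame_isometry:
  assumes "orthogonal_frame n e" "orthogonal_transformation w"
  shows "orthogonal_frame n (\<lambda>i. w (e i))"
  using assms by (simp add: orthogonal_frame_def orthogonal_transformation_def)

lemma root_system_uminus:
  assumes "root_system R" "\<alpha> \<in> R"
  shows "- \<alpha> \<in> R"
proof -
  have "\<alpha> - (coroot \<alpha> \<bullet> \<alpha>) *\<^sub>R \<alpha> \<in> R" "\<alpha> \<noteq> 0" using assms by (auto simp: root_system_def)
  then show ?thesis by (simp add: coroot_def scaleR_2)
qed

lemma positive_roots_Un_uminus:
  assumes "root_system R" "\<forall>\<alpha>\<in>R. v \<bullet> \<alpha> \<noteq> 0" "Rp = {\<alpha> \<in> R. v \<bullet> \<alpha> > 0}"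
  shows "R = Rp \<union> uminus ` Rp" "finite Rp"
proof -
  have "\<alpha> \<in> Rp \<union> uminus ` Rp" if "\<alpha> \<in> R" for \<alpha>
  proof (cases "v \<bullet> \<alpha> > 0")
    case False
    then have "- \<alpha> \<in> Rp"
      using assms(2,3) that root_system_uminus[OF assms(1) that] by force
    then show ?thesis by (metis UnI2 image_eqI minus_minus)
  qed (use assms(3) that in simp)
  then show "R = Rp \<union> uminus ` Rp"
    using assms(3) root_system_uminus[OF assms(1)] by blast
  show "finite Rp" using assms by (simp add: root_system_def)
qed

section \<open>Regularity and duality from cancelled products\<close>

definition regular_and_dual :: "'a::euclidean_space set \<Rightarrow> 'a set \<Rightarrow> bool" where
  "regular_and_dual R Rp \<longleftrightarrow>
        (\<forall>\<alpha>\<in>Rp. ht Rp \<alpha> \<in> \<nat>) \<and>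
        (\<forall>\<nu>\<in>{nu_one, nu_root R}.
           \<forall>e\<in># num_expos \<nu> R Rp + den_expos \<nu> R Rp. e \<in> \<nat> \<times> \<nat> \<times> \<nat> \<and> e \<noteq> 0) \<and>
        regular (Pi_hat R Rp q_ind q_lng q_sht) \<and>
        rel_mset proportional (rational_expos nu_one R Rp) (rational_expos (nu_root R) R Rp) \<and>
        Pi_hat R Rp q_ind q_lng q_sht = Pi_hat (coroot ` R) (coroot ` Rp) q_ind q_sht q_lng"

lemma mem_sum_mset: "finite A \<Longrightarrow> e \<in># (\<Sum>x\<in>A. M x) \<longleftrightarrow> (\<exists>x\<in>A. e \<in># M x)"
  by (induction A rule: finite_induct) auto

context two_length_roots
begin

lemma expos_cube:
  assumes H: "\<And>\<alpha>. \<alpha> \<in> Rp \<Longrightarrow> \<exists>(l::nat) (s::nat). \<alpha> \<bullet> long_sum = l * (\<alpha> \<bullet> \<alpha>) \<and> \<alpha> \<bullet> short_sum = s * (\<alpha> \<bullet> \<alpha>)"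
    and \<nu>: "\<nu> \<in> {nu_one, nu_root R}" and e: "e \<in># num_expos \<nu> R Rp + den_expos \<nu> R Rp"
  shows "e \<in> \<nat> \<times> \<nat> \<times> \<nat> \<and> e \<noteq> 0"
proof -
  obtain \<alpha> where \<alpha>: "\<alpha> \<in> Rp" "e \<in># num_contrib \<nu> R Rp \<alpha> + den_contrib \<nu> R Rp \<alpha>"
    using e unfolding num_expos_sum den_expos_sum union_iff mem_sum_mset[OF finite] by blast
  obtain l s :: nat where "\<alpha> \<bullet> long_sum = l * (\<alpha> \<bullet> \<alpha>)" "\<alpha> \<bullet> short_sum = s * (\<alpha> \<bullet> \<alpha>)"
    using H[OF \<alpha>(1)] by blast
  note c = contrib(1,2)[OF \<alpha>(1) this, of \<nu>]
  have "\<nu> \<alpha> = real 1 \<or> \<nu> \<alpha> = real r"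
    using \<nu> \<alpha>(1) by (auto simp: nu_root_eq)
  then obtain k :: nat where k: "k > 0" "\<nu> \<alpha> = real k"
    using r_gt by (metis less_trans zero_less_one)
  show ?thesis
    using \<alpha>(2) expo_string_cube[OF k(1)] unfolding c k(2) union_iff by blast
qed

lemma dual_expos_cube:
  assumes H: "\<And>\<alpha>. \<alpha> \<in> Rp \<Longrightarrow> \<exists>(l::nat) (s::nat). \<alpha> \<bullet> long_sum = l * (r * m) \<and> \<alpha> \<bullet> short_sum = s * m"
    and e: "e \<in># den_expos nu_one (coroot ` R) (coroot ` Rp)"
  shows "e \<in> \<nat> \<times> \<nat> \<times> \<nat> \<and> e \<noteq> 0"
proof -
  obtain \<alpha> where \<alpha>: "\<alpha> \<in> Rp" "e \<in># den_contrib nu_one (coroot ` R) (coroot ` Rp) (coroot \<alpha>)"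
    using e unfolding den_expos_sum mem_sum_mset[OF finite_imageI[OF finite]] by blast
  obtain l s :: nat where "\<alpha> \<bullet> long_sum = l * (r * m)" "\<alpha> \<bullet> short_sum = s * m"
    using H[OF \<alpha>(1)] by blast
  note c = dual_contrib(2)[OF \<alpha>(1) this]
  show ?thesis
  proof -
    obtain d where d: "d \<in># expo_string (l, s)" "e = swap_expo d"
      using \<alpha>(2) unfolding c by auto
    then have "d \<in> \<nat> \<times> \<nat> \<times> \<nat> \<and> d \<noteq> 0"
      using expo_string_cube[of 1 d "(l, s)"] by (simp only: of_nat_1 image_mset_scaleR_1 zero_less_one simp_thms)
    then show ?thesis
      by (simp only: d(2) swap_expo_cube simp_thms)
  qed
qed

lemma Pi_hat_eq_quotient:
  assumes H: "\<And>\<alpha>. \<alpha> \<in> Rp \<Longrightarrow> \<exists>(l::nat) (s::nat). \<alpha> \<bullet> long_sum = l * (\<alpha> \<bullet> \<alpha>) \<and> \<alpha> \<bullet> short_sum = s * (\<alpha> \<bullet> \<alpha>)"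
    and hat: "num_expos nu_one R Rp + B = den_expos nu_one R Rp + A" "A \<inter># B = {#}"
  shows "Pi_hat R Rp q_ind q_lng q_sht =
    prod_mset (image_mset (binom q_ind q_lng q_sht) A) /
    prod_mset (image_mset (binom q_ind q_lng q_sht) B)"
    and "\<And>e. e \<in># B \<Longrightarrow> e \<in> \<nat> \<times> \<nat> \<times> \<nat> \<and> e \<noteq> 0"
proof -
  have cube: "e \<in> \<nat> \<times> \<nat> \<times> \<nat> \<and> e \<noteq> 0" if "e \<in># den_expos nu_one R Rp" for e
    using expos_cube[OF H, of nu_one e] that by simp
  have "B \<subseteq># den_expos nu_one R Rp"
    using balanced_cancel(2)[OF hat] unfolding negative_expos_def by (metis diff_subset_eq_self)
  then show B: "e \<in> \<nat> \<times> \<nat> \<times> \<nat> \<and> e \<noteq> 0" if "e \<in># B" for e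
    using cube[OF mset_subset_eqD] that by blast
  show "Pi_hat R Rp q_ind q_lng q_sht =
      prod_mset (image_mset (binom q_ind q_lng q_sht) A) /
      prod_mset (image_mset (binom q_ind q_lng q_sht) B)"
  proof (rule Pi_hat_balanced[OF hat(1)])
    fix e assume "e \<in># den_expos nu_one R Rp + B"
    then have "e \<in> \<nat> \<times> \<nat> \<times> \<nat>" "e \<noteq> 0" using cube B unfolding union_iff by blast+
    then show "binom q_ind q_lng q_sht e \<noteq> 0"
      using binom_var_neq_0 by (simp flip: to_fract_binom)
  qed
qed

text \<open>After this criterion only multiset identities and a matching of exponents remain for
  each type. The same \<open>A\<close> and \<open>B\<close> occur in \<open>hat\<close> and,
  swapped, in \<open>dual\<close>; exchanging the arguments of \<open>binom\<close> undoes the swap,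
  so both products reduce to one quotient. \<open>A0\<close> consists of the multiples that give
  regularity.\<close>

lemma regular_and_dualI:
  assumes H: "\<And>\<alpha>. \<alpha> \<in> Rp \<Longrightarrow> \<exists>(l::nat) (s::nat). \<alpha> \<bullet> long_sum = l * (\<alpha> \<bullet> \<alpha>) \<and> \<alpha> \<bullet> short_sum = s * (\<alpha> \<bullet> \<alpha>)"
    and H': "\<And>\<alpha>. \<alpha> \<in> Rp \<Longrightarrow> \<exists>(l::nat) (s::nat). \<alpha> \<bullet> long_sum = l * (r * m) \<and> \<alpha> \<bullet> short_sum = s * m"
    and hat: "num_expos nu_one R Rp + B = den_expos nu_one R Rp + A" "A \<inter># B = {#}"
    and dual: "num_expos nu_one (coroot ` R) (coroot ` Rp) + image_mset swap_expo B =
      den_expos nu_one (coroot ` R) (coroot ` Rp) + image_mset swap_expo A"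
    and dvd: "rel_mset nat_multiple B A0" "A0 \<subseteq># A"
    and tilde: "num_expos (nu_root R) R Rp + B' = den_expos (nu_root R) R Rp + A'" "A' \<inter># B' = {#}"
    and rel: "rel_mset proportional {# e \<in># A. \<forall>d\<in>#B. \<not> nat_multiple d e #}
      {# e \<in># A'. \<forall>d\<in>#B'. \<not> nat_multiple d e #}"
  shows "regular_and_dual R Rp"
  unfolding regular_and_dual_def
proof (intro conjI)
  show "\<forall>\<alpha>\<in>Rp. ht Rp \<alpha> \<in> \<nat>"
    using H contrib(3) by blast
  show "\<forall>\<nu>\<in>{nu_one, nu_root R}.
      \<forall>e\<in># num_expos \<nu> R Rp + den_expos \<nu> R Rp. e \<in> \<nat> \<times> \<nat> \<times> \<nat> \<and> e \<noteq> 0"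
    using expos_cube[OF H] by blast
  note Pi = Pi_hat_eq_quotient[OF H hat]
  note cube = Pi(2)
  let ?P = "\<lambda>M. prod_mset (image_mset (binom var_q var_lng var_sht) M)"
  have fract: "prod_mset (image_mset (binom q_ind q_lng q_sht) M) = to_fract (?P M)" for M
    by (simp add: to_fract_prod_mset image_mset.compositionality o_def to_fract_binom)
  have "?P B dvd ?P A"
    using prod_binom_dvd[OF dvd] cube by blast
  then obtain p where p: "?P A = ?P B * p" ..
  have "?P B \<noteq> 0"
    using binom_var_neq_0 cube by (metis (no_types, lifting) image_iff prod_mset_zero_iff set_image_mset)
  then have "Pi_hat R Rp q_ind q_lng q_sht = to_fract p"
    by (simp add: Pi(1) fract p)
  then show "regular (Pi_hat R Rp q_ind q_lng q_sht)"
    by (simp add: regular_def)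
  show "rel_mset proportional (rational_expos nu_one R Rp) (rational_expos (nu_root R) R Rp)"
  proof -
    have "rational_expos nu_one R Rp = {# e \<in># A. \<forall>d\<in>#B. \<not> nat_multiple d e #}"
      by (rule rational_expos_balanced[OF hat]) (rule expos_cube[OF H], simp_all)
    moreover have "rational_expos (nu_root R) R Rp = {# e \<in># A'. \<forall>d\<in>#B'. \<not> nat_multiple d e #}"
      by (rule rational_expos_balanced[OF tilde]) (rule expos_cube[OF H], simp_all)
    ultimately show ?thesis using rel by simp
  qed
  have "Pi_hat (coroot ` R) (coroot ` Rp) q_ind q_sht q_lng =
      prod_mset (image_mset (binom q_ind q_sht q_lng) (image_mset swap_expo A)) /
      prod_mset (image_mset (binom q_ind q_sht q_lng) (image_mset swap_expo B))"
  proof (rule Pi_hat_balanced[OF dual])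
    fix e assume "e \<in># den_expos nu_one (coroot ` R) (coroot ` Rp) + image_mset swap_expo B"
    then consider "e \<in># den_expos nu_one (coroot ` R) (coroot ` Rp)" | d where "d \<in># B" "e = swap_expo d"
      by (metis image_iff set_image_mset union_iff)
    then have "e \<in> \<nat> \<times> \<nat> \<times> \<nat> \<and> e \<noteq> 0"
    proof cases
      case 1
      then show ?thesis using dual_expos_cube[OF H'] by blast
    next
      case 2
      then show ?thesis using cube[of d] by (simp only: swap_expo_cube simp_thms)
    qed
    then have "swap_expo e \<in> \<nat> \<times> \<nat> \<times> \<nat>" "swap_expo e \<noteq> 0"
      by (simp_all only: swap_expo_cube simp_thms)
    then have "binom q_ind q_lng q_sht (swap_expo e) \<noteq> 0"
      using binom_var_neq_0 by (simp flip: to_fract_binom)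
    then show "binom q_ind q_sht q_lng e \<noteq> 0"
      by (simp add: binom_swap_expo)
  qed
  then show "Pi_hat R Rp q_ind q_lng q_sht = Pi_hat (coroot ` R) (coroot ` Rp) q_ind q_sht q_lng"
    by (simp add: Pi(1) image_mset.compositionality o_def binom_swap_expo)
qed

end

section \<open>Types \<open>B\<^sub>n\<close> and \<open>C\<^sub>n\<close>\<close>

text \<open>For fixed \<open>a\<close> the rows are \<open>F 2, ..., F (a + 1)\<close> and
  \<open>F 1, ..., F a\<close>, which leaves \<open>F (a + 1)\<close> against \<open>F 1\<close>.
  The row \<open>a = 0\<close> is empty, hence the ranges starting at 1 and 2. In a monoid the
  negative terms stand on the other side.\<close>

lemma telescope_difference:
  fixes F :: "nat \<Rightarrow> 'm::comm_monoid_add"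
  shows "(\<Sum>a<n. \<Sum>b<a. F (a - b + 1)) + (\<Sum>a\<in>{1..<n}. F 1) =
    (\<Sum>a<n. \<Sum>b<a. F (a - b)) + (\<Sum>m\<in>{2..n}. F m)"
proof (induction n)
  case (Suc n)
  have *: "(\<Sum>b<n. F (n - b + 1)) + F 1 = (\<Sum>b<n. F (n - b)) + F (n + 1)"
  proof -
    \<comment> \<open>The summand \<open>F 1\<close> is the missing term \<open>i = n\<close>; after
      reversing the order the top term \<open>F (n + 1)\<close> can be split off.\<close>
    have "(\<Sum>b<n. F (n - b + 1)) + F 1 = (\<Sum>i<Suc n. F (n - i + 1))" by simp
    also have "\<dots> = (\<Sum>i<Suc n. F (i + 1))"
      by (subst sum.nat_diff_reindex[symmetric]) (auto intro: sum.cong)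
    also have "\<dots> = (\<Sum>i<n. F (n - i)) + F (n + 1)"
      by (subst (2) sum.nat_diff_reindex[symmetric]) (auto intro!: sum.cong arg_cong2[of _ _ _ _ "(+)"])
    finally show ?thesis .
  qed
  show ?case
  proof (cases "n = 0")
    case False
    have "(\<Sum>a<Suc n. \<Sum>b<a. F (a - b + 1)) + (\<Sum>a\<in>{1..<Suc n}. F 1) =
        ((\<Sum>a<n. \<Sum>b<a. F (a - b + 1)) + (\<Sum>a\<in>{1..<n}. F 1)) + ((\<Sum>b<n. F (n - b + 1)) + F 1)"
      using False by (simp add: sum.atLeastLessThan_Suc ac_simps)
    also have "\<dots> = (\<Sum>a<Suc n. \<Sum>b<a. F (a - b)) + (\<Sum>m\<in>{2..Suc n}. F m)"
      unfolding Suc.IH * using False by (simp add: ac_simps)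
    finally show ?thesis .
  qed simp
qed simp

text \<open>For fixed \<open>a\<close> the rows are \<open>F (a + 1), ..., F (2 * a)\<close> and
  \<open>F a, ..., F (2 * a - 1)\<close>, which leaves \<open>F (2 * a)\<close> against
  \<open>F a\<close>.\<close>

lemma telescope_sum:
  fixes F :: "nat \<Rightarrow> 'm::comm_monoid_add"
  shows "(\<Sum>a<n. \<Sum>b<a. F (a + b + 1)) + (\<Sum>a<n. F a) =
    (\<Sum>a<n. \<Sum>b<a. F (a + b)) + (\<Sum>a<n. F (2 * a))"
proof (induction n)
  case (Suc n)
  have *: "(\<Sum>b<n. F (n + b + 1)) + F n = (\<Sum>b<n. F (n + b)) + F (2 * n)"
  proof -
    have "(\<Sum>b<n. F (n + b + 1)) + F n = (\<Sum>b<Suc n. F (n + b))"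
      by (subst sum.lessThan_Suc_shift) (simp add: add.commute)
    then show ?thesis by (simp add: mult_2)
  qed
  have "(\<Sum>a<Suc n. \<Sum>b<a. F (a + b + 1)) + (\<Sum>a<Suc n. F a) =
      ((\<Sum>a<n. \<Sum>b<a. F (a + b + 1)) + (\<Sum>a<n. F a)) + ((\<Sum>b<n. F (n + b + 1)) + F n)"
    by (simp add: ac_simps)
  also have "\<dots> = (\<Sum>a<Suc n. \<Sum>b<a. F (a + b)) + (\<Sum>a<Suc n. F (2 * a))"
    unfolding Suc.IH * by (simp add: ac_simps)
  finally show ?case .
qed simp

section \<open>Models of types B and C and their dominant chambers\<close>

definition bc_roots :: "real \<Rightarrow> nat \<Rightarrow> (nat \<Rightarrow> 'a::euclidean_space) \<Rightarrow> 'a set" where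
  "bc_roots t n e =
     {(t * s) *\<^sub>R e i | s i. s \<in> {1, -1} \<and> i < n}
     \<union> {s *\<^sub>R e i + u *\<^sub>R e j | s u i j. s \<in> {1, -1} \<and> u \<in> {1, -1} \<and> i < j \<and> j < n}"

text \<open>The chamber where \<open>0 < v \<bullet> e 0 < v \<bullet> e 1 < ...\<close>. In this
  increasing order the larger index \<open>a\<close> leads, and the rows \<open>b < a\<close> are
  those of the telescoping sums.\<close>

definition bc_positive :: "real \<Rightarrow> nat \<Rightarrow> (nat \<Rightarrow> 'a::euclidean_space) \<Rightarrow> 'a set" where
  "bc_positive t n e =
     (\<lambda>a. t *\<^sub>R e a) ` {..<n}
     \<union> ((\<lambda>(a, b). e a - e b) ` (SIGMA a:{..<n}. {..<a})
     \<union> (\<lambda>(a, b). e a + e b) ` (SIGMA a:{..<n}. {..<a}))"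

lemma type_B_iff: "type_B n R \<longleftrightarrow> (\<exists>e. orthogonal_frame n e \<and> R = bc_roots 1 n e)"
  by (simp add: type_B_def bc_roots_def)

lemma type_C_iff: "type_C n R \<longleftrightarrow> (\<exists>e. orthogonal_frame n e \<and> R = bc_roots 2 n e)"
  by (simp add: type_C_def bc_roots_def)

lemma bc_roots_isometry:
  assumes "linear w"
  shows "w ` bc_roots t n e = bc_roots t n (\<lambda>i. w (e i))"
proof -
  have "w ` bc_roots t n e =
     {w ((t * s) *\<^sub>R e i) | s i. s \<in> {1, -1} \<and> i < n}
     \<union> {w (s *\<^sub>R e i + u *\<^sub>R e j) | s u i j. s \<in> {1, -1} \<and> u \<in> {1, -1} \<and> i < j \<and> j < n}"
    unfolding bc_roots_def by blast
  then show ?thesis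
    by (simp only: bc_roots_def linear_cmul[OF assms] linear_add[OF assms])
qed

lemma bc_roots_mem:
  "i < n \<Longrightarrow> t *\<^sub>R e i \<in> bc_roots t n e"
  "i < j \<Longrightarrow> j < n \<Longrightarrow> e j - e i \<in> bc_roots t n e"
  "i < j \<Longrightarrow> j < n \<Longrightarrow> e j + e i \<in> bc_roots t n e"
proof -
  let ?A = "{(t * s) *\<^sub>R e i | s i. s \<in> {1, -1} \<and> i < n}"
  let ?B = "{s *\<^sub>R e i + u *\<^sub>R e j | s u i j. s \<in> {1, -1} \<and> u \<in> {1, -1} \<and> i < j \<and> j < n}"
  have A: "(t * s) *\<^sub>R e i \<in> ?A" if "s \<in> {1, -1}" "i < n" for s i
    using that by blast
  have B: "s *\<^sub>R e i + u *\<^sub>R e j \<in> ?B" if "s \<in> {1, -1}" "u \<in> {1, -1}" "i < j" "j < n" for s u i j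
    using that by blast
  show "i < n \<Longrightarrow> t *\<^sub>R e i \<in> bc_roots t n e"
    using A[of 1 i] by (simp add: bc_roots_def)
  show "i < j \<Longrightarrow> j < n \<Longrightarrow> e j - e i \<in> bc_roots t n e"
    using B[of "-1" 1 i j] by (simp add: bc_roots_def)
  show "i < j \<Longrightarrow> j < n \<Longrightarrow> e j + e i \<in> bc_roots t n e"
    using B[of 1 1 i j] by (simp add: bc_roots_def add.commute)
qed

text \<open>The frame is moved rather than the positive roots: an isometry preserving
  \<open>R\<close> carries \<open>e\<close> to another frame that presents \<open>R\<close>, and for
  a suitable isometry the simple roots of the new frame are positive on \<open>v\<close>.\<close>

lemma bc_dominant:
  assumes R: "root_system R" "positive_roots R Rp" and e: "orthogonal_frame n e"
    and R_eq: "R = bc_roots t n e" and t: "t > 0" and n: "n \<ge> 1"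
  obtains e' where "orthogonal_frame n e'" "Rp = bc_positive t n e'"
proof -
  obtain c where c: "c > 0" "\<And>i j. i < n \<Longrightarrow> j < n \<Longrightarrow> e i \<bullet> e j = (if i = j then c else 0)"
    using e unfolding orthogonal_frame_def by blast
  obtain v where v: "\<And>\<alpha>. \<alpha> \<in> R \<Longrightarrow> v \<bullet> \<alpha> \<noteq> 0" "Rp = {\<alpha> \<in> R. v \<bullet> \<alpha> > 0}"
    using R(2) unfolding positive_roots_def by blast
  \<comment> \<open>\<Delta> consists of the simple roots of \<open>bc_positive\<close>; the
    coordinates 1, 2, 3, ... of \<delta> are positive and increasing, hence strictly
    dominant.\<close>
  define \<Delta> where "\<Delta> = insert (t *\<^sub>R e 0) ((\<lambda>i. e (Suc i) - e i) ` {i. Suc i < n})"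
  define \<delta> where "\<delta> = (\<Sum>i<n. (1 + real i) *\<^sub>R e i)"
  have e\<delta>: "e k \<bullet> \<delta> = c * (1 + real k)" if "k < n" for k
  proof -
    have "e k \<bullet> \<delta> = (\<Sum>i<n. if k = i then c * (1 + real i) else 0)"
      unfolding \<delta>_def inner_sum_right using c(2)[OF that] by (intro sum.cong refl) simp
    then show ?thesis using that by simp
  qed
  have "\<Delta> \<subseteq> R"
    using n by (auto simp: \<Delta>_def R_eq intro!: bc_roots_mem)
  moreover have "\<alpha> \<bullet> \<delta> > 0" if "\<alpha> \<in> \<Delta>" for \<alpha>
    using that e\<delta> c(1) t n by (auto simp: \<Delta>_def inner_diff_left ring_distribs)
  ultimately obtain w where w: "orthogonal_transformation w" "w ` R = R"
    "\<And>\<alpha>. \<alpha> \<in> \<Delta> \<Longrightarrow> v \<bullet> w \<alpha> > 0"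
    using ex_dominant_isometry[OF R(1), of \<Delta> v \<delta>] v(1) by blast
  have lin: "linear w" using w(1) by (simp add: orthogonal_transformation_def)
  define f where "f i = w (e i)" for i
  have frame: "orthogonal_frame n f"
    unfolding f_def by (rule orthogonal_frame_isometry[OF e w(1)])
  have R_f: "R = bc_roots t n f"
    using w(2) bc_roots_isometry[OF lin, of t n e] unfolding R_eq f_def by simp
  have f0: "v \<bullet> f 0 > 0"
    using w(3)[of "t *\<^sub>R e 0"] t by (simp add: \<Delta>_def f_def linear_cmul[OF lin] zero_less_mult_iff)
  have fS: "v \<bullet> f i < v \<bullet> f (Suc i)" if "Suc i < n" for i
    using w(3)[of "e (Suc i) - e i"] that by (simp add: \<Delta>_def f_def linear_diff[OF lin] inner_diff_right)
  have mono: "b < a \<Longrightarrow> a < n \<Longrightarrow> v \<bullet> f b < v \<bullet> f a" for a b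
  proof (induction a)
    case (Suc a)
    then show ?case using fS[of a] by (cases "b = a") force+
  qed simp
  have pos: "v \<bullet> f a > 0" if "a < n" for a
    using mono[of 0 a] f0 that by (cases a) auto
  have "Rp = bc_positive t n f"
  proof (intro equalityI subsetI)
    fix \<alpha> assume "\<alpha> \<in> Rp"
    then have \<alpha>: "\<alpha> \<in> bc_roots t n f" "v \<bullet> \<alpha> > 0" using v(2) R_f by auto
    from \<alpha>(1) consider s i where "s \<in> {1, -1}" "i < n" "\<alpha> = (t * s) *\<^sub>R f i"
      | s u i j where "s \<in> {1, -1}" "u \<in> {1, -1}" "i < j" "j < n" "\<alpha> = s *\<^sub>R f i + u *\<^sub>R f j"
      unfolding bc_roots_def by blast
    then show "\<alpha> \<in> bc_positive t n f"
    proof cases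
      case 1
      then have "s = 1"
        using \<alpha>(2) pos[of i] t by (auto simp: mult_less_0_iff)
      then show ?thesis using 1 by (auto simp: bc_positive_def)
    next
      case 2
      \<comment> \<open>Since \<open>0 < v \<bullet> f i < v \<bullet> f j\<close>, the term with
        the larger index decides the sign.\<close>
      have "u = 1"
        using 2 \<alpha>(2) pos[of i] mono[of i j] by (auto simp: inner_add_right)
      then have "\<alpha> = f j + f i \<or> \<alpha> = f j - f i" using 2 by auto
      moreover have "(j, i) \<in> (SIGMA a:{..<n}. {..<a})" using 2 by simp
      ultimately show ?thesis unfolding bc_positive_def by force
    qed
  next
    fix \<alpha> assume "\<alpha> \<in> bc_positive t n f"
    then consider a where "a < n" "\<alpha> = t *\<^sub>R f a"
      | a b where "a < n" "b < a" "\<alpha> = f a - f b"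
      | a b where "a < n" "b < a" "\<alpha> = f a + f b"
      unfolding bc_positive_def by auto
    then have "\<alpha> \<in> bc_roots t n f \<and> v \<bullet> \<alpha> > 0"
    proof cases
      case 1
      then show ?thesis using bc_roots_mem(1)[of a n] pos[of a] t by simp
    next
      case 2
      then show ?thesis using bc_roots_mem(2)[of b a n] mono[of b a] by (simp add: inner_diff_right)
    next
      case 3
      then show ?thesis using bc_roots_mem(3)[of b a n] pos[of a] pos[of b] by (simp add: inner_add_right)
    qed
    then show "\<alpha> \<in> Rp" using v(2) R_f by simp
  qed
  with frame show thesis by (rule that)
qed

locale bc_frame =
  fixes t :: real and n :: nat and e :: "nat \<Rightarrow> 'a::euclidean_space" and c :: real
  assumes t: "t = 1 \<or> t = 2" and n: "n \<ge> 2" and c: "c > 0"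
    and inner_e: "i < n \<Longrightarrow> j < n \<Longrightarrow> e i \<bullet> e j = (if i = j then c else 0)"
begin

lemma bc_positive_cases:
  assumes "\<alpha> \<in> bc_positive t n e"
  obtains (axis) a where "a < n" "\<alpha> = t *\<^sub>R e a"
    | (diff) a b where "a < n" "b < a" "\<alpha> = e a - e b"
    | (sum) a b where "a < n" "b < a" "\<alpha> = e a + e b"
  using assms unfolding bc_positive_def by force

lemma bc_positive_mem:
  "a < n \<Longrightarrow> t *\<^sub>R e a \<in> bc_positive t n e"
  "a < n \<Longrightarrow> b < a \<Longrightarrow> e a - e b \<in> bc_positive t n e"
  "a < n \<Longrightarrow> b < a \<Longrightarrow> e a + e b \<in> bc_positive t n e"
  unfolding bc_positive_def by force+

lemma finite_bc_positive: "finite (bc_positive t n e)"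
  by (simp add: bc_positive_def)

lemma norms:
  "a < n \<Longrightarrow> (t *\<^sub>R e a) \<bullet> (t *\<^sub>R e a) = t * t * c"
  "a < n \<Longrightarrow> b < a \<Longrightarrow> (e a - e b) \<bullet> (e a - e b) = 2 * c"
  "a < n \<Longrightarrow> b < a \<Longrightarrow> (e a + e b) \<bullet> (e a + e b) = 2 * c"
  by (simp_all add: inner_e inner_diff_left inner_diff_right inner_add_left inner_add_right)

text \<open>\<open>t * t\<close> is 1 or 4, never 2: the axis roots are the short roots of type B
  and the long roots of type C, and their length separates them from all other roots.\<close>

lemma axis_norm_neq: "t * t * c \<noteq> 2 * c"
  using t c by auto

text \<open>The three families have no repetitions: length sets the axis roots apart, and inner
  products with frame vectors recover the indices and the sign.\<close>

lemma sum_bc_positive: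
  "(\<Sum>\<alpha>\<in>bc_positive t n e. G \<alpha>) =
    (\<Sum>a<n. G (t *\<^sub>R e a)) + (\<Sum>a<n. \<Sum>b<a. G (e a - e b)) + (\<Sum>a<n. \<Sum>b<a. G (e a + e b))"
proof -
  let ?T = "SIGMA a:{..<n}. {..<a}"
  have inj1: "inj_on (\<lambda>a. t *\<^sub>R e a) {..<n}"
  proof (rule inj_onI)
    fix a a' assume a: "a \<in> {..<n}" "a' \<in> {..<n}" "t *\<^sub>R e a = t *\<^sub>R e a'"
    then have "e a = e a'" using t by auto
    then have "e a \<bullet> e a = e a' \<bullet> e a" by simp
    then show "a = a'" using a c by (simp add: inner_e split: if_splits)
  qed
  have inj2: "inj_on (\<lambda>(a, b). e a - e b) ?T"
  proof (rule inj_onI, clarify)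
    fix a b a' b' assume *: "a < n" "b < a" "a' < n" "b' < a'" and E: "e a - e b = e a' - e b'"
    have "(e a - e b) \<bullet> e a = (e a' - e b') \<bullet> e a" "(e a - e b) \<bullet> e b = (e a' - e b') \<bullet> e b"
      by (simp_all only: E)
    then show "a = a' \<and> b = b'"
      using * c by (auto simp: inner_e inner_diff_left split: if_splits)
  qed
  have inj3: "inj_on (\<lambda>(a, b). e a + e b) ?T"
  proof (rule inj_onI, clarify)
    fix a b a' b' assume *: "a < n" "b < a" "a' < n" "b' < a'" and E: "e a + e b = e a' + e b'"
    have "(e a + e b) \<bullet> e a = (e a' + e b') \<bullet> e a" "(e a + e b) \<bullet> e b = (e a' + e b') \<bullet> e b"
      by (simp_all only: E)
    then show "a = a' \<and> b = b'"
      using * c by (auto simp: inner_e inner_add_left split: if_splits)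
  qed
  have disj1: "(\<lambda>a. t *\<^sub>R e a) ` {..<n} \<inter>
      ((\<lambda>(a, b). e a - e b) ` ?T \<union> (\<lambda>(a, b). e a + e b) ` ?T) = {}"
  proof -
    have "t *\<^sub>R e a \<noteq> e a' - e b'" "t *\<^sub>R e a \<noteq> e a' + e b'" if "a < n" "a' < n" "b' < a'" for a a' b'
      using norms(1)[of a] norms(2,3)[of a' b'] that axis_norm_neq by metis+
    then show ?thesis by auto
  qed
  have disj2: "(\<lambda>(a, b). e a - e b) ` ?T \<inter> (\<lambda>(a, b). e a + e b) ` ?T = {}"
  proof -
    have "e a - e b \<noteq> e a' + e b'" if *: "a < n" "b < a" "a' < n" "b' < a'" for a b a' b'
    proof
      assume "e a - e b = e a' + e b'"
      \<comment> \<open>The left side is \<open>- c\<close>, the right side is nonnegative.\<close>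
      then have "(e a - e b) \<bullet> e b = (e a' + e b') \<bullet> e b" by simp
      then show False
        using * c by (auto simp: inner_e inner_add_left inner_diff_left split: if_splits)
    qed
    then show ?thesis by auto
  qed
  have "(\<Sum>\<alpha>\<in>bc_positive t n e. G \<alpha>) =
      (\<Sum>a<n. G (t *\<^sub>R e a)) + ((\<Sum>(a, b)\<in>?T. G (e a - e b)) + (\<Sum>(a, b)\<in>?T. G (e a + e b)))"
    unfolding bc_positive_def
    by (subst sum.union_disjoint[OF _ _ disj1], simp, simp,
        subst sum.union_disjoint[OF _ _ disj2], simp, simp,
        subst sum.reindex[OF inj1], subst sum.reindex[OF inj2], subst sum.reindex[OF inj3])
      (simp add: o_def case_prod_unfold)
  then show ?thesis
    by (simp add: sum.Sigma[symmetric] add.assoc)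
qed

definition U :: 'a where "U = (\<Sum>a<n. e a)"
text \<open>When \<open>e a - e b\<close> and \<open>e a + e b\<close> are summed over
  \<open>b < a\<close>, the \<open>e b\<close> cancel and \<open>2 * a\<close> copies of
  \<open>e a\<close> remain.\<close>

definition V :: 'a where "V = (\<Sum>a<n. (2 * real a) *\<^sub>R e a)"

lemma inner_U: "a < n \<Longrightarrow> e a \<bullet> U = c"
  by (simp add: U_def inner_sum_right inner_e)

lemma inner_V: "a < n \<Longrightarrow> e a \<bullet> V = 2 * real a * c"
  by (simp add: V_def inner_sum_right inner_e if_distrib cong: if_cong)

lemma sum_axis: "(\<Sum>\<beta>\<in>{\<beta> \<in> bc_positive t n e. \<beta> \<bullet> \<beta> = t * t * c}. \<beta>) = t *\<^sub>R U"
  unfolding sum.inter_filter[OF finite_bc_positive] sum_bc_positive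
  using axis_norm_neq by (simp add: inner_e norms(2,3) U_def scaleR_sum_right)

lemma sum_other: "(\<Sum>\<beta>\<in>{\<beta> \<in> bc_positive t n e. \<beta> \<bullet> \<beta> = 2 * c}. \<beta>) = V"
proof -
  have "(\<Sum>a<n. \<Sum>b<a. e a - e b) + (\<Sum>a<n. \<Sum>b<a. e a + e b) = V"
  proof -
    have "e a - e b + (e a + e b) = 2 *\<^sub>R e a" for a b by (simp add: scaleR_2)
    then show ?thesis
      unfolding V_def sum.distrib[symmetric] by (simp add: sum_constant_scaleR mult.commute)
  qed
  then show ?thesis
    unfolding sum.inter_filter[OF finite_bc_positive] sum_bc_positive
    using axis_norm_neq by (simp add: inner_e norms(2,3))
qed

lemma norm_cases: "\<alpha> \<in> bc_positive t n e \<Longrightarrow> \<alpha> \<bullet> \<alpha> = t * t * c \<or> \<alpha> \<bullet> \<alpha> = 2 * c"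
  by (erule bc_positive_cases) (simp_all only: norms simp_thms)

lemma sum_not_axis: "(\<Sum>\<beta>\<in>{\<beta> \<in> bc_positive t n e. \<beta> \<bullet> \<beta> \<noteq> t * t * c}. \<beta>) = V"
proof -
  have "{\<beta> \<in> bc_positive t n e. \<beta> \<bullet> \<beta> \<noteq> t * t * c} = {\<beta> \<in> bc_positive t n e. \<beta> \<bullet> \<beta> = 2 * c}"
    using norm_cases axis_norm_neq by metis
  then show ?thesis by (simp only: sum_other)
qed

lemma sum_not_other: "(\<Sum>\<beta>\<in>{\<beta> \<in> bc_positive t n e. \<beta> \<bullet> \<beta> \<noteq> 2 * c}. \<beta>) = t *\<^sub>R U"
proof -
  have "{\<beta> \<in> bc_positive t n e. \<beta> \<bullet> \<beta> \<noteq> 2 * c} = {\<beta> \<in> bc_positive t n e. \<beta> \<bullet> \<beta> = t * t * c}"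
    using norm_cases axis_norm_neq by metis
  then show ?thesis by (simp only: sum_axis)
qed

end

section \<open>Strings that survive the cancellation in types B and C\<close>

definition scaled_string :: "real \<Rightarrow> nat \<times> nat \<Rightarrow> expo multiset" where
  "scaled_string x p = image_mset ((*\<^sub>R) x) (expo_string p)"

lemma scaled_string_1 [simp]: "scaled_string 1 p = expo_string p"
  by (simp add: scaled_string_def image_mset_scaleR_1)

lemma image_mset_sum: "image_mset f (\<Sum>x\<in>A. M x) = (\<Sum>x\<in>A. image_mset f (M x))"
  by (induction A rule: infinite_finite_induct) auto

definition bn_pos :: "nat \<Rightarrow> expo multiset" where
  "bn_pos n = (\<Sum>m\<in>{2..n}. expo_string (m, 0)) + (\<Sum>a<n. expo_string (2 * a, 2))"

definition bn_neg :: "nat \<Rightarrow> expo multiset" where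
  "bn_neg n = (\<Sum>a\<in>{1..<n}. expo_string (1, 0)) + (\<Sum>a<n. expo_string (a, 1))"

definition odd_string :: "nat \<Rightarrow> expo multiset" where
  "odd_string a = {# (2 * real a, 2, 1 + 2 * real j). j \<in># mset_set {..a} #}"

text \<open>Splits by the parity of the constant, which ranges below \<open>2 * a + 2\<close>: the
  even ones give the doubled string over \<open>(a, 1)\<close>.\<close>

lemma expo_string_even_odd:
  "expo_string (2 * a, 2) = scaled_string 2 (a, 1) + odd_string a"
proof -
  have *: "mset_set {..<2 * k} =
      image_mset (\<lambda>j. 2 * j) (mset_set {..<k}) + image_mset (\<lambda>j. 2 * j + 1) (mset_set {..<k})" for k :: nat
    by (induction k) (simp_all add: lessThan_Suc)
  show ?thesis
    using *[of "a + 1"]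
    by (simp add: expo_string_def scaled_string_def odd_string_def image_mset.compositionality o_def
        lessThan_Suc_atMost)
qed

definition bn_tilde_pos :: "nat \<Rightarrow> expo multiset" where
  "bn_tilde_pos n = (\<Sum>m\<in>{2..n}. scaled_string 2 (m, 0)) + (\<Sum>a<n. scaled_string 2 (2 * a, 1)) +
     (\<Sum>a<n. odd_string a)"

definition bn_tilde_neg :: "nat \<Rightarrow> expo multiset" where
  "bn_tilde_neg n = (\<Sum>a\<in>{1..<n}. scaled_string 2 (1, 0)) + (\<Sum>a<n. expo_string (2 * a, 1))"

text \<open>
  For \<open>C\<^sub>n\<close> with \<open>[\<alpha>, \<nu>\<^sub>\<alpha> j]\<close> the odd part of the string over \<open>2 m k\<^sub>s\<^sub>h\<^sub>t + 2 k\<^sub>l\<^sub>n\<^sub>g\<close> cancels if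
  \<open>2 m < n\<close>.  The definitions have \<open>k\<^sub>l\<^sub>n\<^sub>g\<close> and \<open>k\<^sub>s\<^sub>h\<^sub>t\<close> interchanged, to be parallel to \<open>B\<^sub>n\<close>.
\<close>

definition cn_tilde_pos :: "nat \<Rightarrow> expo multiset" where
  "cn_tilde_pos n = (\<Sum>m\<in>{2..n}. expo_string (m, 0)) + (\<Sum>a<n. scaled_string 2 (a, 2)) +
     (\<Sum>a\<in>{a. a < n \<and> n \<le> 2 * a}. odd_string a)"

definition cn_tilde_neg :: "nat \<Rightarrow> expo multiset" where
  "cn_tilde_neg n = (\<Sum>a\<in>{1..<n}. expo_string (1, 0)) +
     (\<Sum>a<n. if even a then scaled_string 2 (a div 2, 1) else expo_string (a, 2))"

text \<open>For \<open>a = 2 * b\<close> the denominator string over \<open>(a, 2)\<close> contains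
  \<open>odd_string b\<close>, and so does the numerator because \<open>b < n\<close>.
  \<open>X\<close> collects these common parts.\<close>

lemma cn_tilde_cancel:
  "\<exists>X. (\<Sum>a\<in>{1..<n}. expo_string (1, 0)) + (\<Sum>a<n. expo_string (a, 2)) = cn_tilde_neg n + X \<and>
    (\<Sum>m\<in>{2..n}. expo_string (m, 0)) + (\<Sum>a<n. scaled_string 2 (a, 2)) + (\<Sum>a<n. odd_string a) =
    cn_tilde_pos n + X"
proof -
  let ?X = "\<Sum>b\<in>{b. 2 * b < n}. odd_string b"
  have "expo_string (a, 2) = (if even a then scaled_string 2 (a div 2, 1) else expo_string (a, 2)) +
      (if even a then odd_string (a div 2) else {#})" for a
  proof (cases "even a")
    case True
    then have "2 * (a div 2) = a" by simp
    then show ?thesis using expo_string_even_odd[of "a div 2"] True by (simp only: if_True)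
  qed simp
  then have "(\<Sum>a<n. expo_string (a, 2)) =
      (\<Sum>a<n. (if even a then scaled_string 2 (a div 2, 1) else expo_string (a, 2)) +
        (if even a then odd_string (a div 2) else {#}))"
    by (rule sum.cong[OF refl])
  also have "\<dots> = (\<Sum>a<n. if even a then scaled_string 2 (a div 2, 1) else expo_string (a, 2)) +
      (\<Sum>a<n. if even a then odd_string (a div 2) else {#})"
    by (simp only: sum.distrib)
  also have "(\<Sum>a<n. if even a then odd_string (a div 2) else {#}) =
      (\<Sum>a\<in>{a \<in> {..<n}. even a}. odd_string (a div 2))"
    by (simp only: sum.inter_filter finite_lessThan)
  also have "\<dots> = ?X"
    by (rule sum.reindex_bij_witness[of _ "\<lambda>b. 2 * b" "\<lambda>a. a div 2"]) auto
  finally have 1: "(\<Sum>a<n. expo_string (a, 2)) =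
      (\<Sum>a<n. if even a then scaled_string 2 (a div 2, 1) else expo_string (a, 2)) + ?X" .
  have "(\<Sum>a<n. odd_string a) = (\<Sum>a\<in>{b. 2 * b < n} \<union> {a. a < n \<and> n \<le> 2 * a}. odd_string a)"
    by (rule sum.cong) auto
  also have "\<dots> = ?X + (\<Sum>a\<in>{a. a < n \<and> n \<le> 2 * a}. odd_string a)"
  proof (rule sum.union_disjoint)
    show "finite {b. 2 * b < n}" by (rule finite_subset[of _ "{..<n}"]) auto
  qed auto
  finally have 2: "(\<Sum>a<n. odd_string a) = ?X + (\<Sum>a\<in>{a. a < n \<and> n \<le> 2 * a}. odd_string a)" .
  show ?thesis
    unfolding 1 2 cn_tilde_pos_def cn_tilde_neg_def by (intro exI[of _ ?X]) (simp add: add_ac)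
qed

lemma image_swap_scaled_string:
  "image_mset swap_expo (scaled_string x (l, s)) = scaled_string x (s, l)"
  by (simp add: scaled_string_def expo_string_def swap_expo_def image_mset.compositionality o_def add.commute)

section \<open>Type B: heights and cancellation\<close>

locale bc_B = bc_frame 1 n e c for n :: nat and e :: "nat \<Rightarrow> 'a::euclidean_space" and c :: real +
  fixes R :: "'a set"
  assumes R_Un: "R = bc_positive 1 n e \<union> uminus ` bc_positive 1 n e"
begin

sublocale two_length_roots R "bc_positive 1 n e" c 2
proof
  show "\<exists>\<alpha>\<in>bc_positive 1 n e. \<alpha> \<bullet> \<alpha> = c"
    using bc_positive_mem(1)[of 0] norms(1)[of 0] n by auto
  show "\<exists>\<alpha>\<in>bc_positive 1 n e. \<alpha> \<bullet> \<alpha> = real 2 * c"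
    using bc_positive_mem(2)[of 1 0] norms(2)[of 1 0] n by auto
qed (use finite_bc_positive c R_Un norm_cases in auto)

lemma sums: "long_sum = V" "short_sum = U"
  using sum_not_axis sum_axis by (simp_all add: long_sum_def short_sum_def)

text \<open>The pair of \<open>(\<alpha>\<^sup>\<or>, \<rho>\<^sub>k)\<close> is
  \<open>(2 * a, 1)\<close>, that of \<open>(\<alpha>, \<rho>\<^sub>k\<^sup>\<or>)\<close> is
  \<open>(a, 1)\<close>: the last two facts divide by the squared lengths of the summed roots, the
  two before them by that of \<open>e a\<close>.\<close>

lemma axis_root:
  assumes "a < n"
  shows "e a \<in> bc_positive 1 n e" "e a \<bullet> e a = c"
    "e a \<bullet> long_sum = real (2 * a) * (e a \<bullet> e a)" "e a \<bullet> short_sum = real 1 * (e a \<bullet> e a)"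
    "e a \<bullet> long_sum = real a * (real 2 * c)" "e a \<bullet> short_sum = real 1 * c"
  using bc_positive_mem(1)[OF assms] assms by (simp_all add: sums inner_U inner_V inner_e)

lemma diff_root:
  assumes "a < n" "b < a"
  shows "e a - e b \<in> bc_positive 1 n e" "(e a - e b) \<bullet> (e a - e b) \<noteq> c"
    "(e a - e b) \<bullet> long_sum = real (a - b) * ((e a - e b) \<bullet> (e a - e b))"
    "(e a - e b) \<bullet> short_sum = real 0 * ((e a - e b) \<bullet> (e a - e b))"
    "(e a - e b) \<bullet> long_sum = real (a - b) * (real 2 * c)" "(e a - e b) \<bullet> short_sum = real 0 * c"
  unfolding norms(2)[OF assms] using bc_positive_mem(2)[OF assms] assms c
  by (simp_all add: sums inner_U inner_V inner_diff_left of_nat_diff algebra_simps)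

lemma sum_root:
  assumes "a < n" "b < a"
  shows "e a + e b \<in> bc_positive 1 n e" "(e a + e b) \<bullet> (e a + e b) \<noteq> c"
    "(e a + e b) \<bullet> long_sum = real (a + b) * ((e a + e b) \<bullet> (e a + e b))"
    "(e a + e b) \<bullet> short_sum = real 1 * ((e a + e b) \<bullet> (e a + e b))"
    "(e a + e b) \<bullet> long_sum = real (a + b) * (real 2 * c)" "(e a + e b) \<bullet> short_sum = real 2 * c"
  unfolding norms(3)[OF assms] using bc_positive_mem(3)[OF assms] assms c
  by (simp_all add: sums inner_U inner_V inner_add_left algebra_simps)

lemma heights:
  assumes "\<alpha> \<in> bc_positive 1 n e"
  shows "\<exists>(l::nat) (s::nat). \<alpha> \<bullet> long_sum = l * (\<alpha> \<bullet> \<alpha>) \<and> \<alpha> \<bullet> short_sum = s * (\<alpha> \<bullet> \<alpha>)" (is ?primal)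
    and "\<exists>(l::nat) (s::nat). \<alpha> \<bullet> long_sum = l * (real 2 * c) \<and> \<alpha> \<bullet> short_sum = s * c" (is ?dual)
proof -
  show ?primal
    using assms
  proof (cases rule: bc_positive_cases)
    case (axis a)
    then show ?thesis using axis_root(3,4)[of a] unfolding scaleR_one by blast
  next
    case (diff a b)
    then show ?thesis using diff_root(3,4)[of a b] by blast
  next
    case (sum a b)
    then show ?thesis using sum_root(3,4)[of a b] by blast
  qed
  show ?dual
    using assms
  proof (cases rule: bc_positive_cases)
    case (axis a)
    then show ?thesis using axis_root(5,6)[of a] unfolding scaleR_one by blast
  next
    case (diff a b)
    then show ?thesis using diff_root(5,6)[of a b] by blast
  next
    case (sum a b)
    then show ?thesis using sum_root(5,6)[of a b] by blast
  qed
qed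

lemma expos:
  assumes \<nu>: "\<And>\<alpha>. \<alpha> \<in> bc_positive 1 n e \<Longrightarrow> \<nu> \<alpha> = (if \<alpha> \<bullet> \<alpha> = c then x else y)"
  shows "num_expos \<nu> R (bc_positive 1 n e) = (\<Sum>a<n. scaled_string x (2 * a, 2)) +
      (\<Sum>a<n. \<Sum>b<a. scaled_string y (a - b + 1, 0)) + (\<Sum>a<n. \<Sum>b<a. scaled_string y (a + b + 1, 1))" (is ?num)
    and "den_expos \<nu> R (bc_positive 1 n e) = (\<Sum>a<n. scaled_string x (2 * a, 1)) +
      (\<Sum>a<n. \<Sum>b<a. scaled_string y (a - b, 0)) + (\<Sum>a<n. \<Sum>b<a. scaled_string y (a + b, 1))" (is ?den)
proof -
  have 1: "num_contrib \<nu> R (bc_positive 1 n e) (e a) = scaled_string x (2 * a, 2)"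
    "den_contrib \<nu> R (bc_positive 1 n e) (e a) = scaled_string x (2 * a, 1)" if "a < n" for a
    using contrib(1,2)[OF axis_root(1,3,4)[OF that], of \<nu>] axis_root(1,2)[OF that] \<nu>[OF axis_root(1)[OF that]]
    by (simp_all add: scaled_string_def add_k_def numeral_2_eq_2)
  have 2: "num_contrib \<nu> R (bc_positive 1 n e) (e a - e b) = scaled_string y (a - b + 1, 0)"
    "den_contrib \<nu> R (bc_positive 1 n e) (e a - e b) = scaled_string y (a - b, 0)" if "a < n" "b < a" for a b
    using contrib(1,2)[OF diff_root(1,3,4)[OF that], of \<nu>] diff_root(1,2)[OF that] \<nu>[OF diff_root(1)[OF that]]
    by (simp_all add: scaled_string_def add_k_def numeral_2_eq_2)
  have 3: "num_contrib \<nu> R (bc_positive 1 n e) (e a + e b) = scaled_string y (a + b + 1, 1)"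
    "den_contrib \<nu> R (bc_positive 1 n e) (e a + e b) = scaled_string y (a + b, 1)" if "a < n" "b < a" for a b
    using contrib(1,2)[OF sum_root(1,3,4)[OF that], of \<nu>] sum_root(1,2)[OF that] \<nu>[OF sum_root(1)[OF that]]
    by (simp_all add: scaled_string_def add_k_def numeral_2_eq_2)
  show ?num ?den
    unfolding num_expos_sum den_expos_sum sum_bc_positive by (simp_all add: 1 2 3)
qed

lemma dual_expos:
  shows "num_expos nu_one (coroot ` R) (coroot ` bc_positive 1 n e) = image_mset swap_expo
      ((\<Sum>a<n. expo_string (a, 2)) +
       (\<Sum>a<n. \<Sum>b<a. expo_string (a - b + 1, 0)) + (\<Sum>a<n. \<Sum>b<a. expo_string (a + b + 1, 2)))" (is ?num)
    and "den_expos nu_one (coroot ` R) (coroot ` bc_positive 1 n e) = image_mset swap_expo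
      ((\<Sum>a<n. expo_string (a, 1)) +
       (\<Sum>a<n. \<Sum>b<a. expo_string (a - b, 0)) + (\<Sum>a<n. \<Sum>b<a. expo_string (a + b, 2)))" (is ?den)
proof -
  have 1: "num_contrib nu_one (coroot ` R) (coroot ` bc_positive 1 n e) (coroot (e a)) =
      image_mset swap_expo (expo_string (a, 2))"
    "den_contrib nu_one (coroot ` R) (coroot ` bc_positive 1 n e) (coroot (e a)) =
      image_mset swap_expo (expo_string (a, 1))" if "a < n" for a
    using dual_contrib[OF axis_root(1,5,6)[OF that]] axis_root(2)[OF that]
    by (simp_all add: add_k_def numeral_2_eq_2)
  have 2: "num_contrib nu_one (coroot ` R) (coroot ` bc_positive 1 n e) (coroot (e a - e b)) =
      image_mset swap_expo (expo_string (a - b + 1, 0))"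
    "den_contrib nu_one (coroot ` R) (coroot ` bc_positive 1 n e) (coroot (e a - e b)) =
      image_mset swap_expo (expo_string (a - b, 0))" if "a < n" "b < a" for a b
    using dual_contrib[OF diff_root(1,5,6)[OF that]] diff_root(2)[OF that]
    by (simp_all add: add_k_def numeral_2_eq_2)
  have 3: "num_contrib nu_one (coroot ` R) (coroot ` bc_positive 1 n e) (coroot (e a + e b)) =
      image_mset swap_expo (expo_string (a + b + 1, 2))"
    "den_contrib nu_one (coroot ` R) (coroot ` bc_positive 1 n e) (coroot (e a + e b)) =
      image_mset swap_expo (expo_string (a + b, 2))" if "a < n" "b < a" for a b
    using dual_contrib[OF sum_root(1,5,6)[OF that]] sum_root(2)[OF that]
    by (simp_all add: add_k_def numeral_2_eq_2)
  show ?num ?den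
    unfolding num_expos_sum den_expos_sum sum.reindex[OF inj_coroot] o_def sum_bc_positive
      image_mset_union image_mset_sum by (simp_all add: 1 2 3)
qed

text \<open>The roots \<open>e a + e b\<close> leave strings over \<open>(2 * a, 1)\<close> in the
  numerator. These cancel the denominators of the axis roots, whose numerators over
  \<open>(2 * a, 2)\<close> remain.\<close>

lemma hat_balanced:
  "num_expos nu_one R (bc_positive 1 n e) + bn_neg n = den_expos nu_one R (bc_positive 1 n e) + bn_pos n"
proof -
  note d = telescope_difference[of "\<lambda>a. expo_string (a, 0)" n]
  note s = telescope_sum[of "\<lambda>a. expo_string (a, 1)" n]
  have "num_expos nu_one R (bc_positive 1 n e) + bn_neg n =
      (\<Sum>a<n. expo_string (2 * a, 2)) +
      ((\<Sum>a<n. \<Sum>b<a. expo_string (a - b + 1, 0)) + (\<Sum>a\<in>{1..<n}. expo_string (1, 0))) +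
      ((\<Sum>a<n. \<Sum>b<a. expo_string (a + b + 1, 1)) + (\<Sum>a<n. expo_string (a, 1)))"
    by (subst expos(1)[of _ 1 1]) (simp_all add: bn_neg_def add_ac)
  also have "\<dots> = den_expos nu_one R (bc_positive 1 n e) + bn_pos n"
    unfolding d s by (subst expos(2)[of _ 1 1]) (simp_all add: bn_pos_def add_ac)
  finally show ?thesis .
qed

text \<open>The other half of the axis roots cancels here: the roots \<open>e a + e b\<close> leave
  \<open>(a, 2)\<close> in the denominator, against the axis numerators, while the axis denominators
  \<open>(a, 1)\<close> remain. The remainder is nevertheless that of the original system,
  swapped.\<close>

lemma dual_balanced:
  "num_expos nu_one (coroot ` R) (coroot ` bc_positive 1 n e) + image_mset swap_expo (bn_neg n) =
   den_expos nu_one (coroot ` R) (coroot ` bc_positive 1 n e) + image_mset swap_expo (bn_pos n)"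
proof -
  note d = telescope_difference[of "\<lambda>a. expo_string (a, 0)" n]
  note s = telescope_sum[of "\<lambda>a. expo_string (a, 2)" n]
  have "((\<Sum>a<n. expo_string (a, 2)) + (\<Sum>a<n. \<Sum>b<a. expo_string (a - b + 1, 0)) +
        (\<Sum>a<n. \<Sum>b<a. expo_string (a + b + 1, 2))) + bn_neg n =
      (\<Sum>a<n. expo_string (a, 1)) +
      ((\<Sum>a<n. \<Sum>b<a. expo_string (a - b + 1, 0)) + (\<Sum>a\<in>{1..<n}. expo_string (1, 0))) +
      ((\<Sum>a<n. \<Sum>b<a. expo_string (a + b + 1, 2)) + (\<Sum>a<n. expo_string (a, 2)))"
    by (simp add: bn_neg_def add_ac)
  also have "\<dots> = ((\<Sum>a<n. expo_string (a, 1)) + (\<Sum>a<n. \<Sum>b<a. expo_string (a - b, 0)) +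
        (\<Sum>a<n. \<Sum>b<a. expo_string (a + b, 2))) + bn_pos n"
    unfolding d s by (simp add: bn_pos_def add_ac)
  finally show ?thesis
    unfolding dual_expos image_mset_union[symmetric] by (rule arg_cong)
qed

text \<open>The roots \<open>e a + e b\<close> leave the doubled strings over \<open>(a, 1)\<close>
  in the denominator. These are the even halves of the axis numerators over
  \<open>(2 * a, 2)\<close>, of which only \<open>odd_string a\<close> survives.\<close>

lemma tilde_balanced:
  "num_expos (nu_root R) R (bc_positive 1 n e) + bn_tilde_neg n =
   den_expos (nu_root R) R (bc_positive 1 n e) + bn_tilde_pos n"
proof -
  note d = telescope_difference[of "\<lambda>a. scaled_string 2 (a, 0)" n]
  note s = telescope_sum[of "\<lambda>a. scaled_string 2 (a, 1)" n]
  have "num_expos (nu_root R) R (bc_positive 1 n e) + bn_tilde_neg n =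
      (\<Sum>a<n. odd_string a) + (\<Sum>a<n. expo_string (2 * a, 1)) +
      ((\<Sum>a<n. \<Sum>b<a. scaled_string 2 (a - b + 1, 0)) + (\<Sum>a\<in>{1..<n}. scaled_string 2 (1, 0))) +
      ((\<Sum>a<n. \<Sum>b<a. scaled_string 2 (a + b + 1, 1)) + (\<Sum>a<n. scaled_string 2 (a, 1)))"
    by (subst expos(1)[of _ 1 2])
      (simp_all add: nu_root_eq expo_string_even_odd sum.distrib bn_tilde_neg_def add_ac)
  also have "\<dots> = den_expos (nu_root R) R (bc_positive 1 n e) + bn_tilde_pos n"
    unfolding d s
    by (subst expos(2)[of _ 1 2]) (simp_all add: nu_root_eq bn_tilde_pos_def add_ac)
  finally show ?thesis .
qed

end

section \<open>Type C: heights and cancellation\<close>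

locale bc_C = bc_frame 2 n e c for n :: nat and e :: "nat \<Rightarrow> 'a::euclidean_space" and c :: real +
  fixes R :: "'a set"
  assumes R_Un: "R = bc_positive 2 n e \<union> uminus ` bc_positive 2 n e"
begin

sublocale two_length_roots R "bc_positive 2 n e" "2 * c" 2
proof
  show "\<exists>\<alpha>\<in>bc_positive 2 n e. \<alpha> \<bullet> \<alpha> = real 2 * (2 * c)"
    using bc_positive_mem(1)[of 0] norms(1)[of 0] n by (intro bexI[of _ "2 *\<^sub>R e 0"]) auto
  show "\<exists>\<alpha>\<in>bc_positive 2 n e. \<alpha> \<bullet> \<alpha> = 2 * c"
    using bc_positive_mem(2)[of 1 0] norms(2)[of 1 0] n by auto
  show "\<alpha> \<bullet> \<alpha> = 2 * c \<or> \<alpha> \<bullet> \<alpha> = real 2 * (2 * c)" if "\<alpha> \<in> bc_positive 2 n e" for \<alpha>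
    using norm_cases[OF that] by auto
qed (use finite_bc_positive c R_Un in auto)

lemma sums: "long_sum = 2 *\<^sub>R U" "short_sum = V"
  using sum_not_other sum_other by (simp_all add: long_sum_def short_sum_def)

lemma axis_root:
  assumes "a < n"
  shows "2 *\<^sub>R e a \<in> bc_positive 2 n e" "(2 *\<^sub>R e a) \<bullet> (2 *\<^sub>R e a) \<noteq> 2 * c"
    "(2 *\<^sub>R e a) \<bullet> long_sum = real 1 * ((2 *\<^sub>R e a) \<bullet> (2 *\<^sub>R e a))"
    "(2 *\<^sub>R e a) \<bullet> short_sum = real a * ((2 *\<^sub>R e a) \<bullet> (2 *\<^sub>R e a))"
    "(2 *\<^sub>R e a) \<bullet> long_sum = real 1 * (real 2 * (2 * c))"
    "(2 *\<^sub>R e a) \<bullet> short_sum = real (2 * a) * (2 * c)"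
  using bc_positive_mem(1)[OF assms] assms c by (simp_all add: sums inner_U inner_V inner_e)

lemma diff_root:
  assumes "a < n" "b < a"
  shows "e a - e b \<in> bc_positive 2 n e" "(e a - e b) \<bullet> (e a - e b) = 2 * c"
    "(e a - e b) \<bullet> long_sum = real 0 * ((e a - e b) \<bullet> (e a - e b))"
    "(e a - e b) \<bullet> short_sum = real (a - b) * ((e a - e b) \<bullet> (e a - e b))"
    "(e a - e b) \<bullet> long_sum = real 0 * (real 2 * (2 * c))" "(e a - e b) \<bullet> short_sum = real (a - b) * (2 * c)"
  unfolding norms(2)[OF assms] sums using bc_positive_mem(2)[OF assms] assms c
  by (simp_all add: inner_U inner_V inner_diff_left of_nat_diff algebra_simps)

lemma sum_root:
  assumes "a < n" "b < a"
  shows "e a + e b \<in> bc_positive 2 n e" "(e a + e b) \<bullet> (e a + e b) = 2 * c"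
    "(e a + e b) \<bullet> long_sum = real 2 * ((e a + e b) \<bullet> (e a + e b))"
    "(e a + e b) \<bullet> short_sum = real (a + b) * ((e a + e b) \<bullet> (e a + e b))"
    "(e a + e b) \<bullet> long_sum = real 1 * (real 2 * (2 * c))" "(e a + e b) \<bullet> short_sum = real (a + b) * (2 * c)"
  unfolding norms(3)[OF assms] sums using bc_positive_mem(3)[OF assms] assms c
  by (simp_all add: inner_U inner_V inner_add_left algebra_simps)

lemma heights:
  assumes "\<alpha> \<in> bc_positive 2 n e"
  shows "\<exists>(l::nat) (s::nat). \<alpha> \<bullet> long_sum = l * (\<alpha> \<bullet> \<alpha>) \<and> \<alpha> \<bullet> short_sum = s * (\<alpha> \<bullet> \<alpha>)" (is ?primal)
    and "\<exists>(l::nat) (s::nat). \<alpha> \<bullet> long_sum = l * (real 2 * (2 * c)) \<and> \<alpha> \<bullet> short_sum = s * (2 * c)" (is ?dual)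
proof -
  show ?primal
    using assms
  proof (cases rule: bc_positive_cases)
    case (axis a)
    then show ?thesis using axis_root(3,4)[of a] unfolding scaleR_one by blast
  next
    case (diff a b)
    then show ?thesis using diff_root(3,4)[of a b] by blast
  next
    case (sum a b)
    then show ?thesis using sum_root(3,4)[of a b] by blast
  qed
  show ?dual
    using assms
  proof (cases rule: bc_positive_cases)
    case (axis a)
    then show ?thesis using axis_root(5,6)[of a] unfolding scaleR_one by blast
  next
    case (diff a b)
    then show ?thesis using diff_root(5,6)[of a b] by blast
  next
    case (sum a b)
    then show ?thesis using sum_root(5,6)[of a b] by blast
  qed
qed

lemma expos:
  assumes \<nu>: "\<And>\<alpha>. \<alpha> \<in> bc_positive 2 n e \<Longrightarrow> \<nu> \<alpha> = (if \<alpha> \<bullet> \<alpha> = 2 * c then x else y)"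
  shows "num_expos \<nu> R (bc_positive 2 n e) = (\<Sum>a<n. scaled_string y (2, a)) +
      (\<Sum>a<n. \<Sum>b<a. scaled_string x (0, a - b + 1)) + (\<Sum>a<n. \<Sum>b<a. scaled_string x (2, a + b + 1))" (is ?num)
    and "den_expos \<nu> R (bc_positive 2 n e) = (\<Sum>a<n. scaled_string y (1, a)) +
      (\<Sum>a<n. \<Sum>b<a. scaled_string x (0, a - b)) + (\<Sum>a<n. \<Sum>b<a. scaled_string x (2, a + b))" (is ?den)
proof -
  have 1: "num_contrib \<nu> R (bc_positive 2 n e) (2 *\<^sub>R e a) = scaled_string y (2, a)"
    "den_contrib \<nu> R (bc_positive 2 n e) (2 *\<^sub>R e a) = scaled_string y (1, a)" if "a < n" for a
    using contrib(1,2)[OF axis_root(1,3,4)[OF that], of \<nu>] axis_root(1,2)[OF that] \<nu>[OF axis_root(1)[OF that]]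
    by (simp_all add: scaled_string_def add_k_def numeral_2_eq_2)
  have 2: "num_contrib \<nu> R (bc_positive 2 n e) (e a - e b) = scaled_string x (0, a - b + 1)"
    "den_contrib \<nu> R (bc_positive 2 n e) (e a - e b) = scaled_string x (0, a - b)" if "a < n" "b < a" for a b
    using contrib(1,2)[OF diff_root(1,3,4)[OF that], of \<nu>] diff_root(1,2)[OF that] \<nu>[OF diff_root(1)[OF that]]
    by (simp_all add: scaled_string_def add_k_def numeral_2_eq_2)
  have 3: "num_contrib \<nu> R (bc_positive 2 n e) (e a + e b) = scaled_string x (2, a + b + 1)"
    "den_contrib \<nu> R (bc_positive 2 n e) (e a + e b) = scaled_string x (2, a + b)" if "a < n" "b < a" for a b
    using contrib(1,2)[OF sum_root(1,3,4)[OF that], of \<nu>] sum_root(1,2)[OF that] \<nu>[OF sum_root(1)[OF that]]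
    by (simp_all add: scaled_string_def add_k_def numeral_2_eq_2)
  show ?num ?den
    unfolding num_expos_sum den_expos_sum sum_bc_positive by (simp_all add: 1 2 3)
qed

lemma dual_expos:
  shows "num_expos nu_one (coroot ` R) (coroot ` bc_positive 2 n e) = image_mset swap_expo
      ((\<Sum>a<n. expo_string (2, 2 * a)) +
       (\<Sum>a<n. \<Sum>b<a. expo_string (0, a - b + 1)) + (\<Sum>a<n. \<Sum>b<a. expo_string (1, a + b + 1)))" (is ?num)
    and "den_expos nu_one (coroot ` R) (coroot ` bc_positive 2 n e) = image_mset swap_expo
      ((\<Sum>a<n. expo_string (1, 2 * a)) +
       (\<Sum>a<n. \<Sum>b<a. expo_string (0, a - b)) + (\<Sum>a<n. \<Sum>b<a. expo_string (1, a + b)))" (is ?den)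
proof -
  have 1: "num_contrib nu_one (coroot ` R) (coroot ` bc_positive 2 n e) (coroot (2 *\<^sub>R e a)) =
      image_mset swap_expo (expo_string (2, 2 * a))"
    "den_contrib nu_one (coroot ` R) (coroot ` bc_positive 2 n e) (coroot (2 *\<^sub>R e a)) =
      image_mset swap_expo (expo_string (1, 2 * a))" if "a < n" for a
    using dual_contrib[OF axis_root(1,5,6)[OF that]] axis_root(2)[OF that]
    by (simp_all add: add_k_def numeral_2_eq_2)
  have 2: "num_contrib nu_one (coroot ` R) (coroot ` bc_positive 2 n e) (coroot (e a - e b)) =
      image_mset swap_expo (expo_string (0, a - b + 1))"
    "den_contrib nu_one (coroot ` R) (coroot ` bc_positive 2 n e) (coroot (e a - e b)) =
      image_mset swap_expo (expo_string (0, a - b))" if "a < n" "b < a" for a b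
    using dual_contrib[OF diff_root(1,5,6)[OF that]] diff_root(2)[OF that]
    by (simp_all add: add_k_def numeral_2_eq_2)
  have 3: "num_contrib nu_one (coroot ` R) (coroot ` bc_positive 2 n e) (coroot (e a + e b)) =
      image_mset swap_expo (expo_string (1, a + b + 1))"
    "den_contrib nu_one (coroot ` R) (coroot ` bc_positive 2 n e) (coroot (e a + e b)) =
      image_mset swap_expo (expo_string (1, a + b))" if "a < n" "b < a" for a b
    using dual_contrib[OF sum_root(1,5,6)[OF that]] sum_root(2)[OF that]
    by (simp_all add: add_k_def numeral_2_eq_2)
  show ?num ?den
    unfolding num_expos_sum den_expos_sum sum.reindex[OF inj_coroot] o_def sum_bc_positive
      image_mset_union image_mset_sum by (simp_all add: 1 2 3)
qed

text \<open>Same cancellations as for type B with the system and its dual exchanged: here the axis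
  numerators \<open>(2, a)\<close> cancel and the axis denominators \<open>(1, a)\<close>
  remain.\<close>

lemma hat_balanced:
  "num_expos nu_one R (bc_positive 2 n e) + image_mset swap_expo (bn_neg n) =
   den_expos nu_one R (bc_positive 2 n e) + image_mset swap_expo (bn_pos n)"
proof -
  note d = telescope_difference[of "\<lambda>a. expo_string (0, a)" n]
  note s = telescope_sum[of "\<lambda>a. expo_string (2, a)" n]
  have "num_expos nu_one R (bc_positive 2 n e) + image_mset swap_expo (bn_neg n) =
      (\<Sum>a<n. expo_string (1, a)) +
      ((\<Sum>a<n. \<Sum>b<a. expo_string (0, a - b + 1)) + (\<Sum>a\<in>{1..<n}. expo_string (0, 1))) +
      ((\<Sum>a<n. \<Sum>b<a. expo_string (2, a + b + 1)) + (\<Sum>a<n. expo_string (2, a)))"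
    by (subst expos(1)[of _ 1 1]) (simp_all add: bn_neg_def image_mset_sum image_swap_expo_string add_ac)
  also have "\<dots> = den_expos nu_one R (bc_positive 2 n e) + image_mset swap_expo (bn_pos n)"
    unfolding d s
    by (subst expos(2)[of _ 1 1]) (simp_all add: bn_pos_def image_mset_sum image_swap_expo_string add_ac)
  finally show ?thesis .
qed

lemma dual_balanced:
  "num_expos nu_one (coroot ` R) (coroot ` bc_positive 2 n e) + image_mset swap_expo (image_mset swap_expo (bn_neg n)) =
   den_expos nu_one (coroot ` R) (coroot ` bc_positive 2 n e) + image_mset swap_expo (image_mset swap_expo (bn_pos n))"
proof -
  note d = telescope_difference[of "\<lambda>a. expo_string (0, a)" n]
  note s = telescope_sum[of "\<lambda>a. expo_string (1, a)" n]
  have "((\<Sum>a<n. expo_string (2, 2 * a)) + (\<Sum>a<n. \<Sum>b<a. expo_string (0, a - b + 1)) +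
        (\<Sum>a<n. \<Sum>b<a. expo_string (1, a + b + 1))) + image_mset swap_expo (bn_neg n) =
      (\<Sum>a<n. expo_string (2, 2 * a)) +
      ((\<Sum>a<n. \<Sum>b<a. expo_string (0, a - b + 1)) + (\<Sum>a\<in>{1..<n}. expo_string (0, 1))) +
      ((\<Sum>a<n. \<Sum>b<a. expo_string (1, a + b + 1)) + (\<Sum>a<n. expo_string (1, a)))"
    by (simp add: bn_neg_def image_mset_sum image_swap_expo_string add_ac)
  also have "\<dots> = ((\<Sum>a<n. expo_string (1, 2 * a)) + (\<Sum>a<n. \<Sum>b<a. expo_string (0, a - b)) +
        (\<Sum>a<n. \<Sum>b<a. expo_string (1, a + b))) + image_mset swap_expo (bn_pos n)"
    unfolding d s by (simp add: bn_pos_def image_mset_sum image_swap_expo_string add_ac)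
  finally show ?thesis
    unfolding dual_expos image_mset_union[symmetric] by (rule arg_cong)
qed

text \<open>The strings over \<open>(2, 2 * a)\<close> left by the roots \<open>e a + e b\<close>
  split by parity, and the even halves cancel the doubled axis denominators over
  \<open>(1, a)\<close>. The odd halves still meet the denominator strings over
  \<open>(2, a)\<close> with even \<open>a\<close>; the overlap is \<open>X\<close>, up to the
  swap.\<close>

lemma tilde_balanced:
  "num_expos (nu_root R) R (bc_positive 2 n e) + image_mset swap_expo (cn_tilde_neg n) =
   den_expos (nu_root R) R (bc_positive 2 n e) + image_mset swap_expo (cn_tilde_pos n)"
proof -
  note d = telescope_difference[of "\<lambda>a. expo_string (0, a)" n]
  note s = telescope_sum[of "\<lambda>a. expo_string (2, a)" n]
  obtain X where X:
    "(\<Sum>a\<in>{1..<n}. expo_string (1, 0)) + (\<Sum>a<n. expo_string (a, 2)) = cn_tilde_neg n + X"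
    "(\<Sum>m\<in>{2..n}. expo_string (m, 0)) + (\<Sum>a<n. scaled_string 2 (a, 2)) + (\<Sum>a<n. odd_string a) =
     cn_tilde_pos n + X"
    using cn_tilde_cancel by blast
  have even_odd: "expo_string (2, 2 * a) = scaled_string 2 (1, a) + image_mset swap_expo (odd_string a)" for a
    using arg_cong[OF expo_string_even_odd[of a], of "image_mset swap_expo"]
    by (simp add: image_swap_expo_string image_swap_scaled_string)
  have "num_expos (nu_root R) R (bc_positive 2 n e) + image_mset swap_expo (cn_tilde_neg n + X) =
      (\<Sum>a<n. scaled_string 2 (2, a)) +
      ((\<Sum>a<n. \<Sum>b<a. expo_string (0, a - b + 1)) + (\<Sum>a\<in>{1..<n}. expo_string (0, 1))) +
      ((\<Sum>a<n. \<Sum>b<a. expo_string (2, a + b + 1)) + (\<Sum>a<n. expo_string (2, a)))"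
    unfolding X(1)[symmetric]
    by (subst expos(1)[of _ 1 2]) (simp_all add: nu_root_eq image_mset_sum image_swap_expo_string add_ac)
  also have "\<dots> = den_expos (nu_root R) R (bc_positive 2 n e) + image_mset swap_expo (cn_tilde_pos n + X)"
    unfolding d s even_odd sum.distrib X(2)[symmetric]
    by (subst expos(2)[of _ 1 2]) (simp_all add: nu_root_eq image_mset_sum image_swap_expo_string
        image_swap_scaled_string add_ac)
  finally show ?thesis by (simp add: add_ac)
qed

end

section \<open>Rational exponents of types B and C\<close>

lemma sum_image_mset_Sigma:
  assumes "finite A" "\<And>a. a \<in> A \<Longrightarrow> finite (J a)"
  shows "(\<Sum>a\<in>A. image_mset (f a) (mset_set (J a))) = image_mset (\<lambda>(a, j). f a j) (mset_set (Sigma A J))"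
  using assms
proof (induction A rule: finite_induct)
  case (insert x A)
  have "mset_set (Sigma (insert x A) J) = mset_set (Pair x ` J x \<union> Sigma A J)"
    by (rule arg_cong[of _ _ mset_set]) auto
  also have "\<dots> = mset_set (Pair x ` J x) + mset_set (Sigma A J)"
    using insert by (intro mset_set_Union) auto
  also have "mset_set (Pair x ` J x) = image_mset (Pair x) (mset_set (J x))"
    by (simp add: image_mset_mset_set inj_on_def)
  finally show ?case using insert by (simp add: image_mset.compositionality o_def)
qed simp

text \<open>Filtering an indexed multiset amounts to filtering its index set; \<open>h\<close>
  reparametrizes the indices that survive.\<close>

lemma filter_image_mset_set:
  assumes "finite S" "inj_on h T" "{x \<in> S. P (f x)} = h ` T"
  shows "filter_mset P (image_mset f (mset_set S)) = image_mset (\<lambda>x. f (h x)) (mset_set T)"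
proof -
  have "filter_mset P (image_mset f (mset_set S)) = image_mset f (mset_set {x \<in> S. P (f x)})"
    using assms(1) by (simp add: filter_mset_image_mset)
  also have "\<dots> = image_mset f (image_mset h (mset_set T))"
    by (simp add: assms(3) image_mset_mset_set[OF assms(2)])
  finally show ?thesis by (simp add: image_mset.compositionality o_def)
qed

lemma filter_image_mset_set_eq:
  assumes "finite S" "{x \<in> S. P (f x)} = T"
  shows "filter_mset P (image_mset f (mset_set S)) = image_mset f (mset_set T)"
  using filter_image_mset_set[of S id T P f] assms by simp

lemma rel_mset_sum:
  "(\<And>x. x \<in> A \<Longrightarrow> rel_mset Q (f x) (g x)) \<Longrightarrow> rel_mset Q (\<Sum>x\<in>A. f x) (\<Sum>x\<in>A. g x)"
  by (induction A rule: infinite_finite_induct) (auto intro: rel_mset_add)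

lemma sum_subseteq_mset:
  "(\<And>x. x \<in> A \<Longrightarrow> f x \<subseteq># g x) \<Longrightarrow> (\<Sum>x\<in>A. f x) \<subseteq># (\<Sum>x\<in>A. g x)"
  by (induction A rule: infinite_finite_induct) (auto intro: subset_mset.add_mono)

lemma expo_string_nat: "expo_string (l, s) = image_mset (\<lambda>j. nat_expo (l, s, j)) (mset_set {..<l + s})"
  by (simp add: expo_string_def nat_expo_def)

lemma scaled_string_nat:
  "scaled_string (real k) (l, s) = image_mset (\<lambda>j. nat_expo (k * l, k * s, k * j)) (mset_set {..<l + s})"
  by (simp add: scaled_string_def expo_string_nat image_mset.compositionality o_def nat_expo_def)

lemmas scaled_string_2_nat = scaled_string_nat[of 2, unfolded of_nat_numeral]

lemma odd_string_nat: "odd_string a = image_mset (\<lambda>j. nat_expo (2 * a, 2, 2 * j + 1)) (mset_set {..a})"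
  by (simp add: odd_string_def nat_expo_def add.commute)

lemma nat_multiple_nat:
  "nat_multiple (nat_expo (l, s, j)) (nat_expo (l', s', j')) \<longleftrightarrow> (\<exists>c. l' = c * l \<and> s' = c * s \<and> j' = c * j)"
  by (simp add: nat_multiple_def nat_expo_def flip: of_nat_mult)

lemma nat_expo_eq_iff [simp]: "nat_expo x = nat_expo y \<longleftrightarrow> x = y"
  by (auto simp: nat_expo_def split: prod.splits)

lemma proportional_scaleR: "k \<noteq> 0 \<Longrightarrow> proportional e (k *\<^sub>R e)"
  by (auto simp: proportional_def)

lemma proportional_refl: "proportional e e"
  using proportional_scaleR[of 1 e] by simp

text \<open>Index sets shared by the rational exponents of both affine extensions:
  \<open>idx1\<close> for those over \<open>(m, 0)\<close>, \<open>idx2\<close> for those over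
  \<open>(2 * m, 2)\<close> with odd constant (swapped for type C). They allow an index by index
  comparison.\<close>

definition idx1 :: "nat \<Rightarrow> (nat \<times> nat) set" where "idx1 n = (SIGMA m:{2..n}. {0<..<m})"
definition idx2 :: "nat \<Rightarrow> (nat \<times> nat) set" where "idx2 n = (SIGMA m:{..<n}. {..m})"

lemma finite_idx: "finite (idx1 n)" "finite (idx2 n)"
  by (simp_all add: idx1_def idx2_def)

lemma bn_pos_image:
  "bn_pos n = image_mset (\<lambda>(m, j). nat_expo (m, 0, j)) (mset_set (SIGMA m:{2..n}. {..<m})) +
    image_mset (\<lambda>(a, j). nat_expo (2 * a, 2, j)) (mset_set (SIGMA a:{..<n}. {..<2 * a + 2}))"
  unfolding bn_pos_def expo_string_nat by (subst sum_image_mset_Sigma, simp, simp)+ simp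

lemma ball_sum_mset: "finite A \<Longrightarrow> (\<forall>e\<in>#(\<Sum>x\<in>A. M x). Q e) \<longleftrightarrow> (\<forall>x\<in>A. \<forall>e\<in>#M x. Q e)"
  by (metis mem_sum_mset)

lemma disjoint_msetI: "(\<forall>d\<in>#B. d \<notin># A) \<Longrightarrow> A \<inter># B = {#}"
  by (metis disjunct_not_in)

lemma ball_bn_neg:
  "n \<ge> 2 \<Longrightarrow> (\<forall>d\<in>#bn_neg n. Q d) \<longleftrightarrow> Q (nat_expo (1, 0, 0)) \<and> (\<forall>a<n. \<forall>j\<le>a. Q (nat_expo (a, 1, j)))"
  by (auto simp: bn_neg_def expo_string_nat ball_Un ball_sum_mset less_Suc_eq_le)

text \<open>The second coordinate is 1 in the denominator, except for \<open>(1, 0, 0)\<close>, and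
  0 or 2 in the numerator, where 0 comes with a first coordinate of at least 2.\<close>

lemma bn_disjoint:
  assumes "n \<ge> 2"
  shows "bn_pos n \<inter># bn_neg n = {#}"
  by (rule disjoint_msetI) (auto simp: ball_bn_neg[OF assms] bn_pos_image)

definition bn_rational :: "nat \<Rightarrow> expo multiset" where
  "bn_rational n = image_mset (\<lambda>(m, j). nat_expo (m, 0, j)) (mset_set (idx1 n)) +
    image_mset (\<lambda>(m, j). nat_expo (2 * m, 2, 2 * j + 1)) (mset_set (idx2 n))"

text \<open>A multiple of \<open>(a, 1, j)\<close> with second coordinate 2 is its double, so over
  \<open>(2 * m, 2)\<close> exactly the even constants drop out. Over \<open>(m, 0)\<close> only
  \<open>(1, 0, 0)\<close> can divide, which removes \<open>j = 0\<close>.\<close>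

lemma bn_rational:
  assumes "n \<ge> 2"
  shows "{# e \<in># bn_pos n. \<forall>d\<in>#bn_neg n. \<not> nat_multiple d e #} = bn_rational n"
proof -
  define P where "P e \<longleftrightarrow> (\<forall>d\<in>#bn_neg n. \<not> nat_multiple d e)" for e
  have P: "P (nat_expo (x, y, z)) \<longleftrightarrow> \<not> (y = 0 \<and> z = 0) \<and>
      \<not> (\<exists>a<n. \<exists>j\<le>a. \<exists>c. x = c * a \<and> y = c \<and> z = c * j)" for x y z
    unfolding P_def ball_bn_neg[OF assms] by (auto simp: nat_multiple_nat)
  have 1: "{p \<in> SIGMA m:{2..n}. {..<m}. P (case p of (m, j) \<Rightarrow> nat_expo (m, 0, j))} = idx1 n"
    by (auto simp: P idx1_def simp del: binom_nat_expo)
  have 2: "{p \<in> SIGMA a:{..<n}. {..<2 * a + 2}. P (case p of (m, j) \<Rightarrow> nat_expo (2 * m, 2, j))} =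
      (\<lambda>(m, j). (m, 2 * j + 1)) ` idx2 n"
  proof (intro equalityI subsetI)
    fix p assume p: "p \<in> {p \<in> SIGMA a:{..<n}. {..<2 * a + 2}. P (case p of (m, j) \<Rightarrow> nat_expo (2 * m, 2, j))}"
    obtain m j where [simp]: "p = (m, j)" by (cases p)
    have mj: "m < n" "j < 2 * m + 2" and "\<not> (\<exists>i\<le>m. j = 2 * i)"
      using p by (auto simp: P)
    have "odd j"
    proof
      assume "even j"
      then obtain i where "j = 2 * i" by (rule evenE)
      moreover from this have "i \<le> m" using mj(2) by simp
      ultimately show False using \<open>\<not> (\<exists>i\<le>m. j = 2 * i)\<close> by blast
    qed
    then obtain i where "j = 2 * i + 1" by (rule oddE)
    then show "p \<in> (\<lambda>(m, j). (m, 2 * j + 1)) ` idx2 n"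
      using mj by (force simp: idx2_def)
  next
    fix p assume "p \<in> (\<lambda>(m, j). (m, 2 * j + 1)) ` idx2 n"
    then obtain m j where "p = (m, 2 * j + 1)" "m < n" "j \<le> m" by (auto simp: idx2_def)
    then show "p \<in> {p \<in> SIGMA a:{..<n}. {..<2 * a + 2}. P (case p of (m, j) \<Rightarrow> nat_expo (2 * m, 2, j))}"
      by (auto simp: P) presburger
  qed
  show ?thesis
    unfolding P_def[symmetric] bn_pos_image filter_union_mset bn_rational_def
      filter_image_mset_set_eq[where P = P, OF _ 1, simplified]
    by (subst filter_image_mset_set[where P = P, OF _ _ 2]) (auto simp: inj_on_def case_prod_unfold)
qed

lemma bn_tilde_pos_image:
  "bn_tilde_pos n = image_mset (\<lambda>(m, j). nat_expo (2 * m, 0, 2 * j)) (mset_set (SIGMA m:{2..n}. {..<m})) +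
    image_mset (\<lambda>(a, j). nat_expo (4 * a, 2, 2 * j)) (mset_set (SIGMA a:{..<n}. {..<2 * a + 1})) +
    image_mset (\<lambda>(a, j). nat_expo (2 * a, 2, 2 * j + 1)) (mset_set (idx2 n))"
  unfolding bn_tilde_pos_def scaled_string_2_nat odd_string_nat idx2_def
  by (subst sum_image_mset_Sigma, simp, simp)+ simp

lemma ball_bn_tilde_neg:
  "n \<ge> 2 \<Longrightarrow> (\<forall>d\<in>#bn_tilde_neg n. Q d) \<longleftrightarrow>
    Q (nat_expo (2, 0, 0)) \<and> (\<forall>a<n. \<forall>j\<le>2 * a. Q (nat_expo (2 * a, 1, j)))"
  by (auto simp: bn_tilde_neg_def expo_string_nat scaled_string_2_nat ball_Un ball_sum_mset less_Suc_eq_le)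

lemma bn_tilde_disjoint:
  assumes "n \<ge> 2"
  shows "bn_tilde_pos n \<inter># bn_tilde_neg n = {#}"
  by (rule disjoint_msetI) (auto simp: ball_bn_tilde_neg[OF assms] bn_tilde_pos_image finite_idx)

text \<open>All \<open>(4 * a, 2, 2 * j)\<close> are doubles of denominators
  \<open>(2 * a, 1, j)\<close> and disappear; with second coordinate 2 and an odd constant no such
  double arises.\<close>

lemma bn_tilde_rational:
  assumes "n \<ge> 2"
  shows "{# e \<in># bn_tilde_pos n. \<forall>d\<in>#bn_tilde_neg n. \<not> nat_multiple d e #} =
    image_mset (\<lambda>(m, j). nat_expo (2 * m, 0, 2 * j)) (mset_set (idx1 n)) +
    image_mset (\<lambda>(m, j). nat_expo (2 * m, 2, 2 * j + 1)) (mset_set (idx2 n))"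
proof -
  define P where "P e \<longleftrightarrow> (\<forall>d\<in>#bn_tilde_neg n. \<not> nat_multiple d e)" for e
  have P: "P (nat_expo (x, y, z)) \<longleftrightarrow> \<not> (even x \<and> y = 0 \<and> z = 0) \<and>
      \<not> (\<exists>a<n. \<exists>j\<le>2 * a. \<exists>c. x = c * (2 * a) \<and> y = c \<and> z = c * j)" for x y z
    unfolding P_def ball_bn_tilde_neg[OF assms] by (auto simp: nat_multiple_nat elim!: evenE)
  have 1: "{p \<in> SIGMA m:{2..n}. {..<m}. P (case p of (m, j) \<Rightarrow> nat_expo (2 * m, 0, 2 * j))} = idx1 n"
    by (auto simp: P idx1_def)
  have 2: "{p \<in> SIGMA a:{..<n}. {..<2 * a + 1}. P (case p of (a, j) \<Rightarrow> nat_expo (4 * a, 2, 2 * j))} = {}"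
    by (auto simp: P)
  have 3: "{p \<in> idx2 n. P (case p of (a, j) \<Rightarrow> nat_expo (2 * a, 2, 2 * j + 1))} = idx2 n"
    by (auto simp: P) presburger
  have fin: "finite (SIGMA m:{2..n}. {..<m})" "finite (SIGMA a:{..<n}. {..<2 * a + 1})" by simp_all
  show ?thesis
    unfolding P_def[symmetric] bn_tilde_pos_image filter_union_mset
      filter_image_mset_set_eq[where P = P, OF fin(1) 1] filter_image_mset_set_eq[where P = P, OF fin(2) 2]
      filter_image_mset_set_eq[where P = P, OF finite_idx(2) 3]
    by simp
qed

lemma bn_rel:
  assumes "n \<ge> 2"
  shows "rel_mset proportional {# e \<in># bn_pos n. \<forall>d\<in>#bn_neg n. \<not> nat_multiple d e #}
    {# e \<in># bn_tilde_pos n. \<forall>d\<in>#bn_tilde_neg n. \<not> nat_multiple d e #}"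
proof -
  have "nat_expo (2 * m, 0, 2 * j) = 2 *\<^sub>R nat_expo (m, 0, j)" for m j by (simp add: nat_expo_def)
  then have "proportional (nat_expo (m, 0, j)) (nat_expo (2 * m, 0, 2 * j))" for m j
    using proportional_scaleR[of 2 "nat_expo (m, 0, j)"] by simp
  then show ?thesis
    unfolding bn_rational[OF assms] bn_tilde_rational[OF assms] bn_rational_def
    by (intro rel_mset_add rel_mset_image_image) (auto simp: proportional_refl)
qed

text \<open>Multiples for the exponents of \<open>bn_neg\<close>: the \<open>n - 1\<close> copies of
  \<open>(1, 0, 0)\<close> receive the different exponents \<open>(a + 1, 0, 0)\<close>, and the
  string over \<open>(a, 1)\<close> is doubled into the even half of the string over
  \<open>(2 * a, 2)\<close>.\<close>

definition bn_div :: "nat \<Rightarrow> expo multiset" where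
  "bn_div n = (\<Sum>a\<in>{1..<n}. {# nat_expo (a + 1, 0, 0) #}) + (\<Sum>a<n. scaled_string 2 (a, 1))"

lemma bn_div:
  "rel_mset nat_multiple (bn_neg n) (bn_div n)" "bn_div n \<subseteq># bn_pos n"
proof -
  have 1: "expo_string (1, 0) = image_mset (\<lambda>_. nat_expo (1, 0, 0)) {#()#}"
    "{# nat_expo (a + 1, 0, 0) #} = image_mset (\<lambda>_. nat_expo (a + 1, 0, 0)) {#()#}" for a
    by (simp_all add: expo_string_nat lessThan_Suc)
  show "rel_mset nat_multiple (bn_neg n) (bn_div n)"
    unfolding bn_neg_def bn_div_def
  proof (intro rel_mset_add rel_mset_sum)
    show "rel_mset nat_multiple (expo_string (1, 0)) {# nat_expo (a + 1, 0, 0) #}" for a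
      unfolding 1 by (intro rel_mset_image_image) (simp add: nat_multiple_nat)
    show "rel_mset nat_multiple (expo_string (a, 1)) (scaled_string 2 (a, 1))" for a
      unfolding expo_string_nat scaled_string_2_nat
      by (intro rel_mset_image_image) (auto simp: nat_multiple_nat intro!: exI[of _ 2])
  qed
  have "(\<Sum>a\<in>{1..<n}. {# nat_expo (a + 1, 0, 0) #}) = (\<Sum>m\<in>{2..n}. {# nat_expo (m, 0, 0) #})"
    by (rule sum.reindex_bij_witness[of _ "\<lambda>m. m - 1" "\<lambda>a. a + 1"]) auto
  also have "\<dots> \<subseteq># (\<Sum>m\<in>{2..n}. expo_string (m, 0))"
    by (intro sum_subseteq_mset) (auto simp: expo_string_nat)
  finally show "bn_div n \<subseteq># bn_pos n"
    unfolding bn_pos_def bn_div_def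
    by (intro subset_mset.add_mono sum_subseteq_mset) (simp_all add: expo_string_even_odd)
qed

lemma cn_tilde_pos_image:
  "cn_tilde_pos n = image_mset (\<lambda>(m, j). nat_expo (m, 0, j)) (mset_set (SIGMA m:{2..n}. {..<m})) +
    image_mset (\<lambda>(a, j). nat_expo (2 * a, 4, 2 * j)) (mset_set (SIGMA a:{..<n}. {..<a + 2})) +
    image_mset (\<lambda>(a, j). nat_expo (2 * a, 2, 2 * j + 1)) (mset_set (SIGMA a:{a. a < n \<and> n \<le> 2 * a}. {..a}))"
  unfolding cn_tilde_pos_def scaled_string_2_nat odd_string_nat expo_string_nat
  by (subst sum_image_mset_Sigma, simp, simp)+ simp

lemma ball_cn_tilde_neg:
  "n \<ge> 2 \<Longrightarrow> (\<forall>d\<in>#cn_tilde_neg n. Q d) \<longleftrightarrow> Q (nat_expo (1, 0, 0)) \<and>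
    (\<forall>a<n. \<forall>j<a + 2. even a \<longrightarrow> even j \<longrightarrow> Q (nat_expo (a, 2, j))) \<and>
    (\<forall>a<n. \<forall>j<a + 2. odd a \<longrightarrow> Q (nat_expo (a, 2, j)))"
proof -
  assume n: "n \<ge> 2"
  have *: "(\<forall>d\<in>#cn_tilde_neg n. Q d) \<longleftrightarrow> Q (nat_expo (1, 0, 0)) \<and>
      (\<forall>a<n. \<forall>d\<in>#(if even a then scaled_string 2 (a div 2, 1) else expo_string (a, 2)). Q d)"
  proof -
    have 1: "(\<forall>d\<in>#expo_string (1, 0). Q d) \<longleftrightarrow> Q (nat_expo (1, 0, 0))"
      by (simp add: expo_string_nat lessThan_Suc)
    have 2: "(\<forall>a\<in>{1..<n}. X) \<longleftrightarrow> X" for X using n by auto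
    show ?thesis
      unfolding cn_tilde_neg_def set_mset_union ball_Un ball_sum_mset[OF finite_atLeastLessThan]
        ball_sum_mset[OF finite_lessThan] 1 2 by (simp only: Ball_def[of "{..<n}"] lessThan_iff)
  qed
  have **: "(\<forall>d\<in>#(if even a then scaled_string 2 (a div 2, 1) else expo_string (a, 2)). Q d) \<longleftrightarrow>
      (\<forall>j<a + 2. even a \<longrightarrow> even j \<longrightarrow> Q (nat_expo (a, 2, j))) \<and>
      (\<forall>j<a + 2. odd a \<longrightarrow> Q (nat_expo (a, 2, j)))" for a
  proof (cases "even a")
    case True
    then have "2 * (a div 2) = a" by simp
    then have "(\<forall>i<a div 2 + 1. Q (nat_expo (a, 2, 2 * i))) \<longleftrightarrow> (\<forall>j<a + 2. even j \<longrightarrow> Q (nat_expo (a, 2, j)))"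
      by (auto elim!: evenE)
    with \<open>2 * (a div 2) = a\<close> True show ?thesis
      by (simp add: scaled_string_2_nat) (simp add: less_Suc_eq_le Ball_def)
  qed (auto simp: expo_string_nat)
  show ?thesis unfolding * ** by blast
qed

lemma mem_cn_tilde_pos:
  "nat_expo (x, y, z) \<in># cn_tilde_pos n \<Longrightarrow> (y = 0 \<and> x \<ge> 2) \<or> y = 4 \<or> (y = 2 \<and> n \<le> x)"
  unfolding cn_tilde_pos_image by auto

text \<open>Numerators with second coordinate 2 have first coordinate at least \<open>n\<close>, the
  denominators with second coordinate 2 have it below \<open>n\<close>.\<close>

lemma cn_tilde_disjoint:
  assumes "n \<ge> 2"
  shows "cn_tilde_pos n \<inter># cn_tilde_neg n = {#}"
  by (rule disjoint_msetI) (unfold ball_cn_tilde_neg[OF assms], auto dest!: mem_cn_tilde_pos)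

definition idx2_low :: "nat \<Rightarrow> (nat \<times> nat) set" where "idx2_low n = (SIGMA m:{m. 2 * m < n}. {..m})"
definition idx2_high :: "nat \<Rightarrow> (nat \<times> nat) set" where "idx2_high n = (SIGMA m:{m. m < n \<and> n \<le> 2 * m}. {..m})"

lemma idx2_split: "mset_set (idx2 n) = mset_set (idx2_low n) + mset_set (idx2_high n)"
proof -
  have "idx2 n = idx2_low n \<union> idx2_high n" "idx2_low n \<inter> idx2_high n = {}"
    by (auto simp: idx2_def idx2_low_def idx2_high_def)
  moreover from this have "finite (idx2_low n)" "finite (idx2_high n)"
    using finite_idx(2)[of n] by simp_all
  ultimately show ?thesis by (simp add: mset_set_Union)
qed

text \<open>\<open>(2 * a, 4, 2 * j)\<close> is twice \<open>(a, 2, j)\<close>, a denominator unless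
  \<open>a\<close> is even and \<open>j\<close> is odd, in which case it has cancelled before. The
  doubles that survive replace exactly the exponents of \<open>odd_string m\<close> lost for
  \<open>2 * m < n\<close>.\<close>

lemma cn_tilde_rational:
  assumes "n \<ge> 2"
  shows "{# e \<in># cn_tilde_pos n. \<forall>d\<in>#cn_tilde_neg n. \<not> nat_multiple d e #} =
    image_mset (\<lambda>(m, j). nat_expo (m, 0, j)) (mset_set (idx1 n)) +
    (image_mset (\<lambda>(m, j). nat_expo (4 * m, 4, 4 * j + 2)) (mset_set (idx2_low n)) +
     image_mset (\<lambda>(m, j). nat_expo (2 * m, 2, 2 * j + 1)) (mset_set (idx2_high n)))"
proof -
  define P where "P e \<longleftrightarrow> (\<forall>d\<in>#cn_tilde_neg n. \<not> nat_multiple d e)" for e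
  have P: "P (nat_expo (x, y, z)) \<longleftrightarrow> \<not> (y = 0 \<and> z = 0) \<and>
      (\<forall>a<n. \<forall>j<a + 2. even a \<longrightarrow> even j \<longrightarrow> \<not> (\<exists>c. x = c * a \<and> y = c * 2 \<and> z = c * j)) \<and>
      (\<forall>a<n. \<forall>j<a + 2. odd a \<longrightarrow> \<not> (\<exists>c. x = c * a \<and> y = c * 2 \<and> z = c * j))" for x y z
    unfolding P_def ball_cn_tilde_neg[OF assms] nat_multiple_nat by simp
  \<comment> \<open>For a denominator with second coordinate 2, the second coordinate 0, 2 or 4 of a
    multiple fixes the coefficient as 0, 1 or 2.\<close>
  have c0: "(\<exists>c. X c \<and> 0 = c * 2 \<and> Y c) \<longleftrightarrow> X 0 \<and> Y 0"
    and c2: "(\<exists>c. X c \<and> 2 = c * 2 \<and> Y c) \<longleftrightarrow> X 1 \<and> Y 1"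
    and c4: "(\<exists>c. X c \<and> 4 = c * 2 \<and> Y c) \<longleftrightarrow> X 2 \<and> Y 2" for X Y :: "nat \<Rightarrow> bool"
  proof -
    have *: "0 = c * 2 \<longleftrightarrow> c = 0" "2 = c * 2 \<longleftrightarrow> c = 1" "4 = c * 2 \<longleftrightarrow> c = 2" for c :: nat by auto
    show "(\<exists>c. X c \<and> 0 = c * 2 \<and> Y c) \<longleftrightarrow> X 0 \<and> Y 0"
      "(\<exists>c. X c \<and> 2 = c * 2 \<and> Y c) \<longleftrightarrow> X 1 \<and> Y 1"
      "(\<exists>c. X c \<and> 4 = c * 2 \<and> Y c) \<longleftrightarrow> X 2 \<and> Y 2" unfolding * by blast+
  qed
  have P0: "P (nat_expo (m, 0, j)) \<longleftrightarrow> j \<noteq> 0" if "m \<ge> 2" for m j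
    unfolding P c0 using that by auto
  have 1: "{p \<in> SIGMA m:{2..n}. {..<m}. P (case p of (m, j) \<Rightarrow> nat_expo (m, 0, j))} = idx1 n"
    by (auto simp: P0 idx1_def)
  have P1: "P (nat_expo (2 * a, 2, z))" if "n \<le> 2 * a" for a z
    unfolding P c2 using that by auto
  have P2: "P (nat_expo (2 * a, 4, 2 * j)) \<longleftrightarrow> even a \<and> odd j" if "a < n" "j < a + 2" for a j
    unfolding P c4 using that by auto
  have 2: "{p \<in> SIGMA a:{..<n}. {..<a + 2}. P (case p of (a, j) \<Rightarrow> nat_expo (2 * a, 4, 2 * j))} =
      (\<lambda>(m, j). (2 * m, 2 * j + 1)) ` idx2_low n"
  proof (intro equalityI subsetI)
    fix p assume p: "p \<in> {p \<in> SIGMA a:{..<n}. {..<a + 2}. P (case p of (a, j) \<Rightarrow> nat_expo (2 * a, 4, 2 * j))}"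
    obtain a j where [simp]: "p = (a, j)" by (cases p)
    have "a < n" "j < a + 2" "even a" "odd j" using p P2 by auto
    then obtain m i where "a = 2 * m" "j = 2 * i + 1" by (auto elim!: evenE oddE)
    with \<open>a < n\<close> \<open>j < a + 2\<close> have "(m, i) \<in> idx2_low n" "p = (2 * m, 2 * i + 1)"
      by (auto simp: idx2_low_def)
    then show "p \<in> (\<lambda>(m, j). (2 * m, 2 * j + 1)) ` idx2_low n" by force
  next
    fix p assume "p \<in> (\<lambda>(m, j). (2 * m, 2 * j + 1)) ` idx2_low n"
    then obtain m j where p: "p = (2 * m, 2 * j + 1)" "2 * m < n" "j \<le> m" by (auto simp: idx2_low_def)
    then have "P (nat_expo (2 * (2 * m), 4, 2 * (2 * j + 1)))"
      by (subst P2) auto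
    with p show "p \<in> {p \<in> SIGMA a:{..<n}. {..<a + 2}. P (case p of (a, j) \<Rightarrow> nat_expo (2 * a, 4, 2 * j))}"
      by simp
  qed
  have 3: "{p \<in> SIGMA a:{a. a < n \<and> n \<le> 2 * a}. {..a}. P (case p of (a, j) \<Rightarrow> nat_expo (2 * a, 2, 2 * j + 1))}
      = idx2_high n"
    using P1 by (auto simp: idx2_high_def)
  have fin: "finite (SIGMA m:{2..n}. {..<m})" "finite (SIGMA a:{..<n}. {..<a + 2})"
    "finite (SIGMA a:{a. a < n \<and> n \<le> 2 * a}. {..a})" by simp_all
  have inj: "inj_on (\<lambda>(m, j). (2 * m, 2 * j + 1)) (idx2_low n)"
    by (auto simp: inj_on_def)
  show ?thesis
    unfolding P_def[symmetric] cn_tilde_pos_image filter_union_mset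
      filter_image_mset_set_eq[where P = P, OF fin(1) 1] filter_image_mset_set[where P = P, OF fin(2) inj 2]
      filter_image_mset_set_eq[where P = P, OF fin(3) 3]
    by (simp add: case_prod_unfold add.assoc)
qed

lemma cn_rel:
  assumes "n \<ge> 2"
  shows "rel_mset proportional {# e \<in># bn_pos n. \<forall>d\<in>#bn_neg n. \<not> nat_multiple d e #}
    {# e \<in># cn_tilde_pos n. \<forall>d\<in>#cn_tilde_neg n. \<not> nat_multiple d e #}"
proof -
  have "nat_expo (4 * m, 4, 4 * j + 2) = 2 *\<^sub>R nat_expo (2 * m, 2, 2 * j + 1)" for m j
    by (simp add: nat_expo_def)
  then have "proportional (nat_expo (2 * m, 2, 2 * j + 1)) (nat_expo (4 * m, 4, 4 * j + 2))" for m j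
    using proportional_scaleR[of 2 "nat_expo (2 * m, 2, 2 * j + 1)"] by simp
  then show ?thesis
    unfolding bn_rational[OF assms] cn_tilde_rational[OF assms] bn_rational_def idx2_split image_mset_union
    by (intro rel_mset_add rel_mset_image_image) (auto simp: proportional_refl)
qed

lemma nat_multiple_swap: "nat_multiple (swap_expo d) (swap_expo e) \<longleftrightarrow> nat_multiple d e"
  by (cases d; cases e) (auto simp: nat_multiple_def swap_expo_def)

lemma filter_swap:
  "{# e \<in># image_mset swap_expo A. \<forall>d\<in>#image_mset swap_expo B. \<not> nat_multiple d e #} =
    image_mset swap_expo {# e \<in># A. \<forall>d\<in>#B. \<not> nat_multiple d e #}"
  by (simp add: filter_mset_image_mset nat_multiple_swap)

lemma rel_mset_swap:
  assumes "rel_mset Q A B" "\<And>d e. Q d e \<Longrightarrow> Q (swap_expo d) (swap_expo e)"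
  shows "rel_mset Q (image_mset swap_expo A) (image_mset swap_expo B)"
  unfolding multiset.rel_map using assms(1) by (rule multiset.rel_mono_strong) (use assms(2) in auto)

lemma proportional_swap: "proportional d e \<Longrightarrow> proportional (swap_expo d) (swap_expo e)"
  by (cases d; cases e) (auto simp: proportional_def swap_expo_def)

lemma disjoint_swap: "A \<inter># B = {#} \<Longrightarrow> image_mset swap_expo A \<inter># image_mset swap_expo B = {#}"
  unfolding disjunct_not_in using swap_expo_cube(3) by (metis image_iff set_image_mset)

section \<open>Proportional pairs and the product for \<open>B\<^sub>n\<close>\<close>

lemma inj_on_nat_expo:
  "inj_on (\<lambda>(m, j). nat_expo (m, 0, j)) I" "inj_on (\<lambda>(m, j). nat_expo (2 * m, 2, 2 * j + 1)) I"
  by (auto simp: inj_on_def)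

lemma bn_rational_mset_set:
  "bn_rational n = mset_set ((\<lambda>(m, j). nat_expo (m, 0, j)) ` idx1 n \<union> (\<lambda>(m, j). nat_expo (2 * m, 2, 2 * j + 1)) ` idx2 n)"
  unfolding bn_rational_def image_mset_mset_set[OF inj_on_nat_expo(1)] image_mset_mset_set[OF inj_on_nat_expo(2)]
  by (rule mset_set_Union[symmetric]) (auto simp: finite_idx)

lemma pair_subset_mset_set:
  assumes "finite S"
  shows "{#e, f#} \<subseteq># mset_set S \<longleftrightarrow> e \<noteq> f \<and> e \<in> S \<and> f \<in> S"
proof (cases "e = f")
  case True
  then show ?thesis
    using mset_subset_eq_count[of "{#e, f#}" "mset_set S" e] by (auto simp: count_mset_set' split: if_splits)
next
  case False
  then show ?thesis using msubset_mset_set_iff[of "{e, f}" S] assms by simp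
qed

lemma proportional_pairs_mset_set:
  assumes "finite S"
  shows "proportional_pairs (mset_set S) = {{#e, f#} | e f. e \<in> S \<and> f \<in> S \<and> e \<noteq> f \<and> proportional e f}"
  unfolding proportional_pairs_def pair_subset_mset_set[OF assms] by blast

text \<open>Second coordinate 2 forces the factor 1, and 0 against 2 excludes mixed pairs, so both
  members are over some \<open>(m, 0)\<close> with equal \<open>j / m\<close>. The ratio
  \<open>l\<close> of the first coordinates need not be an integer, as for \<open>(4, 0, 2)\<close>
  and \<open>(6, 0, 3)\<close>.\<close>

lemma bn_proportional_pairs:
  "proportional_pairs (bn_rational n) =
    {{# (real m, 0, real j), l *\<^sub>R (real m, 0, real j) #} | m j l.
             l \<in> \<rat> \<and> l > 1 \<and> l * real m \<in> \<nat> \<and> l * real j \<in> \<nat> \<and>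
             m > 1 \<and> j < m \<and> real j / real m \<notin> \<int> \<and> l * real m \<le> real n}" (is "_ = ?rhs")
proof (intro equalityI subsetI)
  let ?S = "(\<lambda>(m, j). nat_expo (m, 0, j)) ` idx1 n \<union> (\<lambda>(m, j). nat_expo (2 * m, 2, 2 * j + 1)) ` idx2 n"
  have fin: "finite ?S" by (simp add: finite_idx)
  note pairs = proportional_pairs_mset_set[OF fin, folded bn_rational_mset_set]
  have not_int: "real j / real m \<notin> \<int>" if "0 < j" "j < m" for j m :: nat
  proof
    assume "real j / real m \<in> \<int>"
    moreover have "0 < real j / real m" "real j / real m < 1" using that by auto
    ultimately show False by (auto elim!: Ints_cases)
  qed
  {
    fix X assume "X \<in> proportional_pairs (bn_rational n)"
    then obtain e f where X: "X = {#e, f#}" and ef: "e \<in> ?S" "f \<in> ?S" "e \<noteq> f" "proportional e f"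
      unfolding pairs by blast
    have *: "{#nat_expo (m, 0, j), nat_expo (m', 0, j')#} \<in> ?rhs"
      if "(m, j) \<in> idx1 n" "(m', j') \<in> idx1 n" "m < m'" "real m * real j' = real m' * real j" for m j m' j'
    proof -
      define l where "l = real m' / real m"
      have "m \<ge> 2" "m' \<le> n" "0 < j" "j < m" using that by (auto simp: idx1_def)
      moreover from this have "l * real m = real m'" "l * real j = real j'"
        using that(4) by (auto simp: l_def field_simps)
      moreover have "l \<in> \<rat>" by (simp add: l_def)
      moreover have "l > 1" using that(3) \<open>m \<ge> 2\<close> by (simp add: l_def)
      ultimately show ?thesis
        using not_int[of j m]
        by (intro CollectI exI[of _ m] exI[of _ j] exI[of _ l]) (simp add: nat_expo_def)
    qed
    from ef(4) obtain k where k: "f = k *\<^sub>R e" "k \<noteq> 0" unfolding proportional_def by blast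
    have "(\<exists>m j. (m, j) \<in> idx1 n \<and> e = nat_expo (m, 0, j)) \<or> (\<exists>m j. e = nat_expo (2 * m, 2, j))"
      "(\<exists>m j. (m, j) \<in> idx1 n \<and> f = nat_expo (m, 0, j)) \<or> (\<exists>m j. f = nat_expo (2 * m, 2, j))"
      using ef(1,2) by auto
    then consider
        m j m' j' where "(m, j) \<in> idx1 n" "(m', j') \<in> idx1 n" "e = nat_expo (m, 0, j)" "f = nat_expo (m', 0, j')"
      | m j m' j' where "e = nat_expo (2 * m, 2, j)" "f = nat_expo (2 * m', 2, j')"
      | m j m' j' where "e = nat_expo (m, 0, j)" "f = nat_expo (m', 2, j')"
      | m j m' j' where "e = nat_expo (m, 2, j)" "f = nat_expo (m', 0, j')"
      by blast
    then show "X \<in> ?rhs"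
    proof cases
      case 1
      note e_eq = 1(3) and f_eq = 1(4)
      have km: "real m' = k * real m" "real j' = k * real j" using k(1) 1 by (auto simp: nat_expo_def)
      then have c: "real m * real j' = real m' * real j" by simp
      have "m \<noteq> m'"
      proof
        assume "m = m'"
        then have "k = 1" using km(1) 1 by (auto simp: idx1_def)
        then show False using k ef(3) by simp
      qed
      \<comment> \<open>Pairs are unordered; the smaller first coordinate is put first to have
        \<open>l > 1\<close>.\<close>
      then consider "m < m'" | "m' < m" by linarith
      then show ?thesis
      proof cases
        case 1
        then show ?thesis using * \<open>(m, j) \<in> idx1 n\<close> \<open>(m', j') \<in> idx1 n\<close> c X e_eq f_eq by simp
      next
        case 2
        have "X = {#nat_expo (m', 0, j'), nat_expo (m, 0, j)#}"
          using X e_eq f_eq by (simp add: add_mset_commute)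
        then show ?thesis using *[of m' j' m j] 2 \<open>(m, j) \<in> idx1 n\<close> \<open>(m', j') \<in> idx1 n\<close> c by simp
      qed
    next
      case 2
      then have "k = 1" using k by (auto simp: nat_expo_def)
      then show ?thesis using k ef(3) by simp
    qed (use k in \<open>auto simp: nat_expo_def\<close>)
  }
  {
    fix X assume "X \<in> ?rhs"
    then obtain m j l where X: "X = {# (real m, 0, real j), l *\<^sub>R (real m, 0, real j) #}" and
      l: "l > 1" "l * real m \<in> \<nat>" "l * real j \<in> \<nat>" and
      mj: "m > 1" "j < m" "real j / real m \<notin> \<int>" "l * real m \<le> real n" by blast
    obtain m' j' where m': "l * real m = real m'" "l * real j = real j'" using l by (auto elim!: Nats_cases)
    have "j > 0" using mj(3) by (cases "j = 0") auto
    have "real m < real m'" using l(1) mj(1) by (simp flip: m'(1))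
    then have "(m, j) \<in> idx1 n" using mj \<open>j > 0\<close> m' by (simp add: idx1_def)
    moreover have "real j' < real m'" "real j' > 0"
      using l(1) mj(2) \<open>j > 0\<close> by (simp_all flip: m')
    then have "(m', j') \<in> idx1 n" using mj m' \<open>real m < real m'\<close> by (simp add: idx1_def)
    moreover have "l *\<^sub>R (real m, 0, real j) = nat_expo (m', 0, j')" "(real m, 0, real j) = nat_expo (m, 0, j)"
      using m' by (simp_all add: nat_expo_def)
    moreover have "nat_expo (m, 0, j) \<noteq> nat_expo (m', 0, j')" using \<open>real m < real m'\<close> by simp
    moreover have "proportional (real m, 0, real j) (l *\<^sub>R (real m, 0, real j))"
      using l(1) by (intro proportional_scaleR) simp
    ultimately show "X \<in> proportional_pairs (bn_rational n)"
      unfolding pairs X by (intro CollectI exI conjI refl) force+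
  }
qed

lemma size_sum_mset: "size (\<Sum>x\<in>A. M x :: 'a multiset) = (\<Sum>x\<in>A. size (M x))"
  by (induction A rule: infinite_finite_induct) auto

text \<open>The total is \<open>n - 1\<close>, from the copies of \<open>(1, 0, 0)\<close>, plus
  \<open>n * (n + 1) / 2\<close>, from strings of lengths 1 to \<open>n\<close>.\<close>

lemma size_bn_neg:
  assumes "n \<ge> 2"
  shows "real (size (bn_neg n)) = (real n ^ 2 + 3 * real n - 2) / 2"
proof -
  have "real (\<Sum>a<n. a + 1) = real n * (real n + 1) / 2"
    by (induction n) (simp_all add: field_simps)
  then show ?thesis
    using assms by (simp add: bn_neg_def size_sum_mset expo_string_def power2_eq_square field_simps of_nat_diff)
qed

lemma prod_binom_expo_string:
  "prod_mset (image_mset (binom q ql qs) (expo_string (l, s))) = (\<Prod>j<l + s. 1 - ql ^ l * qs ^ s * q ^ j)"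
  by (simp add: expo_string_nat image_mset.compositionality o_def prod_unfold_prod_mset)

lemma bn_quotient:
  assumes "n \<ge> 2"
  shows "prod_mset (image_mset (binom q ql qs) (bn_pos n)) / prod_mset (image_mset (binom q ql qs) (bn_neg n)) =
    ((\<Prod>m=2..n. \<Prod>j=0..m-1. 1 - ql^m * q^j) *
           (\<Prod>m=0..n-1. \<Prod>j=0..2*m+1. 1 - qs^2 * ql^(2*m) * q^j)) /
          ((1 - ql)^(n-1) *
           (\<Prod>m=0..n-1. \<Prod>j=0..m. 1 - qs * ql^m * q^j))"
proof -
  have "prod_mset (image_mset (binom q ql qs) (bn_pos n)) =
      (\<Prod>m=2..n. \<Prod>j=0..m-1. 1 - ql^m * q^j) * (\<Prod>m=0..n-1. \<Prod>j=0..2*m+1. 1 - qs^2 * ql^(2*m) * q^j)"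
    unfolding bn_pos_def image_mset_union prod_mset.union prod_mset_image_sum prod_binom_expo_string
    using assms by (intro arg_cong2[of _ _ _ _ "(*)"] prod.cong) (auto simp: mult.commute)
  moreover have "prod_mset (image_mset (binom q ql qs) (bn_neg n)) =
      (1 - ql)^(n-1) * (\<Prod>m=0..n-1. \<Prod>j=0..m. 1 - qs * ql^m * q^j)"
    unfolding bn_neg_def image_mset_union prod_mset.union prod_mset_image_sum prod_binom_expo_string
    using assms by (intro arg_cong2[of _ _ _ _ "(*)"] prod.cong) (auto simp: mult.commute)
  ultimately show ?thesis by simp
qed

section \<open>Conclusions for types B and C\<close>

context bc_B
begin

lemmas regular_and_dual_B = regular_and_dualI[OF heights hat_balanced bn_disjoint[OF n] dual_balanced bn_div
  tilde_balanced bn_tilde_disjoint[OF n] bn_rel[OF n]]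

lemma rational: "rational_expos nu_one R (bc_positive 1 n e) = bn_rational n"
  unfolding bn_rational[OF n, symmetric]
  by (rule rational_expos_balanced[OF hat_balanced bn_disjoint[OF n]]) (rule expos_cube[OF heights(1)], simp_all)

lemmas negative = balanced_cancel(2)[OF hat_balanced bn_disjoint[OF n]]

lemma quotient: "Pi_hat R (bc_positive 1 n e) q_ind q_lng q_sht =
    prod_mset (image_mset (binom q_ind q_lng q_sht) (bn_pos n)) /
    prod_mset (image_mset (binom q_ind q_lng q_sht) (bn_neg n))"
  by (rule Pi_hat_eq_quotient(1)[OF heights(1) hat_balanced bn_disjoint[OF n]])

end

context bc_C
begin

lemma rational_rel:
  "rel_mset proportional
    {# e \<in># image_mset swap_expo (bn_pos n). \<forall>d\<in>#image_mset swap_expo (bn_neg n). \<not> nat_multiple d e #}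
    {# e \<in># image_mset swap_expo (cn_tilde_pos n). \<forall>d\<in>#image_mset swap_expo (cn_tilde_neg n). \<not> nat_multiple d e #}"
  unfolding filter_swap by (rule rel_mset_swap[OF cn_rel[OF n] proportional_swap])

lemmas regular_and_dual_C = regular_and_dualI[OF heights hat_balanced disjoint_swap[OF bn_disjoint[OF n]] dual_balanced
  rel_mset_swap[OF bn_div(1) nat_multiple_swap[THEN iffD2]] image_mset_subseteq_mono[OF bn_div(2)]
  tilde_balanced disjoint_swap[OF cn_tilde_disjoint[OF n]] rational_rel]

end

lemma ex_bc_frame:
  assumes R: "root_system R" "positive_roots R Rp" and e: "orthogonal_frame n e"
    and R_eq: "R = bc_roots t n e" and t: "t = 1 \<or> t = 2" and n: "n \<ge> 2"
  obtains e c where "bc_frame t n e c" "Rp = bc_positive t n e"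
    "R = bc_positive t n e \<union> uminus ` bc_positive t n e"
proof -
  have "t > 0" "n \<ge> 1" using t n by auto
  then obtain f where f: "orthogonal_frame n f" "Rp = bc_positive t n f"
    by (rule bc_dominant[OF R e R_eq])
  obtain c where c: "c > 0" "\<forall>i<n. \<forall>j<n. f i \<bullet> f j = (if i = j then c else 0)"
    using f(1) unfolding orthogonal_frame_def by blast
  have "bc_frame t n f c"
    by unfold_locales (use c t n in simp_all)
  moreover obtain v where "\<forall>\<alpha>\<in>R. v \<bullet> \<alpha> \<noteq> 0" "Rp = {\<alpha> \<in> R. v \<bullet> \<alpha> > 0}"
    using R(2) unfolding positive_roots_def by blast
  then have "R = Rp \<union> uminus ` Rp"
    by (rule positive_roots_Un_uminus(1)[OF R(1)])
  ultimately show thesis using that f(2) by simp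
qed

lemma ex_bc_B:
  assumes "root_system R" "positive_roots R Rp" "type_B n R" "n \<ge> 2"
  obtains e c where "bc_B n e c R" "Rp = bc_positive 1 n e"
proof -
  obtain e where "orthogonal_frame n e" "R = bc_roots 1 n e"
    using assms(3) type_B_iff by blast
  moreover have "(1 :: real) = 1 \<or> (1 :: real) = 2" by simp
  ultimately obtain f c where "bc_frame 1 n f c" "Rp = bc_positive 1 n f"
      "R = bc_positive 1 n f \<union> uminus ` bc_positive 1 n f"
    using assms(4) by (rule ex_bc_frame[OF assms(1,2)])
  then show thesis using that by (simp add: bc_B_def bc_B_axioms_def)
qed

lemma ex_bc_C:
  assumes "root_system R" "positive_roots R Rp" "type_C n R" "n \<ge> 2"
  obtains e c where "bc_C n e c R" "Rp = bc_positive 2 n e"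
proof -
  obtain e where "orthogonal_frame n e" "R = bc_roots 2 n e"
    using assms(3) type_C_iff by blast
  moreover have "(2 :: real) = 1 \<or> (2 :: real) = 2" by simp
  ultimately obtain f c where "bc_frame 2 n f c" "Rp = bc_positive 2 n f"
      "R = bc_positive 2 n f \<union> uminus ` bc_positive 2 n f"
    using assms(4) by (rule ex_bc_frame[OF assms(1,2)])
  then show thesis using that by (simp add: bc_C_def bc_C_axioms_def)
qed

section \<open>Verified cancellation for a given table of roots\<close>

text \<open>Multiset inclusion in a form that can be evaluated on lists; a matched entry is removed,
  so multiplicities count.\<close>

fun sub_list :: "'b list \<Rightarrow> 'b list \<Rightarrow> bool" where
  "sub_list [] ys \<longleftrightarrow> True"
| "sub_list (x # xs) ys \<longleftrightarrow> x \<in> set ys \<and> sub_list xs (remove1 x ys)"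

definition same_elems :: "'b list \<Rightarrow> 'b list \<Rightarrow> bool" where
  "same_elems xs ys \<longleftrightarrow> length xs = length ys \<and> sub_list xs ys"

lemma sub_list_mset: "sub_list xs ys \<Longrightarrow> mset xs \<subseteq># mset ys"
  by (induction xs ys rule: sub_list.induct) (auto simp: insert_subset_eq_iff)

lemma same_elems_mset: "same_elems xs ys \<Longrightarrow> mset xs = mset ys"
  unfolding same_elems_def
  by (metis mset_subset_size nat_less_le size_mset sub_list_mset subset_mset.less_le)

text \<open>For a nonzero divisor the only candidate for the coefficient is the quotient of the
  coordinate sums.\<close>

definition divides_expo :: "nat \<times> nat \<times> nat \<Rightarrow> nat \<times> nat \<times> nat \<Rightarrow> bool" where
  "divides_expo = (\<lambda>(l, s, j) (l', s', j').
     let c = (l' + s' + j') div (l + s + j) in l' = c * l \<and> s' = c * s \<and> j' = c * j)"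

lemma divides_expo_iff:
  assumes "d \<noteq> (0, 0, 0)"
  shows "divides_expo d e \<longleftrightarrow> nat_multiple (nat_expo d) (nat_expo e)"
proof -
  obtain l s j l' s' j' where de: "d = (l, s, j)" "e = (l', s', j')"
    by (metis surj_pair)
  have "c = (l' + s' + j') div (l + s + j)" if "l' = c * l" "s' = c * s" "j' = c * j" for c
  proof -
    have "l' + s' + j' = c * (l + s + j)" using that by (simp add: algebra_simps)
    then show ?thesis using assms de by simp
  qed
  then show ?thesis
    unfolding de nat_multiple_nat divides_expo_def by (auto simp: Let_def)
qed

text \<open>The factor must be the ratio \<open>b / a\<close> of the coordinate sums;
  cross-multiplying keeps the test within the integers, and \<open>b \<noteq> 0\<close> excludes the
  factor 0.\<close>

definition parallel_expo :: "nat \<times> nat \<times> nat \<Rightarrow> nat \<times> nat \<times> nat \<Rightarrow> bool" where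
  "parallel_expo = (\<lambda>(l, s, j) (l', s', j').
     let a = int (l + s + j); b = int (l' + s' + j')
     in a \<noteq> 0 \<and> b \<noteq> 0 \<and> a * int l' = b * int l \<and> a * int s' = b * int s \<and> a * int j' = b * int j)"

lemma parallel_expo_iff:
  assumes "e \<noteq> (0, 0, 0)"
  shows "parallel_expo e f \<longleftrightarrow> proportional (nat_expo e) (nat_expo f)"
proof -
  obtain l s j l' s' j' where ef: "e = (l, s, j)" "f = (l', s', j')"
    by (metis surj_pair)
  have a: "real (l + s + j) > 0" using assms ef by auto
  show ?thesis
  proof
    assume "parallel_expo e f"
    then have p: "l' + s' + j' > 0" "int ((l + s + j) * l') = int ((l' + s' + j') * l)"
        "int ((l + s + j) * s') = int ((l' + s' + j') * s)"
        "int ((l + s + j) * j') = int ((l' + s' + j') * j)"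
      by (auto simp: parallel_expo_def ef Let_def)
    then have "real ((l + s + j) * l') = real ((l' + s' + j') * l)"
        "real ((l + s + j) * s') = real ((l' + s' + j') * s)"
        "real ((l + s + j) * j') = real ((l' + s' + j') * j)"
      by (simp_all only: of_nat_eq_iff)
    then show "proportional (nat_expo e) (nat_expo f)"
      using a p(1) unfolding proportional_def ef nat_expo_def
      by (intro exI[of _ "real (l' + s' + j') / real (l + s + j)"])
        (simp add: nonzero_eq_divide_eq mult.commute del: of_nat_add)
  next
    assume "proportional (nat_expo e) (nat_expo f)"
    then obtain c where c: "c \<noteq> 0" "real l' = c * real l" "real s' = c * real s" "real j' = c * real j"
      by (auto simp: proportional_def ef nat_expo_def)
    then have b: "real (l' + s' + j') = c * real (l + s + j)" by (simp add: algebra_simps)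
    then have "real (l' + s' + j') > 0" using c(1) a by (metis mult_eq_0_iff of_nat_0_le_iff order_less_le)
    moreover have "real ((l + s + j) * l') = real ((l' + s' + j') * l)"
      "real ((l + s + j) * s') = real ((l' + s' + j') * s)"
      "real ((l + s + j) * j') = real ((l' + s' + j') * j)"
      unfolding of_nat_mult b c by simp_all
    then have "(l + s + j) * l' = (l' + s' + j') * l" "(l + s + j) * s' = (l' + s' + j') * s"
      "(l + s + j) * j' = (l' + s' + j') * j" by (simp_all only: of_nat_eq_iff)
    then have "int ((l + s + j) * l') = int ((l' + s' + j') * l)"
      "int ((l + s + j) * s') = int ((l' + s' + j') * s)"
      "int ((l + s + j) * j') = int ((l' + s' + j') * j)" by simp_all
    ultimately show "parallel_expo e f"
      using a by (simp add: parallel_expo_def ef Let_def del: of_nat_add)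
  qed
qed

type_synonym expo_list = "(nat \<times> nat \<times> nat) list"

text \<open>A triple \<open>(k, l, s)\<close> stands for the string over \<open>l k\<^sub>l\<^sub>n\<^sub>g + s k\<^sub>s\<^sub>h\<^sub>t\<close>, scaled by \<open>k\<close>.\<close>

definition strings :: "expo_list \<Rightarrow> expo_list" where
  "strings = (\<lambda>ps. concat (map (\<lambda>(k, l, s). map (\<lambda>j. (k * l, k * s, k * j)) [0..<l + s]) ps))"

definition rationals :: "expo_list \<Rightarrow> expo_list \<Rightarrow> expo_list" where
  "rationals A B = filter (\<lambda>e. list_all (\<lambda>d. \<not> divides_expo d e) B) A"

abbreviation expos :: "expo_list \<Rightarrow> expo multiset" where
  "expos xs \<equiv> image_mset nat_expo (mset xs)"

lemma strings_append: "strings (xs @ ys) = strings xs @ strings ys"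
  by (simp add: strings_def)

lemma strings_Cons: "strings (x # xs) = strings [x] @ strings xs"
  by (simp add: strings_def)

lemma expos_strings_single: "expos (strings [(k, p)]) = scaled_string (real k) p"
  by (cases p) (simp add: strings_def scaled_string_nat image_mset.compositionality o_def
      lessThan_atLeast0)

lemma expos_strings_sum: "expos (strings ps) = (\<Sum>(k, p)\<leftarrow>ps. scaled_string (real k) p)"
proof (induction ps)
  case (Cons x ps)
  obtain k p where x: "x = (k, p)" by (cases x)
  have "expos (strings (x # ps)) = expos (strings [x]) + expos (strings ps)"
    by (subst strings_Cons) (simp only: mset_append image_mset_union)
  also have "\<dots> = (\<Sum>(k, p)\<leftarrow>x # ps. scaled_string (real k) p)"
    unfolding Cons.IH x expos_strings_single by simp
  finally show ?case .
qed (simp add: strings_def)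

lemma expos_strings_cong: "mset xs = mset ys \<Longrightarrow> expos (strings xs) = expos (strings ys)"
proof -
  have "sum_list (map f zs) = (\<Sum>z\<in>#mset zs. f z)" for f :: "nat \<times> nat \<times> nat \<Rightarrow> expo multiset" and zs
    by (induction zs) simp_all
  then show "mset xs = mset ys \<Longrightarrow> expos (strings xs) = expos (strings ys)"
    unfolding expos_strings_sum by simp
qed

lemma expos_filter:
  assumes "list_all (\<lambda>d. d \<noteq> (0, 0, 0)) B"
  shows "{# e \<in># expos A. \<forall>d\<in>#expos B. \<not> nat_multiple d e #} = expos (rationals A B)"
proof -
  have "(\<forall>d\<in>#expos B. \<not> nat_multiple d (nat_expo e)) \<longleftrightarrow> list_all (\<lambda>d. \<not> divides_expo d e) B" for e
    using assms by (auto simp: list_all_iff divides_expo_iff)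
  then show ?thesis
    by (simp add: filter_mset_image_mset rationals_def mset_filter)
qed

lemma expos_disjoint:
  assumes "list_all (\<lambda>a. a \<notin> set B) A"
  shows "expos A \<inter># expos B = {#}"
  by (rule disjoint_msetI) (use assms in \<open>auto simp: list_all_iff\<close>)

text \<open>Without repetitions the multiset is a set, so the pairs are found by enumerating the
  square of the list. \<open>ps\<close> contains every pair in both orders, which give the same
  multiset.\<close>

lemma proportional_pairs_expos:
  assumes "distinct X" "list_all (\<lambda>e. e \<noteq> (0, 0, 0)) X"
    and "filter (\<lambda>(e, f). e \<noteq> f \<and> parallel_expo e f) (List.product X X) = ps"
  shows "proportional_pairs (expos X) = (\<lambda>(e, f). {#nat_expo e, nat_expo f#}) ` set ps"
proof -
  have inj: "inj_on nat_expo A" for A by (simp add: inj_on_def)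
  have "expos X = mset_set (nat_expo ` set X)"
    using assms(1) by (simp add: mset_set_set image_mset_mset_set[OF inj, symmetric])
  then have "proportional_pairs (expos X) = {{#e, f#} | e f. e \<in> nat_expo ` set X \<and> f \<in> nat_expo ` set X \<and>
      e \<noteq> f \<and> proportional e f}"
    by (simp add: proportional_pairs_mset_set)
  also have "\<dots> = {{#nat_expo e, nat_expo f#} | e f. e \<in> set X \<and> f \<in> set X \<and> e \<noteq> f \<and> parallel_expo e f}"
    (is "?L = ?R")
  proof -
    have par: "parallel_expo e f \<longleftrightarrow> proportional (nat_expo e) (nat_expo f)" if "e \<in> set X" for e f
      using assms(2) that unfolding list_all_iff by (intro parallel_expo_iff) blast
    have "Z \<in> ?R" if "Z \<in> ?L" for Z
    proof -
      from that obtain e f where "Z = {#nat_expo e, nat_expo f#}" "e \<in> set X" "f \<in> set X"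
        "nat_expo e \<noteq> nat_expo f" "proportional (nat_expo e) (nat_expo f)" by blast
      then show ?thesis using par by blast
    qed
    moreover have "Z \<in> ?L" if "Z \<in> ?R" for Z
    proof -
      from that obtain e f where *: "Z = {#nat_expo e, nat_expo f#}" "e \<in> set X" "f \<in> set X"
        "e \<noteq> f" "parallel_expo e f" by blast
      then have "nat_expo e \<noteq> nat_expo f" "proportional (nat_expo e) (nat_expo f)" using par by simp_all
      with * show ?thesis by blast
    qed
    ultimately show ?thesis by blast
  qed
  finally show ?thesis
    unfolding assms(3)[symmetric] by force
qed

text \<open>
  An entry of a table consists of the coordinates of a positive root \<open>\<alpha>\<close>, of \<open>(\<alpha>\<^sup>\<or>, \<rho>\<^sub>k)\<close>, and of
  \<open>(\<alpha>, \<rho>\<^sub>k\<^sup>\<or>)\<close> for the dual system, each written as the pair of the coefficients for the long and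
  the short roots of the original system.
\<close>

type_synonym 'i root_table = "('i \<times> (nat \<times> nat) \<times> (nat \<times> nat)) list"

text \<open>\<open>B\<close> is the inner product in coordinates, up to scale. The inequality for
  \<open>x \<noteq> y\<close> says that the difference has nonzero squared length, so different
  coordinates give different roots; the last clause checks both tabulated pairs of heights.\<close>

definition valid_table ::
  "('i \<Rightarrow> 'i \<Rightarrow> int) \<Rightarrow> int \<Rightarrow> nat \<Rightarrow> 'i root_table \<Rightarrow> bool" where
  "valid_table B m r T \<longleftrightarrow>
     (let L = map fst T in
      0 < m \<and> 1 < r \<and> distinct L \<and>
      list_all (\<lambda>x. list_all (\<lambda>y. x = y \<or> B x x + B y y \<noteq> 2 * B x y) L) L \<and>
      list_all (\<lambda>x. B x x = m \<or> B x x = int r * m) L \<and>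
      list_ex (\<lambda>x. B x x = m) L \<and> list_ex (\<lambda>x. B x x = int r * m) L \<and>
      list_all (\<lambda>(x, (l, s), (l', s')).
        let lng = sum_list (map (B x) (filter (\<lambda>y. B y y \<noteq> m) L));
            sht = sum_list (map (B x) (filter (\<lambda>y. B y y = m) L))
        in lng = int l * B x x \<and> sht = int s * B x x \<and>
           lng = int l' * (int r * m) \<and> sht = int s' * m) T)"

definition table_num :: "('i \<Rightarrow> 'i \<Rightarrow> int) \<Rightarrow> int \<Rightarrow> nat \<Rightarrow>
    'i root_table \<Rightarrow> expo_list" where
  "table_num B m k T = map (\<lambda>(x, p, p'). (if B x x = m then 1 else k, add_k (B x x = m) p)) T"

definition table_den :: "('i \<Rightarrow> 'i \<Rightarrow> int) \<Rightarrow> int \<Rightarrow> nat \<Rightarrow>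
    'i root_table \<Rightarrow> expo_list" where
  "table_den B m k T = map (\<lambda>(x, p, p'). (if B x x = m then 1 else k, p)) T"

definition dual_table_num :: "('i \<Rightarrow> 'i \<Rightarrow> int) \<Rightarrow> int \<Rightarrow>
    'i root_table \<Rightarrow> expo_list" where
  "dual_table_num B m T = map (\<lambda>(x, p, p'). (1, add_k (B x x = m) p')) T"

definition dual_table_den :: "'i root_table \<Rightarrow> expo_list" where
  "dual_table_den T = map (\<lambda>(x, p, p'). (1, p')) T"

text \<open>\<kappa> absorbs the scale of the inner product, so that all else is integer arithmetic
  with \<open>B\<close>.\<close>

locale table_roots =
  fixes R Rp :: "'a::euclidean_space set" and vec :: "'i \<Rightarrow> 'a" and B :: "'i \<Rightarrow> 'i \<Rightarrow> int"
    and \<kappa> :: real and m :: int and r :: nat and T :: "'i root_table"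
  assumes \<kappa>: "\<kappa> > 0" and inner_vec: "vec x \<bullet> vec y = \<kappa> * of_int (B x y)"
    and Rp_eq: "Rp = vec ` fst ` set T" and R_Un: "R = Rp \<union> uminus ` Rp"
    and valid: "valid_table B m r T"
begin

lemma valid_D:
  "0 < m" "1 < r" "distinct (map fst T)"
  "x \<in> fst ` set T \<Longrightarrow> y \<in> fst ` set T \<Longrightarrow> x = y \<or> B x x + B y y \<noteq> 2 * B x y"
  "x \<in> fst ` set T \<Longrightarrow> B x x = m \<or> B x x = int r * m"
  "\<exists>x\<in>fst ` set T. B x x = m" "\<exists>x\<in>fst ` set T. B x x = int r * m"
  using valid unfolding valid_table_def Let_def list_all_iff list_ex_iff set_map by blast+

lemma valid_heights:
  assumes "(x, (l, s), (l', s')) \<in> set T"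
  shows "sum_list (map (B x) (filter (\<lambda>y. B y y \<noteq> m) (map fst T))) = int l * B x x"
    "sum_list (map (B x) (filter (\<lambda>y. B y y = m) (map fst T))) = int s * B x x"
    "sum_list (map (B x) (filter (\<lambda>y. B y y \<noteq> m) (map fst T))) = int l' * (int r * m)"
    "sum_list (map (B x) (filter (\<lambda>y. B y y = m) (map fst T))) = int s' * m"
  using valid assms unfolding valid_table_def Let_def list_all_iff by fastforce+

lemma inj_vec: "inj_on vec (fst ` set T)"
proof (rule inj_onI)
  fix x y assume xy: "x \<in> fst ` set T" "y \<in> fst ` set T" "vec x = vec y"
  then have "vec x \<bullet> vec x + vec y \<bullet> vec y = 2 * (vec x \<bullet> vec y)" by simp
  then have "\<kappa> * (of_int (B x x) + of_int (B y y)) = \<kappa> * (2 * of_int (B x y))"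
    unfolding inner_vec by (simp add: algebra_simps)
  then have "real_of_int (B x x + B y y) = of_int (2 * B x y)"
    using \<kappa> by (simp del: of_int_add)
  then have "B x x + B y y = 2 * B x y" by (simp only: of_int_eq_iff)
  then show "x = y" using valid_D(4)[OF xy(1,2)] by blast
qed

lemma norm_vec_eq_iff: "vec x \<bullet> vec x = \<kappa> * of_int c \<longleftrightarrow> B x x = c"
  using \<kappa> by (simp add: inner_vec)

sublocale two_length_roots R Rp "\<kappa> * of_int m" r
proof
  show "finite Rp" by (simp add: Rp_eq)
  show "R = Rp \<union> uminus ` Rp" by (rule R_Un)
  show "0 < \<kappa> * of_int m" using \<kappa> valid_D(1) by simp
  show "1 < r" by (rule valid_D(2))
  have c: "real r * (\<kappa> * of_int m) = \<kappa> * of_int (int r * m)" by simp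
  show "\<alpha> \<bullet> \<alpha> = \<kappa> * of_int m \<or> \<alpha> \<bullet> \<alpha> = real r * (\<kappa> * of_int m)" if "\<alpha> \<in> Rp" for \<alpha>
  proof -
    obtain x where x: "x \<in> fst ` set T" "\<alpha> = vec x" using \<open>\<alpha> \<in> Rp\<close> unfolding Rp_eq by blast
    show ?thesis using valid_D(5)[OF x(1)] unfolding c x(2) norm_vec_eq_iff .
  qed
  show "\<exists>\<alpha>\<in>Rp. \<alpha> \<bullet> \<alpha> = \<kappa> * of_int m"
    using valid_D(6) norm_vec_eq_iff unfolding Rp_eq by blast
  show "\<exists>\<alpha>\<in>Rp. \<alpha> \<bullet> \<alpha> = real r * (\<kappa> * of_int m)"
    using valid_D(7) norm_vec_eq_iff unfolding c Rp_eq by blast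
qed

lemma inner_sum_vec:
  "vec x \<bullet> (\<Sum>\<beta>\<in>{\<beta> \<in> Rp. Q (\<beta> \<bullet> \<beta>)}. \<beta>) =
    \<kappa> * of_int (sum_list (map (B x) (filter (\<lambda>y. Q (vec y \<bullet> vec y)) (map fst T))))"
proof -
  have set_eq: "{\<beta> \<in> Rp. Q (\<beta> \<bullet> \<beta>)} = vec ` {y \<in> fst ` set T. Q (vec y \<bullet> vec y)}"
    unfolding Rp_eq by blast
  have inj: "inj_on vec {y \<in> fst ` set T. Q (vec y \<bullet> vec y)}"
    by (rule inj_on_subset[OF inj_vec]) blast
  have "vec x \<bullet> (\<Sum>\<beta>\<in>{\<beta> \<in> Rp. Q (\<beta> \<bullet> \<beta>)}. \<beta>) =
      (\<Sum>y\<in>{y \<in> fst ` set T. Q (vec y \<bullet> vec y)}. \<kappa> * of_int (B x y))"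
    unfolding inner_sum_right set_eq sum.reindex[OF inj] by (simp add: inner_vec[of x])
  also have "{y \<in> fst ` set T. Q (vec y \<bullet> vec y)} = set (filter (\<lambda>y. Q (vec y \<bullet> vec y)) (map fst T))"
    by auto
  also have "(\<Sum>y\<in>\<dots>. \<kappa> * of_int (B x y)) = \<kappa> * of_int (sum_list (map (B x) (filter (\<lambda>y. Q (vec y \<bullet> vec y)) (map fst T))))"
    using valid_D(3) by (simp add: sum_list_distinct_conv_sum_set sum_distrib_left)
  finally show ?thesis .
qed

lemma heights:
  assumes "(x, (l, s), (l', s')) \<in> set T"
  shows "vec x \<bullet> long_sum = real l * (vec x \<bullet> vec x)" "vec x \<bullet> short_sum = real s * (vec x \<bullet> vec x)"
    "vec x \<bullet> long_sum = real l' * (real r * (\<kappa> * of_int m))" "vec x \<bullet> short_sum = real s' * (\<kappa> * of_int m)"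
proof -
  have lng: "vec x \<bullet> long_sum = \<kappa> * of_int (sum_list (map (B x) (filter (\<lambda>y. B y y \<noteq> m) (map fst T))))"
    unfolding long_sum_def inner_sum_vec[where Q = "\<lambda>z. z \<noteq> \<kappa> * of_int m"] norm_vec_eq_iff ..
  have sht: "vec x \<bullet> short_sum = \<kappa> * of_int (sum_list (map (B x) (filter (\<lambda>y. B y y = m) (map fst T))))"
    unfolding short_sum_def inner_sum_vec[where Q = "\<lambda>z. z = \<kappa> * of_int m"] norm_vec_eq_iff ..
  show "vec x \<bullet> long_sum = real l * (vec x \<bullet> vec x)"
    unfolding lng valid_heights(1)[OF assms] inner_vec by simp
  show "vec x \<bullet> long_sum = real l' * (real r * (\<kappa> * of_int m))"
    unfolding lng valid_heights(3)[OF assms] by simp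
  show "vec x \<bullet> short_sum = real s * (vec x \<bullet> vec x)"
    unfolding sht valid_heights(2)[OF assms] inner_vec by simp
  show "vec x \<bullet> short_sum = real s' * (\<kappa> * of_int m)"
    unfolding sht valid_heights(4)[OF assms] by simp
qed

lemma root_entry:
  assumes "\<alpha> \<in> Rp"
  obtains x l s l' s' where "(x, (l, s), (l', s')) \<in> set T" "\<alpha> = vec x"
proof -
  obtain y where "y \<in> set T" "\<alpha> = vec (fst y)" using assms unfolding Rp_eq by blast
  moreover obtain x l s l' s' where "y = (x, (l, s), (l', s'))" by (metis surj_pair)
  ultimately show thesis using that by simp
qed

lemma ex_heights:
  assumes "\<alpha> \<in> Rp"
  shows "\<exists>(l::nat) (s::nat). \<alpha> \<bullet> long_sum = l * (\<alpha> \<bullet> \<alpha>) \<and> \<alpha> \<bullet> short_sum = s * (\<alpha> \<bullet> \<alpha>)" (is ?primal)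
    and "\<exists>(l::nat) (s::nat). \<alpha> \<bullet> long_sum = l * (real r * (\<kappa> * of_int m)) \<and> \<alpha> \<bullet> short_sum = s * (\<kappa> * of_int m)" (is ?dual)
proof -
  obtain x l s l' s' where x: "(x, (l, s), (l', s')) \<in> set T" "\<alpha> = vec x"
    using root_entry[OF assms] .
  note h = heights[OF x(1)]
  show ?primal
    unfolding x(2) using h(1,2) by (intro exI conjI)
  show ?dual
    unfolding x(2) using h(3,4) by (intro exI conjI)
qed

lemma sum_Rp: "(\<Sum>\<alpha>\<in>Rp. G \<alpha>) = (\<Sum>(x, p)\<leftarrow>T. G (vec x))" for G :: "'a \<Rightarrow> expo multiset"
proof -
  have "(\<Sum>\<alpha>\<in>Rp. G \<alpha>) = (\<Sum>x\<in>set (map fst T). G (vec x))"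
    unfolding Rp_eq sum.reindex[OF inj_vec] by simp
  also have "\<dots> = sum_list (map (\<lambda>x. G (vec x)) (map fst T))"
    using valid_D(3) by (simp only: sum_list_distinct_conv_sum_set)
  finally show ?thesis by (simp add: o_def case_prod_unfold)
qed

lemma table_expos:
  assumes \<nu>: "\<And>\<alpha>. \<alpha> \<in> Rp \<Longrightarrow> \<nu> \<alpha> = (if \<alpha> \<bullet> \<alpha> = \<kappa> * of_int m then 1 else real k)"
  shows "num_expos \<nu> R Rp = expos (strings (table_num B m k T))"
    and "den_expos \<nu> R Rp = expos (strings (table_den B m k T))"
proof -
  have *: "num_contrib \<nu> R Rp (vec x) = scaled_string (if B x x = m then 1 else real k) (add_k (B x x = m) p)"
    "den_contrib \<nu> R Rp (vec x) = scaled_string (if B x x = m then 1 else real k) p"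
    if "(x, p, p') \<in> set T" for x p p'
  proof -
    obtain l s l' s' where p: "p = (l, s)" "p' = (l', s')" by (metis surj_pair)
    have x: "vec x \<in> Rp" using that by (force simp: Rp_eq)
    note h = heights[OF that[unfolded p]]
    show "num_contrib \<nu> R Rp (vec x) = scaled_string (if B x x = m then 1 else real k) (add_k (B x x = m) p)"
      "den_contrib \<nu> R Rp (vec x) = scaled_string (if B x x = m then 1 else real k) p"
      unfolding contrib(1,2)[OF x h(1,2)] scaled_string_def \<nu>[OF x] norm_vec_eq_iff p by simp_all
  qed
  show "num_expos \<nu> R Rp = expos (strings (table_num B m k T))"
    unfolding num_expos_sum sum_Rp expos_strings_sum table_num_def map_map
    by (intro arg_cong[of _ _ sum_list] map_cong refl) (auto simp: *)
  show "den_expos \<nu> R Rp = expos (strings (table_den B m k T))"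
    unfolding den_expos_sum sum_Rp expos_strings_sum table_den_def map_map
    by (intro arg_cong[of _ _ sum_list] map_cong refl) (auto simp: *)
qed

lemma image_mset_sum_list: "image_mset f (sum_list Ms) = sum_list (map (image_mset f) Ms)"
  by (induction Ms) simp_all

lemma dual_table_expos:
  "num_expos nu_one (coroot ` R) (coroot ` Rp) = image_mset swap_expo (expos (strings (dual_table_num B m T)))"
  "den_expos nu_one (coroot ` R) (coroot ` Rp) = image_mset swap_expo (expos (strings (dual_table_den T)))"
proof -
  have *: "num_contrib nu_one (coroot ` R) (coroot ` Rp) (coroot (vec x)) =
      image_mset swap_expo (expo_string (add_k (B x x = m) p'))"
    "den_contrib nu_one (coroot ` R) (coroot ` Rp) (coroot (vec x)) = image_mset swap_expo (expo_string p')"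
    if "(x, p, p') \<in> set T" for x p p'
  proof -
    obtain l s l' s' where p: "p = (l, s)" "p' = (l', s')" by (metis surj_pair)
    have x: "vec x \<in> Rp" using that by (force simp: Rp_eq)
    note h = heights[OF that[unfolded p]]
    show "num_contrib nu_one (coroot ` R) (coroot ` Rp) (coroot (vec x)) =
        image_mset swap_expo (expo_string (add_k (B x x = m) p'))"
      "den_contrib nu_one (coroot ` R) (coroot ` Rp) (coroot (vec x)) = image_mset swap_expo (expo_string p')"
      unfolding dual_contrib[OF x h(3,4)] norm_vec_eq_iff p by simp_all
  qed
  show "num_expos nu_one (coroot ` R) (coroot ` Rp) = image_mset swap_expo (expos (strings (dual_table_num B m T)))"
    unfolding num_expos_sum sum.reindex[OF inj_coroot] o_def sum_Rp expos_strings_sum dual_table_num_def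
      image_mset_sum_list map_map
    by (intro arg_cong[of _ _ sum_list] map_cong refl) (auto simp: *)
  show "den_expos nu_one (coroot ` R) (coroot ` Rp) = image_mset swap_expo (expos (strings (dual_table_den T)))"
    unfolding den_expos_sum sum.reindex[OF inj_coroot] o_def sum_Rp expos_strings_sum dual_table_den_def
      image_mset_sum_list map_map
    by (intro arg_cong[of _ _ sum_list] map_cong refl) (auto simp: *)
qed

end

text \<open>
  \<open>N\<close> and \<open>D\<close> are the strings that remain after cancelling coinciding strings; \<open>N'\<close> and \<open>D'\<close> play
  this role for \<open>[\<alpha>, \<nu>\<^sub>\<alpha> j]\<close>, where single exponents of different strings still cancel and leave
  \<open>P\<close> and \<open>Q\<close>.  The list \<open>M\<close> has pairwise different multiples of the exponents of the denominator,
  and \<open>X\<close>, \<open>Y\<close> are the rational exponents.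
\<close>

definition certificate where
  "certificate B m r T N D N' D' P Q M X Y \<longleftrightarrow>
     same_elems (table_num B m 1 T @ D) (table_den B m 1 T @ N) \<and>
     same_elems (dual_table_num B m T @ D) (dual_table_den T @ N) \<and>
     list_all (\<lambda>a. a \<notin> set (strings D)) (strings N) \<and>
     list_all (\<lambda>d. d \<noteq> (0, 0, 0)) (strings D) \<and>
     list_all2 divides_expo (strings D) M \<and> sub_list M (strings N) \<and>
     same_elems (table_num B m r T @ D') (table_den B m r T @ N') \<and>
     same_elems (strings N' @ Q) (strings D' @ P) \<and>
     list_all (\<lambda>a. a \<notin> set Q) P \<and> list_all (\<lambda>d. d \<noteq> (0, 0, 0)) Q \<and>
     same_elems (rationals (strings N) (strings D)) X \<and> same_elems (rationals P Q) Y \<and>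
     list_all (\<lambda>e. e \<noteq> (0, 0, 0)) X \<and> list_all2 parallel_expo X Y"

context table_roots
begin

context
  fixes N D N' D' P Q M X Y
  assumes cert: "certificate B m r T N D N' D' P Q M X Y"
begin

lemma certD:
  "mset (table_num B m 1 T @ D) = mset (table_den B m 1 T @ N)"
  "mset (dual_table_num B m T @ D) = mset (dual_table_den T @ N)"
  "expos (strings N) \<inter># expos (strings D) = {#}"
  "list_all (\<lambda>d. d \<noteq> (0, 0, 0)) (strings D)"
  "list_all2 divides_expo (strings D) M" "mset M \<subseteq># mset (strings N)"
  "mset (table_num B m r T @ D') = mset (table_den B m r T @ N')"
  "mset (strings N' @ Q) = mset (strings D' @ P)"
  "expos P \<inter># expos Q = {#}" "list_all (\<lambda>d. d \<noteq> (0, 0, 0)) Q"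
  "mset (rationals (strings N) (strings D)) = mset X" "mset (rationals P Q) = mset Y"
  "list_all (\<lambda>e. e \<noteq> (0, 0, 0)) X" "list_all2 parallel_expo X Y"
  using cert unfolding certificate_def
  by (auto intro: same_elems_mset sub_list_mset expos_disjoint simp del: mset_append)

lemma hat_balanced:
  "num_expos nu_one R Rp + expos (strings D) = den_expos nu_one R Rp + expos (strings N)"
  using expos_strings_cong[OF certD(1)] table_expos[of nu_one 1] by (simp add: strings_append)

lemma dual_balanced:
  "num_expos nu_one (coroot ` R) (coroot ` Rp) + image_mset swap_expo (expos (strings D)) =
   den_expos nu_one (coroot ` R) (coroot ` Rp) + image_mset swap_expo (expos (strings N))"
  unfolding dual_table_expos image_mset_union[symmetric]
  using expos_strings_cong[OF certD(2)] by (simp add: strings_append)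

lemma tilde_balanced:
  "num_expos (nu_root R) R Rp + expos Q = den_expos (nu_root R) R Rp + expos P"
proof -
  have 1: "num_expos (nu_root R) R Rp + expos (strings D') = den_expos (nu_root R) R Rp + expos (strings N')"
    using expos_strings_cong[OF certD(7)] table_expos[of "nu_root R" r]
    by (simp add: strings_append nu_root_eq)
  have 2: "expos (strings N') + expos Q = expos (strings D') + expos P"
    using arg_cong[OF certD(8), of "image_mset nat_expo"] by simp
  \<comment> \<open>Whole strings cancel first, then single exponents; \<open>D'\<close> is carried
    on both sides to join the two stages and removed at the end.\<close>
  have "(num_expos (nu_root R) R Rp + expos Q) + expos (strings D') =
      (num_expos (nu_root R) R Rp + expos (strings D')) + expos Q" by (simp only: add_ac)
  also have "\<dots> = den_expos (nu_root R) R Rp + (expos (strings N') + expos Q)"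
    unfolding 1 by (simp only: add_ac)
  also have "\<dots> = (den_expos (nu_root R) R Rp + expos P) + expos (strings D')"
    unfolding 2 by (simp only: add_ac)
  finally show ?thesis by (simp only: add_right_cancel)
qed

lemma rational: "rational_expos nu_one R Rp = expos X"
proof -
  have "rational_expos nu_one R Rp =
      {# e \<in># expos (strings N). \<forall>d\<in>#expos (strings D). \<not> nat_multiple d e #}"
    by (rule rational_expos_balanced[OF hat_balanced certD(3)]) (rule expos_cube[OF ex_heights(1)], simp_all)
  then show ?thesis by (simp only: expos_filter[OF certD(4)] certD(11))
qed

lemma table_rel:
  "rel_mset proportional {# e \<in># expos (strings N). \<forall>d\<in>#expos (strings D). \<not> nat_multiple d e #}
    {# e \<in># expos P. \<forall>d\<in>#expos Q. \<not> nat_multiple d e #}"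
proof -
  have "list_all2 (\<lambda>x y. proportional (nat_expo x) (nat_expo y)) X Y"
    using certD(14) certD(13)
    by (auto simp: list_all2_conv_all_nth list_all_length parallel_expo_iff)
  then have "rel_mset proportional (mset (map nat_expo X)) (mset (map nat_expo Y))"
    unfolding rel_mset_def by (intro exI[of _ "map nat_expo X"] exI[of _ "map nat_expo Y"])
      (simp add: list_all2_map1 list_all2_map2)
  then show ?thesis
    by (simp only: expos_filter[OF certD(4)] expos_filter[OF certD(10)] certD(11,12) mset_map)
qed

lemma table_multiples:
  "rel_mset nat_multiple (expos (strings D)) (expos M)" "expos M \<subseteq># expos (strings N)"
proof -
  have "list_all2 (\<lambda>x y. nat_multiple (nat_expo x) (nat_expo y)) (strings D) M"
    using certD(4,5)
    by (auto simp: list_all2_conv_all_nth list_all_length divides_expo_iff)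
  then show "rel_mset nat_multiple (expos (strings D)) (expos M)"
    unfolding rel_mset_def by (intro exI[of _ "map nat_expo (strings D)"] exI[of _ "map nat_expo M"])
      (simp add: list_all2_map1 list_all2_map2)
  show "expos M \<subseteq># expos (strings N)"
    by (rule image_mset_subseteq_mono[OF certD(6)])
qed

lemmas regular_and_dual_table = regular_and_dualI[OF ex_heights hat_balanced certD(3) dual_balanced table_multiples
  tilde_balanced certD(9) table_rel]

lemmas affine_expos = balanced_cancel[OF hat_balanced certD(3)]

end

end

section \<open>Tables and certificates for types F4 and G2\<close>

definition f4_table :: "(int \<times> int \<times> int \<times> int) root_table" where
  "f4_table = [
    ((2, 0, 0, 0), (0, 1), (0, 1)), ((0, 2, 0, 0), (2, 1), (1, 1)),
    ((0, 0, 2, 0), (4, 1), (2, 1)), ((0, 0, 0, 2), (6, 5), (3, 5)),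
    ((-2, 2, 0, 0), (1, 0), (1, 0)), ((2, 2, 0, 0), (1, 1), (1, 2)),
    ((-2, 0, 2, 0), (2, 0), (2, 0)), ((2, 0, 2, 0), (2, 1), (2, 2)),
    ((0, -2, 2, 0), (1, 0), (1, 0)), ((0, 2, 2, 0), (3, 1), (3, 2)),
    ((-2, 0, 0, 2), (3, 2), (3, 4)), ((2, 0, 0, 2), (3, 3), (3, 6)),
    ((0, -2, 0, 2), (2, 2), (2, 4)), ((0, 2, 0, 2), (4, 3), (4, 6)),
    ((0, 0, -2, 2), (1, 2), (1, 4)), ((0, 0, 2, 2), (5, 3), (5, 6)),
    ((-1, -1, -1, 1), (0, 1), (0, 1)), ((-1, -1, 1, 1), (4, 2), (2, 2)),
    ((-1, 1, -1, 1), (2, 2), (1, 2)), ((-1, 1, 1, 1), (6, 3), (3, 3)),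
    ((1, -1, -1, 1), (0, 2), (0, 2)), ((1, -1, 1, 1), (4, 3), (2, 3)),
    ((1, 1, -1, 1), (2, 3), (1, 3)), ((1, 1, 1, 1), (6, 4), (3, 4))]"

definition f4_num :: expo_list where
  "f4_num = [
    (1, 0, 2), (1, 0, 3), (1, 2, 0), (1, 2, 4), (1, 3, 0), (1, 4, 2), (1, 4, 4), (1, 6, 6)]"

definition f4_den :: expo_list where
  "f4_den = [
    (1, 0, 1), (1, 0, 1), (1, 1, 0), (1, 1, 0), (1, 1, 1), (1, 1, 2), (1, 2, 1), (1, 3, 3)]"

definition f4_num_strings :: expo_list where
  "f4_num_strings = [
    (1, 0, 2), (1, 0, 3), (1, 2, 4), (1, 4, 4), (1, 6, 6), (2, 2, 0), (2, 3, 0), (2, 4, 1),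
    (2, 4, 2), (2, 6, 3)]"

definition f4_den_strings :: expo_list where
  "f4_den_strings = [
    (1, 0, 1), (1, 0, 1), (1, 2, 1), (1, 4, 1), (1, 6, 3), (2, 1, 0), (2, 1, 0), (2, 1, 1),
    (2, 1, 2), (2, 3, 3)]"

definition f4_tilde_pos :: expo_list where
  "f4_tilde_pos = [
    (0, 2, 0), (0, 2, 1), (0, 3, 0), (0, 3, 1), (0, 3, 2), (2, 4, 1), (2, 4, 3), (2, 4, 5),
    (4, 0, 0), (4, 0, 2), (4, 4, 0), (4, 4, 1), (4, 4, 2), (4, 4, 3), (4, 4, 4), (4, 4, 5),
    (4, 4, 6), (4, 4, 7), (6, 0, 0), (6, 0, 2), (6, 0, 4), (6, 6, 1), (6, 6, 3), (6, 6, 5),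
    (6, 6, 7), (6, 6, 9), (6, 6, 11), (8, 2, 0), (8, 2, 2), (8, 2, 4), (8, 2, 6), (8, 2, 8),
    (8, 4, 0), (8, 4, 2), (8, 4, 4), (8, 4, 6), (8, 4, 8), (8, 4, 10), (12, 6, 0), (12, 6, 2),
    (12, 6, 4), (12, 6, 6), (12, 6, 8), (12, 6, 10), (12, 6, 12), (12, 6, 14), (12, 6, 16)]"

definition f4_tilde_neg :: expo_list where
  "f4_tilde_neg = [
    (0, 1, 0), (0, 1, 0), (2, 0, 0), (2, 0, 0), (2, 1, 0), (2, 1, 1), (2, 1, 2), (2, 2, 0),
    (2, 2, 2), (4, 1, 0), (4, 1, 1), (4, 1, 2), (4, 1, 3), (4, 1, 4), (6, 3, 0), (6, 3, 1),
    (6, 3, 2), (6, 3, 3), (6, 3, 4), (6, 3, 5), (6, 3, 6), (6, 3, 7), (6, 3, 8)]"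

text \<open>The two copies of \<open>(0, 1)\<close> and of \<open>(1, 0)\<close> get the factors 2
  and 3, the string over \<open>(1, 1)\<close> the factor 4, all others 2. The factor 4 arises
  because no numerator is over \<open>(2, 2)\<close> or \<open>(3, 3)\<close>, and those over
  \<open>(6, 6)\<close> that would serve are used by the doubles of \<open>(3, 3)\<close>.\<close>

definition f4_multiples :: expo_list where
  "f4_multiples = [
    (0, 2, 0), (0, 3, 0), (2, 0, 0), (3, 0, 0), (4, 4, 0), (4, 4, 4), (2, 4, 0), (2, 4, 2),
    (2, 4, 4), (4, 2, 0), (4, 2, 2), (4, 2, 4), (6, 6, 0), (6, 6, 2), (6, 6, 4), (6, 6, 6),
    (6, 6, 8), (6, 6, 10)]"

definition f4_rational :: expo_list where
  "f4_rational = [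
    (0, 2, 1), (0, 3, 1), (0, 3, 2), (2, 0, 1), (2, 4, 1), (2, 4, 3), (2, 4, 5), (3, 0, 1),
    (3, 0, 2), (4, 2, 1), (4, 2, 3), (4, 2, 5), (4, 4, 1), (4, 4, 2), (4, 4, 3), (4, 4, 5),
    (4, 4, 6), (4, 4, 7), (6, 6, 1), (6, 6, 3), (6, 6, 5), (6, 6, 7), (6, 6, 9), (6, 6, 11)]"

text \<open>Listed in the order of \<open>f4_rational\<close>, because the comparison is by
  position: the entries over \<open>(2, 0)\<close>, \<open>(3, 0)\<close> and \<open>(4, 2)\<close>
  are doubled, the others unchanged.\<close>

definition f4_tilde_rational :: expo_list where
  "f4_tilde_rational = [
    (0, 2, 1), (0, 3, 1), (0, 3, 2), (4, 0, 2), (2, 4, 1), (2, 4, 3), (2, 4, 5), (6, 0, 2),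
    (6, 0, 4), (8, 4, 2), (8, 4, 6), (8, 4, 10), (4, 4, 1), (4, 4, 2), (4, 4, 3), (4, 4, 5),
    (4, 4, 6), (4, 4, 7), (6, 6, 1), (6, 6, 3), (6, 6, 5), (6, 6, 7), (6, 6, 9), (6, 6, 11)]"

definition g2_table :: "(int \<times> int) root_table" where
  "g2_table = [
    ((1, 0), (0, 1), (0, 1)), ((0, 1), (1, 0), (1, 0)), ((1, 1), (3, 1), (1, 1)),
    ((2, 1), (3, 2), (1, 2)), ((3, 1), (1, 1), (1, 3)), ((3, 2), (2, 1), (2, 3))]"

definition g2_num :: expo_list where
  "g2_num = [
    (1, 0, 2), (1, 2, 0), (1, 3, 3)]"

definition g2_den :: expo_list where
  "g2_den = [
    (1, 0, 1), (1, 1, 0), (1, 1, 1)]"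

definition g2_num_strings :: expo_list where
  "g2_num_strings = [
    (1, 0, 2), (1, 3, 3), (3, 2, 0), (3, 3, 1)]"

definition g2_den_strings :: expo_list where
  "g2_den_strings = [
    (1, 0, 1), (1, 3, 1), (3, 1, 0), (3, 1, 1)]"

definition g2_tilde_pos :: expo_list where
  "g2_tilde_pos = [
    (0, 2, 0), (0, 2, 1), (3, 3, 1), (3, 3, 2), (3, 3, 4), (3, 3, 5), (6, 0, 0), (6, 0, 3),
    (9, 3, 0), (9, 3, 3), (9, 3, 6), (9, 3, 9)]"

definition g2_tilde_neg :: expo_list where
  "g2_tilde_neg = [
    (0, 1, 0), (3, 0, 0), (3, 1, 0), (3, 1, 1), (3, 1, 2), (3, 1, 3)]"

definition g2_multiples :: expo_list where
  "g2_multiples = [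
    (0, 2, 0), (2, 0, 0), (3, 3, 0), (3, 3, 3)]"

definition g2_rational :: expo_list where
  "g2_rational = [
    (0, 2, 1), (2, 0, 1), (3, 3, 1), (3, 3, 2), (3, 3, 4), (3, 3, 5)]"

definition g2_tilde_rational :: expo_list where
  "g2_tilde_rational = [
    (0, 2, 1), (6, 0, 3), (3, 3, 1), (3, 3, 2), (3, 3, 4), (3, 3, 5)]"

text \<open>Coordinates are twice those in the frame, which makes the half sums integral; the
  squared lengths become 4 and 8.\<close>

fun f4_form :: "int \<times> int \<times> int \<times> int \<Rightarrow> int \<times> int \<times> int \<times> int \<Rightarrow> int" where
  "f4_form (a, b, c, d) (a', b', c', d') = a * a' + b * b' + c * c' + d * d'"

text \<open>Gram form of the simple roots, the short one first, with squared lengths 2 and 6 and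
  inner product -3.\<close>

fun g2_form :: "int \<times> int \<Rightarrow> int \<times> int \<Rightarrow> int" where
  "g2_form (x, y) (x', y') = 2 * (x * x') - 3 * (x * y' + y * x') + 6 * (y * y')"

lemma f4_valid: "valid_table f4_form 4 2 f4_table"
  by code_simp

lemma f4_certificate:
  "certificate f4_form 4 2 f4_table f4_num f4_den f4_num_strings f4_den_strings
    f4_tilde_pos f4_tilde_neg f4_multiples f4_rational f4_tilde_rational"
  by code_simp

lemma g2_valid: "valid_table g2_form 2 3 g2_table"
  by code_simp

lemma g2_certificate:
  "certificate g2_form 2 3 g2_table g2_num g2_den g2_num_strings g2_den_strings
    g2_tilde_pos g2_tilde_neg g2_multiples g2_rational g2_tilde_rational"
  by code_simp

lemma f4_parallel:
  "filter (\<lambda>(e, f). e \<noteq> f \<and> parallel_expo e f) (List.product f4_rational f4_rational) =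
    [((4, 4, 2), (6, 6, 3)), ((4, 4, 6), (6, 6, 9)), ((6, 6, 3), (4, 4, 2)), ((6, 6, 9), (4, 4, 6))]"
  by code_simp

lemma g2_parallel:
  "filter (\<lambda>(e, f). e \<noteq> f \<and> parallel_expo e f) (List.product g2_rational g2_rational) = []"
  by code_simp

section \<open>Type \<open>G\<^sub>2\<close>\<close>

definition g2_positive :: "'a::euclidean_space \<Rightarrow> 'a \<Rightarrow> 'a set" where
  "g2_positive a b = {a, b, a + b, 2 *\<^sub>R a + b, 3 *\<^sub>R a + b, 3 *\<^sub>R a + 2 *\<^sub>R b}"

definition g2_vec :: "'a::euclidean_space \<Rightarrow> 'a \<Rightarrow> int \<times> int \<Rightarrow> 'a" where
  "g2_vec a b = (\<lambda>(x, y). of_int x *\<^sub>R a + of_int y *\<^sub>R b)"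

lemma g2_positive_eq: "g2_positive a b = g2_vec a b ` fst ` set g2_table"
  by (simp add: g2_positive_def g2_vec_def g2_table_def)

lemma positive_roots_eq:
  assumes "R = P \<union> uminus ` P" "Rp = {\<alpha> \<in> R. v \<bullet> \<alpha> > 0}" "\<And>\<alpha>. \<alpha> \<in> P \<Longrightarrow> v \<bullet> \<alpha> > 0"
  shows "Rp = P"
proof (intro equalityI subsetI)
  fix \<alpha> assume "\<alpha> \<in> Rp"
  then have "\<alpha> \<in> P \<or> - \<alpha> \<in> P" "v \<bullet> \<alpha> > 0" using assms(1,2) by auto
  then show "\<alpha> \<in> P" using assms(3)[of "- \<alpha>"] by auto
qed (use assms in auto)

lemma g2_table_roots:
  assumes R: "root_system R" "positive_roots R Rp" and G2: "type_G2 R"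
  obtains vec \<kappa> where "table_roots R Rp vec g2_form \<kappa> 2 3 g2_table"
proof -
  obtain a b where ab: "a \<bullet> a > 0" "b \<bullet> b = 3 * (a \<bullet> a)" "a \<bullet> b = - (3/2) * (a \<bullet> a)"
    and R_ab: "R = g2_positive a b \<union> uminus ` g2_positive a b"
    using G2 unfolding type_G2_def Let_def g2_positive_def by blast
  obtain v where v: "\<And>\<alpha>. \<alpha> \<in> R \<Longrightarrow> v \<bullet> \<alpha> \<noteq> 0" "Rp = {\<alpha> \<in> R. v \<bullet> \<alpha> > 0}"
    using R(2) unfolding positive_roots_def by blast
  have "{a, b} \<subseteq> R" by (simp add: R_ab g2_positive_def)
  \<comment> \<open>\<open>5 a + 3 b\<close> is half the sum of the six positive roots; its inner
    products with \<open>a\<close> and \<open>b\<close> are 1/2 and 3/2 times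
    \<open>a \<bullet> a\<close>.\<close>
  moreover have "\<alpha> \<bullet> (5 *\<^sub>R a + 3 *\<^sub>R b) > 0" if "\<alpha> \<in> {a, b}" for \<alpha>
    using that ab by (auto simp: inner_add_right inner_commute[of b a])
  ultimately obtain w where w: "orthogonal_transformation w" "w ` R = R"
    "\<And>\<alpha>. \<alpha> \<in> {a, b} \<Longrightarrow> v \<bullet> w \<alpha> > 0"
    using ex_dominant_isometry[OF R(1), of "{a, b}" v "5 *\<^sub>R a + 3 *\<^sub>R b"] v(1) by blast
  have lin: "linear w" and iso: "\<And>x y. w x \<bullet> w y = x \<bullet> y"
    using w(1) by (auto simp: orthogonal_transformation_def)
  define f where "f = w a"
  define g where "g = w b"
  have pos: "w ` g2_positive a b = g2_positive f g"
    by (simp add: g2_positive_def f_def g_def linear_add[OF lin] linear_cmul[OF lin])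
  have "w ` uminus ` g2_positive a b = uminus ` w ` g2_positive a b"
    by (simp add: image_image linear_neg[OF lin])
  then have R_fg: "R = g2_positive f g \<union> uminus ` g2_positive f g"
    using w(2) unfolding R_ab image_Un pos by simp
  have fg: "v \<bullet> f > 0" "v \<bullet> g > 0" using w(3) by (simp_all add: f_def g_def)
  have "v \<bullet> \<alpha> > 0" if "\<alpha> \<in> g2_positive f g" for \<alpha>
    using that fg by (auto simp: g2_positive_def inner_add_right)
  then have Rp: "Rp = g2_positive f g"
    by (rule positive_roots_eq[OF R_fg v(2)])
  have in_fg: "f \<bullet> f = a \<bullet> a" "g \<bullet> g = 3 * (a \<bullet> a)" "f \<bullet> g = - (3/2) * (a \<bullet> a)" "g \<bullet> f = - (3/2) * (a \<bullet> a)"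
    using ab by (simp_all add: f_def g_def iso inner_commute[of b a])
  have "table_roots R Rp (g2_vec f g) g2_form ((a \<bullet> a) / 2) 2 3 g2_table"
  proof
    show "g2_vec f g x \<bullet> g2_vec f g y = (a \<bullet> a) / 2 * of_int (g2_form x y)" for x y
      by (cases x; cases y) (simp add: g2_vec_def inner_add_left inner_add_right in_fg algebra_simps)
  qed (use ab(1) R_fg Rp g2_valid in \<open>simp_all add: g2_positive_eq\<close>)
  then show thesis by (rule that)
qed

section \<open>Type \<open>F\<^sub>4\<close>\<close>

definition f4_roots :: "(nat \<Rightarrow> 'a::euclidean_space) \<Rightarrow> 'a set" where
  "f4_roots e = {s *\<^sub>R e i | s i. s \<in> {1, -1} \<and> i < 4}
       \<union> {s *\<^sub>R e i + t *\<^sub>R e j | s t i j. s \<in> {1, -1} \<and> t \<in> {1, -1} \<and> i < j \<and> j < 4}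
       \<union> {(1/2) *\<^sub>R (\<Sum>i<4. s i *\<^sub>R e i) | s. \<forall>i<4. s i \<in> {1, -1}}"

lemma type_F4_iff: "type_F4 R \<longleftrightarrow> (\<exists>e. orthogonal_frame 4 e \<and> R = f4_roots e)"
  by (simp only: type_F4_def f4_roots_def)

lemma f4_roots_isometry:
  assumes "linear w"
  shows "w ` f4_roots e = f4_roots (\<lambda>i. w (e i))"
proof -
  have "w ` f4_roots e = {w (s *\<^sub>R e i) | s i. s \<in> {1, -1} \<and> i < 4}
       \<union> {w (s *\<^sub>R e i + t *\<^sub>R e j) | s t i j. s \<in> {1, -1} \<and> t \<in> {1, -1} \<and> i < j \<and> j < 4}
       \<union> {w ((1/2) *\<^sub>R (\<Sum>i<4. s i *\<^sub>R e i)) | s. \<forall>i<4. s i \<in> {1, -1}}"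
    unfolding f4_roots_def by blast
  then show ?thesis
    by (simp only: f4_roots_def linear_cmul[OF assms] linear_add[OF assms] linear_sum[OF assms])
qed

definition f4_vec :: "(nat \<Rightarrow> 'a::euclidean_space) \<Rightarrow> int \<times> int \<times> int \<times> int \<Rightarrow> 'a" where
  "f4_vec e = (\<lambda>(a, b, c, d). (1/2) *\<^sub>R (of_int a *\<^sub>R e 0 + of_int b *\<^sub>R e 1 + of_int c *\<^sub>R e 2 + of_int d *\<^sub>R e 3))"

lemma sum_4: "(\<Sum>i<4. h i) = h 0 + h 1 + h 2 + h (3::nat)"
  by (simp add: eval_nat_numeral)

lemma less_4: "i < 4 \<longleftrightarrow> i = 0 \<or> i = 1 \<or> i = 2 \<or> i = (3::nat)"
  by auto

definition f4_positive_coords :: "(int \<times> int \<times> int \<times> int) set" where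
  "f4_positive_coords = fst ` set f4_table"

lemmas f4_positive_coords = f4_positive_coords_def[unfolded f4_table_def, simplified]

text \<open>Of two opposite roots the table lists the one whose last nonzero coordinate is positive.
  The signs of the model are made integers so that this is a finite check.\<close>

lemma f4_roots_coords:
  assumes "\<alpha> \<in> f4_roots e"
  shows "\<alpha> \<in> f4_vec e ` f4_positive_coords \<or> - \<alpha> \<in> f4_vec e ` f4_positive_coords"
proof -
  have *: "\<alpha> \<in> f4_vec e ` f4_positive_coords \<or> - \<alpha> \<in> f4_vec e ` f4_positive_coords"
    if "\<alpha> = f4_vec e (a, b, c, d)" "(a, b, c, d) \<in> f4_positive_coords \<or> (-a, -b, -c, -d) \<in> f4_positive_coords" for a b c d
  proof -
    have "- \<alpha> = f4_vec e (-a, -b, -c, -d)" by (simp add: that(1) f4_vec_def algebra_simps)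
    then show ?thesis using that by blast
  qed
  from assms consider
      s i where "s \<in> {1, -1}" "i < 4" "\<alpha> = s *\<^sub>R e i"
    | s t i j where "s \<in> {1, -1}" "t \<in> {1, -1}" "i < j" "j < 4" "\<alpha> = s *\<^sub>R e i + t *\<^sub>R e j"
    | s where "\<forall>i<4. s i \<in> {1, -1}" "\<alpha> = (1/2) *\<^sub>R (\<Sum>i<4. s i *\<^sub>R e i)"
    unfolding f4_roots_def by blast
  then show ?thesis
  proof cases
    case 1
    obtain \<sigma> :: int where \<sigma>: "s = of_int \<sigma>" "\<sigma> = 1 \<or> \<sigma> = -1"
      using 1(1) by (metis insertE of_int_1 of_int_minus singletonD)
    let ?c = "\<lambda>k. if k = i then 2 * \<sigma> else 0"
    show ?thesis
      by (rule *[of "?c 0" "?c 1" "?c 2" "?c 3"])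
        (use 1(2,3) \<sigma> in \<open>auto simp: less_4 f4_vec_def f4_positive_coords\<close>)
  next
    case 2
    obtain \<sigma> :: int where \<sigma>: "s = of_int \<sigma>" "\<sigma> = 1 \<or> \<sigma> = -1"
      using 2(1) by (metis insertE of_int_1 of_int_minus singletonD)
    obtain \<tau> :: int where \<tau>: "t = of_int \<tau>" "\<tau> = 1 \<or> \<tau> = -1"
      using 2(2) by (metis insertE of_int_1 of_int_minus singletonD)
    note \<alpha>_eq = 2(5)
    have mem:
      "(2 * \<sigma>, 2 * \<tau>, 0, 0) \<in> f4_positive_coords \<or> (- (2 * \<sigma>), - (2 * \<tau>), 0, 0) \<in> f4_positive_coords"
      "(2 * \<sigma>, 0, 2 * \<tau>, 0) \<in> f4_positive_coords \<or> (- (2 * \<sigma>), 0, - (2 * \<tau>), 0) \<in> f4_positive_coords"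
      "(2 * \<sigma>, 0, 0, 2 * \<tau>) \<in> f4_positive_coords \<or> (- (2 * \<sigma>), 0, 0, - (2 * \<tau>)) \<in> f4_positive_coords"
      "(0, 2 * \<sigma>, 2 * \<tau>, 0) \<in> f4_positive_coords \<or> (0, - (2 * \<sigma>), - (2 * \<tau>), 0) \<in> f4_positive_coords"
      "(0, 2 * \<sigma>, 0, 2 * \<tau>) \<in> f4_positive_coords \<or> (0, - (2 * \<sigma>), 0, - (2 * \<tau>)) \<in> f4_positive_coords"
      "(0, 0, 2 * \<sigma>, 2 * \<tau>) \<in> f4_positive_coords \<or> (0, 0, - (2 * \<sigma>), - (2 * \<tau>)) \<in> f4_positive_coords"
      using \<sigma>(2) \<tau>(2) by (elim disjE; simp add: f4_positive_coords)+
    consider "i = 0" "j = 1" | "i = 0" "j = 2" | "i = 0" "j = 3" | "i = 1" "j = 2" | "i = 1" "j = 3" | "i = 2" "j = 3"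
      using 2(3,4) less_trans[OF 2(3,4)] unfolding less_4 by auto
    then show ?thesis
    proof cases
      case 1
      then show ?thesis
        using *[of "2 * \<sigma>" "2 * \<tau>" 0 0] mem(1) \<alpha>_eq
        by (simp add: f4_vec_def scaleR_add_right \<sigma>(1) \<tau>(1))
    next
      case 2
      then show ?thesis
        using *[of "2 * \<sigma>" 0 "2 * \<tau>" 0] mem(2) \<alpha>_eq
        by (simp add: f4_vec_def scaleR_add_right \<sigma>(1) \<tau>(1))
    next
      case 3
      then show ?thesis
        using *[of "2 * \<sigma>" 0 0 "2 * \<tau>"] mem(3) \<alpha>_eq
        by (simp add: f4_vec_def scaleR_add_right \<sigma>(1) \<tau>(1))
    next
      case 4
      then show ?thesis
        using *[of 0 "2 * \<sigma>" "2 * \<tau>" 0] mem(4) \<alpha>_eq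
        by (simp add: f4_vec_def scaleR_add_right \<sigma>(1) \<tau>(1))
    next
      case 5
      then show ?thesis
        using *[of 0 "2 * \<sigma>" 0 "2 * \<tau>"] mem(5) \<alpha>_eq
        by (simp add: f4_vec_def scaleR_add_right \<sigma>(1) \<tau>(1))
    next
      case 6
      then show ?thesis
        using *[of 0 0 "2 * \<sigma>" "2 * \<tau>"] mem(6) \<alpha>_eq
        by (simp add: f4_vec_def scaleR_add_right \<sigma>(1) \<tau>(1))
    qed
  next
    case 3
    have "\<exists>\<sigma>::int. s i = of_int \<sigma> \<and> (\<sigma> = 1 \<or> \<sigma> = -1)" if "i < 4" for i
      using 3(1) that by (metis insertE of_int_1 of_int_minus singletonD)
    then obtain \<sigma> :: "nat \<Rightarrow> int" where \<sigma>: "\<And>i. i < 4 \<Longrightarrow> s i = of_int (\<sigma> i)" "\<And>i. i < 4 \<Longrightarrow> \<sigma> i = 1 \<or> \<sigma> i = -1"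
      by metis
    have signs: "\<sigma> 0 = 1 \<or> \<sigma> 0 = -1" "\<sigma> 1 = 1 \<or> \<sigma> 1 = -1" "\<sigma> 2 = 1 \<or> \<sigma> 2 = -1" "\<sigma> 3 = 1 \<or> \<sigma> 3 = -1"
      by (simp_all add: \<sigma>(2))
    show ?thesis
    proof (rule *[of "\<sigma> 0" "\<sigma> 1" "\<sigma> 2" "\<sigma> 3"])
      show "\<alpha> = f4_vec e (\<sigma> 0, \<sigma> 1, \<sigma> 2, \<sigma> 3)"
        by (simp add: 3(2) sum_4 f4_vec_def \<sigma>(1))
      show "(\<sigma> 0, \<sigma> 1, \<sigma> 2, \<sigma> 3) \<in> f4_positive_coords \<or>
          (- \<sigma> 0, - \<sigma> 1, - \<sigma> 2, - \<sigma> 3) \<in> f4_positive_coords"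
        using signs by (elim disjE; simp add: f4_positive_coords)
    qed
  qed
qed

text \<open>As the last nonzero coordinate is positive, the roots with two terms have one free sign,
  and the half sums end in 1.\<close>

lemma f4_vec_in_roots:
  assumes "x \<in> f4_positive_coords"
  shows "f4_vec e x \<in> f4_roots e"
proof -
  define A where "A = {s *\<^sub>R e i | s i. s \<in> {1, -1} \<and> i < 4}"
  define B where "B = {s *\<^sub>R e i + t *\<^sub>R e j | s t i j. s \<in> {1, -1} \<and> t \<in> {1, -1} \<and> i < j \<and> j < 4}"
  define C where "C = {(1/2) *\<^sub>R (\<Sum>i<4. s i *\<^sub>R e i) | s. \<forall>i<4. s i \<in> {1, -1}}"
  have A: "1 *\<^sub>R e i \<in> A" if "i < 4" for i
    unfolding A_def using that by blast
  have B: "s *\<^sub>R e i + 1 *\<^sub>R e j \<in> B" if "s \<in> {1, -1}" "i < j" "j < 4" for s i j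
    unfolding B_def using that by blast
  have C: "(1/2) *\<^sub>R (\<Sum>i<4. s i *\<^sub>R e i) \<in> C" if "\<forall>i<4. s i \<in> {1, -1}" for s
    unfolding C_def using that by blast
  have A': "f4_vec e (2, 0, 0, 0) \<in> A" "f4_vec e (0, 2, 0, 0) \<in> A" "f4_vec e (0, 0, 2, 0) \<in> A"
    "f4_vec e (0, 0, 0, 2) \<in> A"
    using A[of 0] A[of 1] A[of 2] A[of 3] by (simp_all add: f4_vec_def)
  have B': "f4_vec e (2 * \<sigma>, 2, 0, 0) \<in> B" "f4_vec e (2 * \<sigma>, 0, 2, 0) \<in> B" "f4_vec e (2 * \<sigma>, 0, 0, 2) \<in> B"
    "f4_vec e (0, 2 * \<sigma>, 2, 0) \<in> B" "f4_vec e (0, 2 * \<sigma>, 0, 2) \<in> B" "f4_vec e (0, 0, 2 * \<sigma>, 2) \<in> B"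
    if "real_of_int \<sigma> \<in> {1, -1}" for \<sigma>
    using B[OF that, of 0 1] B[OF that, of 0 2] B[OF that, of 0 3] B[OF that, of 1 2] B[OF that, of 1 3]
      B[OF that, of 2 3]
    by (simp_all add: f4_vec_def scaleR_add_right)
  have C': "f4_vec e (a, b, c, 1) \<in> C"
    if "real_of_int a \<in> {1, -1}" "real_of_int b \<in> {1, -1}" "real_of_int c \<in> {1, -1}" for a b c
  proof -
    define h where "h i = (if i = 0 then of_int a else if i = 1 then of_int b else if i = 2 then of_int c else 1 :: real)"
      for i :: nat
    have "f4_vec e (a, b, c, 1) = (1/2) *\<^sub>R (\<Sum>i<4. h i *\<^sub>R e i)"
      by (simp add: f4_vec_def sum_4 h_def)
    moreover have "\<forall>i<4. h i \<in> {1, -1}" using that by (auto simp: h_def)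
    ultimately show ?thesis using C[of h] by (simp only:)
  qed
  have "f4_vec e x \<in> A \<or> f4_vec e x \<in> B \<or> f4_vec e x \<in> C"
    using assms unfolding f4_positive_coords insert_iff empty_iff
    by (elim disjE) (use A' B'[of 1] B'[of "-1"] C' in simp_all)
  then show ?thesis
    unfolding f4_roots_def A_def B_def C_def by blast
qed

lemma f4_table_roots:
  assumes R: "root_system R" "positive_roots R Rp" and F4: "type_F4 R"
  obtains vec \<kappa> where "table_roots R Rp vec f4_form \<kappa> 4 2 f4_table"
proof -
  obtain e where e: "orthogonal_frame 4 e" and R_e: "R = f4_roots e"
    using F4 unfolding type_F4_iff by blast
  obtain c where c: "c > 0" "\<And>i j. i < 4 \<Longrightarrow> j < 4 \<Longrightarrow> e i \<bullet> e j = (if i = j then c else 0)"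
    using e unfolding orthogonal_frame_def by blast
  obtain v where v: "\<And>\<alpha>. \<alpha> \<in> R \<Longrightarrow> v \<bullet> \<alpha> \<noteq> 0" "Rp = {\<alpha> \<in> R. v \<bullet> \<alpha> > 0}"
    using R(2) unfolding positive_roots_def by blast
  define \<Delta> where "\<Delta> = f4_vec e ` {(2, 0, 0, 0), (-2, 2, 0, 0), (0, -2, 2, 0), (-1, -1, -1, 1)}"
  have "\<Delta> \<subseteq> R"
    unfolding \<Delta>_def R_e by (auto intro!: f4_vec_in_roots simp: f4_positive_coords)
  \<comment> \<open>The vector with coordinates 1, 2, 3, 8 has the same inner product
    \<open>c\<close> with all four simple roots.\<close>
  moreover have "\<alpha> \<bullet> (1 *\<^sub>R e 0 + 2 *\<^sub>R e 1 + 3 *\<^sub>R e 2 + 8 *\<^sub>R e 3) > 0" if "\<alpha> \<in> \<Delta>" for \<alpha>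
    using that c by (auto simp: \<Delta>_def f4_vec_def inner_add_left inner_add_right inner_diff_left inner_minus_left)
  ultimately obtain w where w: "orthogonal_transformation w" "w ` R = R"
    "\<And>\<alpha>. \<alpha> \<in> \<Delta> \<Longrightarrow> v \<bullet> w \<alpha> > 0"
    using ex_dominant_isometry[OF R(1), of \<Delta> v "1 *\<^sub>R e 0 + 2 *\<^sub>R e 1 + 3 *\<^sub>R e 2 + 8 *\<^sub>R e 3"] v(1) by blast
  have lin: "linear w" and iso: "\<And>x y. w x \<bullet> w y = x \<bullet> y"
    using w(1) by (auto simp: orthogonal_transformation_def)
  define f where "f i = w (e i)" for i
  have w_vec: "w (f4_vec e x) = f4_vec f x" for x
    by (cases x) (simp add: f4_vec_def f_def linear_add[OF lin] linear_cmul[OF lin])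
  have R_f: "R = f4_roots f"
    using w(2) f4_roots_isometry[OF lin, of e] unfolding R_e f_def by simp
  have simple: "v \<bullet> f4_vec f (2, 0, 0, 0) > 0" "v \<bullet> f4_vec f (-2, 2, 0, 0) > 0"
    "v \<bullet> f4_vec f (0, -2, 2, 0) > 0" "v \<bullet> f4_vec f (-1, -1, -1, 1) > 0"
    unfolding w_vec[symmetric] by (auto intro!: w(3) simp: \<Delta>_def)
  \<comment> \<open>Every tabulated root is a nonnegative combination of these four.\<close>
  then have pos: "v \<bullet> f4_vec f x > 0" if "x \<in> f4_positive_coords" for x
    using that by (auto simp: f4_positive_coords f4_vec_def inner_add_right inner_diff_right)
  have "R = f4_vec f ` f4_positive_coords \<union> uminus ` f4_vec f ` f4_positive_coords"
  proof (intro equalityI subsetI)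
    fix \<alpha> assume "\<alpha> \<in> R"
    then show "\<alpha> \<in> f4_vec f ` f4_positive_coords \<union> uminus ` f4_vec f ` f4_positive_coords"
      using f4_roots_coords[of \<alpha> f] R_f by (metis UnCI image_eqI minus_minus)
  next
    fix \<alpha> assume "\<alpha> \<in> f4_vec f ` f4_positive_coords \<union> uminus ` f4_vec f ` f4_positive_coords"
    then show "\<alpha> \<in> R"
      using f4_vec_in_roots[of _ f] root_system_uminus[OF R(1)] R_f by blast
  qed
  note R_Un = this
  have Rp: "Rp = f4_vec f ` f4_positive_coords"
    by (rule positive_roots_eq[OF R_Un v(2)]) (use pos in blast)
  have in_f: "i < 4 \<Longrightarrow> j < 4 \<Longrightarrow> f i \<bullet> f j = (if i = j then c else 0)" for i j
    using c(2) by (simp add: f_def iso)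
  \<comment> \<open>The scale \<open>c / 4\<close> undoes the doubling of the coordinates in both
    arguments.\<close>
  have "table_roots R Rp (f4_vec f) f4_form (c / 4) 4 2 f4_table"
  proof
    show "f4_vec f x \<bullet> f4_vec f y = c / 4 * of_int (f4_form x y)" for x y
      by (cases x; cases y) (simp add: f4_vec_def inner_add_left inner_add_right in_f algebra_simps)
  qed (use c(1) R_Un Rp f4_valid in \<open>simp_all add: f4_positive_coords_def\<close>)
  then show thesis by (rule that)
qed

section \<open>Assembly of the statements for all types\<close>

lemma g2_part:
  assumes "root_system R" "positive_roots R Rp" "type_G2 R"
  shows "positive_expos nu_one R Rp =
          {# (2, 0, 0), (0, 2, 0), (2, 0, 1), (0, 2, 1),
             (3, 3, 0), (3, 3, 1), (3, 3, 2), (3, 3, 3), (3, 3, 4), (3, 3, 5) #}"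
    and "negative_expos nu_one R Rp = {# (1, 0, 0), (0, 1, 0), (1, 1, 0), (1, 1, 1) #}"
    and "proportional_pairs (rational_expos nu_one R Rp) = {}"
proof -
  obtain vec \<kappa> where T: "table_roots R Rp vec g2_form \<kappa> 2 3 g2_table"
    using g2_table_roots[OF assms] .
  interpret table_roots R Rp vec g2_form \<kappa> 2 3 g2_table by (rule T)
  note pn = affine_expos[OF g2_certificate]
  have upt: "[0..<6] = [0, 1, 2, 3, 4, 5]" "[0..<2] = [0, 1]" by (simp_all add: upt_rec)
  show "positive_expos nu_one R Rp =
          {# (2, 0, 0), (0, 2, 0), (2, 0, 1), (0, 2, 1),
             (3, 3, 0), (3, 3, 1), (3, 3, 2), (3, 3, 3), (3, 3, 4), (3, 3, 5) #}"
    unfolding pn by (simp add: g2_num_def strings_def nat_expo_def upt add_mset_commute)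
  show "negative_expos nu_one R Rp = {# (1, 0, 0), (0, 1, 0), (1, 1, 0), (1, 1, 1) #}"
    unfolding pn by (simp add: g2_den_def strings_def nat_expo_def upt add_mset_commute)
  have "distinct g2_rational" "list_all (\<lambda>e. e \<noteq> (0, 0, 0)) g2_rational"
    by (simp_all add: g2_rational_def)
  then show "proportional_pairs (rational_expos nu_one R Rp) = {}"
    unfolding rational[OF g2_certificate] by (simp only: proportional_pairs_expos[OF _ _ g2_parallel]) simp
qed

lemma f4_part:
  assumes "root_system R" "positive_roots R Rp" "type_F4 R"
  shows "positive_expos nu_one R Rp =
          (\<Sum>p\<in>#{# (2,0), (0,2), (3,0), (0,3), (2,4), (4,2), (4,4), (6,6) #}. expo_string p)"
    and "negative_expos nu_one R Rp =
          (\<Sum>p\<in>#{# (1,0), (0,1), (1,0), (0,1), (1,2), (2,1), (1,1), (3,3) #}. expo_string p)"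
    and "proportional_pairs (rational_expos nu_one R Rp) =
          {{# (4, 4, 2), (6, 6, 3) #}, {# (4, 4, 6), (6, 6, 9) #}}"
proof -
  obtain vec \<kappa> where T: "table_roots R Rp vec f4_form \<kappa> 4 2 f4_table"
    using f4_table_roots[OF assms] .
  interpret table_roots R Rp vec f4_form \<kappa> 4 2 f4_table by (rule T)
  note pn = affine_expos[OF f4_certificate]
  show "positive_expos nu_one R Rp =
          (\<Sum>p\<in>#{# (2,0), (0,2), (3,0), (0,3), (2,4), (4,2), (4,4), (6,6) #}. expo_string p)"
    unfolding pn expos_strings_sum by (simp add: f4_num_def add_ac)
  show "negative_expos nu_one R Rp =
          (\<Sum>p\<in>#{# (1,0), (0,1), (1,0), (0,1), (1,2), (2,1), (1,1), (3,3) #}. expo_string p)"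
    unfolding pn expos_strings_sum by (simp add: f4_den_def add_ac)
  have "distinct f4_rational" "list_all (\<lambda>e. e \<noteq> (0, 0, 0)) f4_rational"
    by (simp_all add: f4_rational_def)
  then show "proportional_pairs (rational_expos nu_one R Rp) =
          {{# (4, 4, 2), (6, 6, 3) #}, {# (4, 4, 6), (6, 6, 9) #}}"
    unfolding rational[OF f4_certificate]
    by (simp only: proportional_pairs_expos[OF _ _ f4_parallel])
      (simp add: nat_expo_def add_mset_commute insert_commute)
qed

lemma regular_and_dual_all:
  assumes R: "root_system R" "positive_roots R Rp"
    and type: "(\<exists>n\<ge>2. type_B n R \<or> type_C n R) \<or> type_F4 R \<or> type_G2 R"
  shows "regular_and_dual R Rp"
proof -
  from type consider n where "n \<ge> 2" "type_B n R" | n where "n \<ge> 2" "type_C n R" | "type_F4 R" | "type_G2 R"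
    by blast
  then show ?thesis
  proof cases
    case 1
    obtain e c where B: "bc_B n e c R" "Rp = bc_positive 1 n e"
      using ex_bc_B[OF R 1(2,1)] .
    interpret bc_B n e c R by (rule B(1))
    show ?thesis unfolding B(2) by (rule regular_and_dual_B)
  next
    case 2
    obtain e c where C: "bc_C n e c R" "Rp = bc_positive 2 n e"
      using ex_bc_C[OF R 2(2,1)] .
    interpret bc_C n e c R by (rule C(1))
    show ?thesis unfolding C(2) by (rule regular_and_dual_C)
  next
    case 3
    obtain vec \<kappa> where T: "table_roots R Rp vec f4_form \<kappa> 4 2 f4_table"
      using f4_table_roots[OF R 3] .
    show ?thesis by (rule table_roots.regular_and_dual_table[OF T f4_certificate])
  next
    case 4
    obtain vec \<kappa> where T: "table_roots R Rp vec g2_form \<kappa> 2 3 g2_table"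
      using g2_table_roots[OF R 4] .
    show ?thesis by (rule table_roots.regular_and_dual_table[OF T g2_certificate])
  qed
qed

theorem theorem8p2:
  fixes R Rp :: "'a::euclidean_space set"
  assumes "root_system R" and "reduced_roots R" and "irreducible_roots R"
    and "positive_roots R Rp"
  shows
    "((\<exists>n\<ge>2. type_B n R \<or> type_C n R) \<or> type_F4 R \<or> type_G2 R \<longrightarrow>
        (\<forall>\<alpha>\<in>Rp. ht Rp \<alpha> \<in> \<nat>) \<and>
        (\<forall>\<nu>\<in>{nu_one, nu_root R}.
           \<forall>e\<in># num_expos \<nu> R Rp + den_expos \<nu> R Rp. e \<in> \<nat> \<times> \<nat> \<times> \<nat> \<and> e \<noteq> 0) \<and>
        regular (Pi_hat R Rp q_ind q_lng q_sht) \<and>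
        rel_mset proportional (rational_expos nu_one R Rp) (rational_expos (nu_root R) R Rp) \<and>
        Pi_hat R Rp q_ind q_lng q_sht = Pi_hat (coroot ` R) (coroot ` Rp) q_ind q_sht q_lng) \<and>
     (\<forall>n\<ge>2. type_B n R \<longrightarrow>
        Pi_hat R Rp q_ind q_lng q_sht =
          ((\<Prod>m=2..n. \<Prod>j=0..m-1. 1 - q_lng^m * q_ind^j) *
           (\<Prod>m=0..n-1. \<Prod>j=0..2*m+1. 1 - q_sht^2 * q_lng^(2*m) * q_ind^j)) /
          ((1 - q_lng)^(n-1) *
           (\<Prod>m=0..n-1. \<Prod>j=0..m. 1 - q_sht * q_lng^m * q_ind^j)) \<and>
        real (size (negative_expos nu_one R Rp)) = (real n ^ 2 + 3 * real n - 2) / 2 \<and>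
        proportional_pairs (rational_expos nu_one R Rp) =
          {{# (real m, 0, real j), l *\<^sub>R (real m, 0, real j) #} | m j l.
             l \<in> \<rat> \<and> l > 1 \<and> l * real m \<in> \<nat> \<and> l * real j \<in> \<nat> \<and>
             m > 1 \<and> j < m \<and> real j / real m \<notin> \<int> \<and> l * real m \<le> real n}) \<and>
     (type_G2 R \<longrightarrow>
        positive_expos nu_one R Rp =
          {# (2, 0, 0), (0, 2, 0), (2, 0, 1), (0, 2, 1),
             (3, 3, 0), (3, 3, 1), (3, 3, 2), (3, 3, 3), (3, 3, 4), (3, 3, 5) #} \<and>
        negative_expos nu_one R Rp = {# (1, 0, 0), (0, 1, 0), (1, 1, 0), (1, 1, 1) #} \<and>
        size (positive_expos nu_one R Rp) = 10 \<and> size (negative_expos nu_one R Rp) = 4 \<and>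
        proportional_pairs (rational_expos nu_one R Rp) = {}) \<and>
     (type_F4 R \<longrightarrow>
        positive_expos nu_one R Rp =
          (\<Sum>p\<in>#{# (2,0), (0,2), (3,0), (0,3), (2,4), (4,2), (4,4), (6,6) #}. expo_string p) \<and>
        negative_expos nu_one R Rp =
          (\<Sum>p\<in>#{# (1,0), (0,1), (1,0), (0,1), (1,2), (2,1), (1,1), (3,3) #}. expo_string p) \<and>
        size (positive_expos nu_one R Rp) = 42 \<and> size (negative_expos nu_one R Rp) = 18 \<and>
        proportional_pairs (rational_expos nu_one R Rp) =
          {{# (4, 4, 2), (6, 6, 3) #}, {# (4, 4, 6), (6, 6, 9) #}})"
  (is "(?types \<longrightarrow> ?i) \<and> (\<forall>n\<ge>2. type_B n R \<longrightarrow> ?ii n) \<and> (_ \<longrightarrow> ?iii) \<and> (_ \<longrightarrow> ?iv)")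
proof -
  note R = assms(1,4)
  have "?ii n" if n: "n \<ge> 2" and tB: "type_B n R" for n
  proof -
    obtain e c where B: "bc_B n e c R" "Rp = bc_positive 1 n e"
      using ex_bc_B[OF R tB n] .
    interpret bc_B n e c R by (rule B(1))
    show ?thesis
      unfolding B(2) rational negative quotient
      by (intro conjI bn_quotient[OF n] size_bn_neg[OF n] bn_proportional_pairs)
  qed
  moreover have ?iii if "type_G2 R"
    using g2_part[OF R that] by simp
  moreover have ?iv if "type_F4 R"
    using f4_part[OF R that] by (simp add: expo_string_def)
  ultimately show ?thesis
    using regular_and_dual_all[OF R] unfolding regular_and_dual_def by blast
qed

end
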